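(* Let $H$ be a complex Hilbert space and let $A$ be an operator in $H$ which can be represented in the form $A=C+T$, where $C$ is a non-negative compact operator in $H$ such that $\lim_{n\to\infty} n^2 s_n(C)=\infty$ and, for some real numbers $\alpha$ and $a$ with $0<\alpha<2$ and $0<a<\infty$, $\lim_{n\to\infty} n^{\alpha}s_n(C)=a$; and where $T\in\mathfrak{S}_q(H)$ for all $q$ with $0<q\le \frac{1}{\alpha}$. Then $A$ is not a Volterra operator.
   Context: For a compact operator $T$ in a Hilbert space $H$, the $s$-numbers $s_n(T)$, $n=1,2,\dots$, are the eigenvalues of $|T|=(T^*T)^{1/2}$, counted with multiplicity and arranged in non-increasing order. For $0<p<\infty$, $\mathfrak{S}_p(H)$ denotes the set of all compact operators $T$ in $H$ with $\sum_{j=1}^{\infty}s_j^p(T)<\infty$. A bounded operator is called quasinilpotent if its spectrum consists of the single point zero. An operator $A$ in $H$ is called a Volterra operator if $A$ is compact and quasinilpotent. A non-negative operator is a self-adjoint operator $C$ with $(Cf,f)\ge 0$ for all $f$. *)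

theory Defs
  imports "HOL-Analysis.Analysis"
begin

class scaleC =
  fixes scaleC :: "complex \<Rightarrow> 'a \<Rightarrow> 'a"  (infixr "*\<^sub>C" 75)

(* The real Hilbert space structure of the library is compatible with the complex one: real scalars
   act as before, and the real inner product is the real part of the complex one, so that
   norm x = sqrt (Re (cinner x x)).  The complex inner product is linear in its first argument. *)
class complex_hilbert_space = real_inner + complete_space + scaleC +
  fixes cinner :: "'a \<Rightarrow> 'a \<Rightarrow> complex"
  assumes scaleC_add_right: "c *\<^sub>C (x + y) = c *\<^sub>C x + c *\<^sub>C y"
    and scaleC_add_left: "(c + d) *\<^sub>C x = c *\<^sub>C x + d *\<^sub>C x"
    and scaleC_scaleC: "c *\<^sub>C (d *\<^sub>C x) = (c * d) *\<^sub>C x"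
    and scaleC_of_real: "complex_of_real r *\<^sub>C x = r *\<^sub>R x"
    and cinner_commute: "cinner x y = cnj (cinner y x)"
    and cinner_add_left: "cinner (x + y) z = cinner x z + cinner y z"
    and cinner_scaleC_left: "cinner (c *\<^sub>C x) y = c * cinner x y"
    and Re_cinner: "Re (cinner x y) = inner x y"

lemma scaleC_one: "1 *\<^sub>C x = (x :: 'a :: complex_hilbert_space)"
  using scaleC_of_real[of 1 x] by simp

global_interpretation complex_vector:
  vector_space "scaleC :: complex \<Rightarrow> 'a \<Rightarrow> 'a :: complex_hilbert_space"
  by unfold_locales
    (simp_all add: scaleC_add_right scaleC_add_left scaleC_scaleC scaleC_one)

lemma cinner_self: "cinner x x = complex_of_real ((norm x)\<^sup>2)"
  for x :: "'a :: complex_hilbert_space"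
proof (rule complex_eqI)
  show "Re (cinner x x) = Re (complex_of_real ((norm x)\<^sup>2))"
    by (simp add: Re_cinner power2_norm_eq_inner)
  have "Im (cinner x x) = - Im (cinner x x)"
    by (subst cinner_commute) simp
  then show "Im (cinner x x) = Im (complex_of_real ((norm x)\<^sup>2))"
    by simp
qed

instantiation complex :: complex_hilbert_space
begin

definition scaleC_complex :: "complex \<Rightarrow> complex \<Rightarrow> complex" where
  "scaleC_complex c x = c * x"

definition cinner_complex :: "complex \<Rightarrow> complex \<Rightarrow> complex" where
  "cinner_complex x y = x * cnj y"

instance
  by standard
    (simp_all add: scaleC_complex_def cinner_complex_def inner_complex_def algebra_simps
      scaleR_conv_of_real)

end

definition bounded_clinear :: "('a :: complex_hilbert_space \<Rightarrow> 'a) \<Rightarrow> bool" where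
  "bounded_clinear T \<longleftrightarrow> bounded_linear T \<and> (\<forall>c x. T (c *\<^sub>C x) = c *\<^sub>C T x)"

definition compact_operator :: "('a :: complex_hilbert_space \<Rightarrow> 'a) \<Rightarrow> bool" where
  "compact_operator T \<longleftrightarrow>
     bounded_clinear T \<and> (\<forall>B. bounded B \<longrightarrow> compact (closure (T ` B)))"

definition cadjoint :: "('a :: complex_hilbert_space \<Rightarrow> 'a) \<Rightarrow> 'a \<Rightarrow> 'a" where
  "cadjoint T = (THE S. bounded_clinear S \<and> (\<forall>x y. cinner (T x) y = cinner x (S y)))"

definition self_adjoint :: "('a :: complex_hilbert_space \<Rightarrow> 'a) \<Rightarrow> bool" where
  "self_adjoint T \<longleftrightarrow> bounded_clinear T \<and> cadjoint T = T"

definition nonneg_operator :: "('a :: complex_hilbert_space \<Rightarrow> 'a) \<Rightarrow> bool" where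
  "nonneg_operator T \<longleftrightarrow> self_adjoint T \<and> (\<forall>f. cinner (T f) f \<in> \<real>\<^sub>\<ge>\<^sub>0)"

(* The modulus: the unique non-negative square root of the product of the adjoint of T with T. *)
definition abs_operator :: "('a :: complex_hilbert_space \<Rightarrow> 'a) \<Rightarrow> 'a \<Rightarrow> 'a" where
  "abs_operator T = (THE S. nonneg_operator S \<and> S \<circ> S = cadjoint T \<circ> T)"

definition eigenspace :: "('a :: complex_hilbert_space \<Rightarrow> 'a) \<Rightarrow> complex \<Rightarrow> 'a set" where
  "eigenspace T z = {x. T x = z *\<^sub>C x}"

(* s 0, s 1, ... lists the eigenvalues of the non-negative compact operator S in non-increasing
   order: each positive number occurs exactly as often as its multiplicity (zero times if it is
   not an eigenvalue).  As usual, the list continues with zeros if there are only finitely many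
   positive eigenvalues, and contains no zeros otherwise.  Finiteness is demanded separately
   because card is 0 on infinite sets; dim is 0 on infinite-dimensional spaces, but for compact S
   the eigenspaces of non-zero eigenvalues are finite-dimensional. *)
definition eigenvalue_sequence ::
    "('a :: complex_hilbert_space \<Rightarrow> 'a) \<Rightarrow> (nat \<Rightarrow> real) \<Rightarrow> bool" where
  "eigenvalue_sequence S s \<longleftrightarrow>
     decseq s \<and> (\<forall>n. 0 \<le> s n) \<and>
     (\<forall>\<mu>>0. finite {n. s n = \<mu>} \<and>
       card {n. s n = \<mu>} = complex_vector.dim (eigenspace S (complex_of_real \<mu>)))"

(* Numbered from n = 1; the value at n = 0 is meaningless. *)
definition s_number :: "('a :: complex_hilbert_space \<Rightarrow> 'a) \<Rightarrow> nat \<Rightarrow> real" where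
  "s_number T n = (THE s. eigenvalue_sequence (abs_operator T) s) (n - 1)"

definition schatten_class :: "real \<Rightarrow> ('a :: complex_hilbert_space \<Rightarrow> 'a) set" where
  "schatten_class p =
     {T. compact_operator T \<and> summable (\<lambda>j. s_number T (Suc j) powr p)}"

definition cspectrum :: "('a :: complex_hilbert_space \<Rightarrow> 'a) \<Rightarrow> complex set" where
  "cspectrum T =
     {z. \<not> (\<exists>R. bounded_clinear R \<and>
            (\<forall>x. R (T x - z *\<^sub>C x) = x) \<and> (\<forall>x. T (R x) - z *\<^sub>C R x = x))}"

definition quasinilpotent :: "('a :: complex_hilbert_space \<Rightarrow> 'a) \<Rightarrow> bool" where
  "quasinilpotent T \<longleftrightarrow> bounded_clinear T \<and> cspectrum T = {0}"

definition volterra_operator :: "('a :: complex_hilbert_space \<Rightarrow> 'a) \<Rightarrow> bool" where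
  "volterra_operator A \<longleftrightarrow> compact_operator A \<and> quasinilpotent A"

end

(* Write s_n(T) for the s-numbers of T and l_0 >= l_1 >= ... for the eigenvalues of C.  As T lies in
   S_q for all small q, its s-numbers decay faster than any power, and
     D(z) = det(1 - z (1 - z C)^-1 T) = det(1 - z A) / det(1 - z C)
   satisfies log |D(z)| <= K_p r^p |sin(t/2)|^-p for z = r e^(it) and every p in (0,1).  If A were a
   Volterra operator, det(1 - z A) would have no zeros, so u = -log |D| would be bounded below by
   -K_p r^p |sin(t/2)|^-p while being harmonic except for the masses at the points 1/l_i > 0.
   A bound below by r^p with small p is only compatible with growth of order 1/2: integrate u against
     r^-s f(t),  where f'' + s^2 f = -w <= 0,  w a Fejer kernel and 1/2 < s < 1.
   Outside the origin this test function is superharmonic, and f(0) = max f is positive as soon as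
   s > 1/2 and w is sufficiently concentrated; Green's formula then yields sum l_i^s < infinity,
   which contradicts l_i ~ a i^-alpha if moreover s alpha <= 1, and such an s exists because alpha < 2.
   To avoid infinite determinants, C and T are replaced by finite-rank truncations close to them in
   norm: the eigenvalues of the truncated A then have modulus less than 1/R, which is all that is
   needed on the disc of radius R, and the constants do not depend on the truncation. *)
theory Submission
  imports Defs "HOL-Real_Asymp.Real_Asymp" "Jordan_Normal_Form.Char_Poly"
begin

section \<open>Complex Hilbert spaces and adjoints\<close>

text \<open>Green's formula is carried out one cosine frequency at a time. As u is a finite sum of
  logarithms, each coefficient of ln |1 - mu r e^(it)| solves the Euler equation (r d/dr)^2 j = k^2
  j, except that r j' jumps by 1 at r = 1/mu for mu = l_i; f enters only through its coefficients
  w_k / (k^2 - s^2). The radial factor is r^-s - r^s R^(-2s): vanishing at r = R, it keeps the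
  uncontrolled radial derivative of u out of the boundary term. What remains there contains, by
  Jensen's formula, f(0) times the sum of ln (R l_i), which is moved to the side of the masses.

  A single p cannot work: r^p must be integrable against r^(-s-1) both near 0 (p > s) and near
  infinity (p < s). Hence two exponents p1 > s > p2, both below 1 so that |sin(t/2)|^-p is
  integrable.

  The threshold 1/2 appears because f(0) tends to -(pi/s) cot(pi s) as w concentrates. For the
  determinant, each s-number of T is split into two square roots, one per factor of its rank-one
  term; the Schur complement of the block of C then has row sums 1 + O(tau_k), with constants
  independent of the rank.\<close>

lemma cinner_add_right: "cinner x (y + z) = cinner x y + cinner x z"
  by (metis cinner_add_left cinner_commute complex_cnj_add)

lemma cinner_scaleC_right: "cinner x (c *\<^sub>C y) = cnj c * cinner x y"
  by (metis cinner_commute cinner_scaleC_left complex_cnj_mult)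

lemma cinner_zero_left [simp]: "cinner 0 x = 0"
  using cinner_add_left[of 0 0 x] by simp

lemma cinner_zero_right [simp]: "cinner x 0 = 0"
  using cinner_add_right[of x 0 0] by simp

lemma cinner_minus_left: "cinner (- x) y = - cinner x y"
  using cinner_add_left[of x "- x" y] by (simp add: eq_neg_iff_add_eq_0 add.commute)

lemma cinner_minus_right: "cinner x (- y) = - cinner x y"
  using cinner_add_right[of x y "- y"] by (simp add: eq_neg_iff_add_eq_0 add.commute)

lemma cinner_diff_left: "cinner (x - y) z = cinner x z - cinner y z"
  using cinner_add_left[of x "- y" z] by (simp add: cinner_minus_left)

lemma cinner_diff_right: "cinner x (y - z) = cinner x y - cinner x z"
  using cinner_add_right[of x y "- z"] by (simp add: cinner_minus_right)

lemma cinner_sum_left: "cinner (\<Sum>i\<in>I. f i) y = (\<Sum>i\<in>I. cinner (f i) y)"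
  by (induction I rule: infinite_finite_induct) (simp_all add: cinner_add_left)

lemma cinner_sum_right: "cinner y (\<Sum>i\<in>I. f i) = (\<Sum>i\<in>I. cinner y (f i))"
  by (induction I rule: infinite_finite_induct) (simp_all add: cinner_add_right)

lemma scaleR_eq_scaleC: "r *\<^sub>R x = complex_of_real r *\<^sub>C (x :: 'a :: complex_hilbert_space)"
  by (simp add: scaleC_of_real)

lemma cinner_scaleR_left: "cinner (r *\<^sub>R x) y = of_real r * cinner x y"
  by (simp add: scaleR_eq_scaleC cinner_scaleC_left)

lemma cinner_scaleR_right: "cinner x (r *\<^sub>R y) = of_real r * cinner x y"
  by (simp add: scaleR_eq_scaleC cinner_scaleC_right)

lemma norm_scaleC: "norm (c *\<^sub>C x) = cmod c * norm (x :: 'a :: complex_hilbert_space)"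
proof -
  have "complex_of_real ((norm (c *\<^sub>C x))\<^sup>2) = (c * cnj c) * of_real ((norm x)\<^sup>2)"
    unfolding cinner_self[symmetric] cinner_scaleC_left cinner_scaleC_right by (simp add: mult.assoc)
  also have "c * cnj c = of_real ((cmod c)\<^sup>2)"
    by (simp add: complex_norm_square[symmetric])
  finally have "(norm (c *\<^sub>C x))\<^sup>2 = (cmod c * norm x)\<^sup>2"
    by (simp only: of_real_mult[symmetric] of_real_eq_iff power_mult_distrib)
  then show ?thesis
    by (simp add: power2_eq_iff_nonneg)
qed

text \<open>Rotating the second argument by i exposes the imaginary part. Identities of the real
  \<open>inner\<close> that are stable under complex scalars, and limits of it, thus lift to
  \<open>cinner\<close>.\<close>

lemma cinner_eq_inner: "cinner x y = Complex (inner x y) (inner x (\<i> *\<^sub>C y))"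
  by (simp add: complex_eq_iff Re_cinner[symmetric] cinner_scaleC_right)

text \<open>A phase \<open>c\<close> of modulus 1 makes the inner product real and non-negative;
  then the real Cauchy-Schwarz inequality applies.\<close>

lemma norm_cinner_le: "cmod (cinner x y) \<le> norm x * norm y"
proof (cases "cinner x y = 0")
  case False
  define c where "c = cnj (sgn (cinner x y))"
  have "cinner (c *\<^sub>C x) y = of_real (cmod (cinner x y))"
    using False by (simp add: c_def cinner_scaleC_left sgn_div_norm scaleR_conv_of_real mult.commute
        complex_norm_square power2_eq_square flip: of_real_mult)
      (simp add: field_simps complex_norm_square[symmetric] power2_eq_square)
  then have "cmod (cinner x y) = inner (c *\<^sub>C x) y"
    by (metis Re_cinner Re_complex_of_real)
  also have "\<dots> \<le> norm (c *\<^sub>C x) * norm y"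
    by (rule norm_cauchy_schwarz)
  also have "norm (c *\<^sub>C x) = norm x"
    using False by (simp add: norm_scaleC c_def norm_sgn)
  finally show ?thesis .
qed simp

lemma cinner_ext:
  assumes "\<And>y. cinner x y = cinner z y"
  shows "x = z"
proof -
  have "cinner (x - z) (x - z) = 0"
    using assms[of "x - z"] by (simp add: cinner_diff_left)
  then show ?thesis by (simp add: cinner_self)
qed

lemma cinner_ext_right:
  assumes "\<And>y. cinner y x = cinner y z"
  shows "x = z"
proof (rule cinner_ext)
  fix y
  have "cnj (cinner y x) = cnj (cinner y z)" using assms by simp
  then show "cinner x y = cinner z y" by (simp only: cinner_commute[symmetric])
qed

lemma inner_scaleC_shift: "inner (c *\<^sub>C x) y = inner x (cnj c *\<^sub>C y)"
  for x y :: "'a :: complex_hilbert_space"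
  by (simp add: Re_cinner[symmetric] cinner_scaleC_left cinner_scaleC_right)

lemma bounded_clinearD:
  assumes "bounded_clinear T"
  shows "bounded_linear T" "T (c *\<^sub>C x) = c *\<^sub>C T x"
  using assms by (auto simp: bounded_clinear_def)

text \<open>The representing vector is the minimiser of \<open>J\<close>. Minimising sequences are
  Cauchy by the parallelogram law, and the first variation of \<open>J\<close> at the minimiser is
  the claimed identity.\<close>

lemma riesz_representation:
  fixes f :: "'a :: {real_inner, complete_space} \<Rightarrow> real"
  assumes "bounded_linear f"
  shows "\<exists>x. \<forall>y. f y = inner x y"
proof -
  interpret f: bounded_linear f by fact
  define J where "J x = (norm x)\<^sup>2 / 2 - f x" for x
  obtain M where M: "\<And>x. norm (f x) \<le> norm x * M"
    using f.bounded by blast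
  have bdd: "bdd_below (range J)"
  proof (rule bdd_belowI2)
    fix x
    have "f x \<le> norm x * M" using M[of x] by simp
    moreover have "0 \<le> (norm x - M)\<^sup>2" by simp
    ultimately show "- (M\<^sup>2) / 2 \<le> J x"
      by (simp add: J_def power2_diff)
  qed
  define d where "d = (INF x. J x)"
  have dle: "d \<le> J x" for x
    unfolding d_def by (rule cINF_lower[OF bdd]) simp
  have "\<exists>x. J x < d + 1 / real (Suc n)" for n
  proof -
    have "(INF x. J x) < d + 1 / real (Suc n)" unfolding d_def by simp
    then show ?thesis by (rule cInf_lessD[rotated, THEN bexE]) auto
  qed
  then obtain x where x: "\<And>n. J (x n) < d + 1 / real (Suc n)" by metis
  \<comment> \<open>The parallelogram law in terms of \<open>J\<close>; the linear part
    \<open>f\<close> cancels at the midpoint.\<close>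
  have par: "(norm (a - b))\<^sup>2 / 8 = (J a + J b) / 2 - J ((1 / 2) *\<^sub>R (a + b))" for a b
    by (simp add: J_def f.scaleR f.add power_mult_distrib power2_norm_eq_inner inner_diff_left
        inner_diff_right inner_add_left inner_add_right inner_commute field_simps)
  have dist: "(norm (x m - x n))\<^sup>2 \<le> 8 / real (Suc N)" if "m \<ge> N" "n \<ge> N" for m n N
  proof -
    have *: "J (x k) \<le> d + 1 / real (Suc N)" if "k \<ge> N" for k
    proof -
      have "1 / real (Suc k) \<le> 1 / real (Suc N)" using that by (simp add: frac_le)
      then show ?thesis using x[of k] by linarith
    qed
    have "(norm (x m - x n))\<^sup>2 / 8 \<le> 1 / real (Suc N)"
    proof -
      have "(p + q) / 2 - r \<le> e" if "p \<le> d + e" "q \<le> d + e" "d \<le> r" for p q r e :: real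
        unfolding add_divide_distrib using that by linarith
      from this[OF *[OF that(1)] *[OF that(2)] dle] show ?thesis
        unfolding par .
    qed
    then show ?thesis by simp
  qed
  have "Cauchy x"
  proof (rule metric_CauchyI)
    fix e :: real assume e: "e > 0"
    obtain N where N: "8 / e\<^sup>2 < real N" using reals_Archimedean2 by blast
    then have "8 < real N * e\<^sup>2" using e by (simp add: divide_less_eq)
    also have "\<dots> \<le> real (Suc N) * e\<^sup>2" by (intro mult_right_mono) auto
    finally have "8 / real (Suc N) < e\<^sup>2" by (simp add: divide_less_eq mult.commute)
    then have "(norm (x m - x n))\<^sup>2 < e\<^sup>2" if "m \<ge> N" "n \<ge> N" for m n
      using dist[OF that] by linarith
    then have "norm (x m - x n) < e" if "m \<ge> N" "n \<ge> N" for m n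
      using that e by (meson less_imp_le power_less_imp_less_base)
    then show "\<exists>N. \<forall>m\<ge>N. \<forall>n\<ge>N. dist (x m) (x n) < e"
      by (auto simp: dist_norm)
  qed
  then obtain z where z: "x \<longlonglongrightarrow> z"
    using Cauchy_convergent_iff convergent_def by blast
  have "(\<lambda>n. J (x n)) \<longlonglongrightarrow> J z"
    unfolding J_def by (intro tendsto_intros z f.tendsto) simp
  moreover have "(\<lambda>n. d + 1 / real (Suc n)) \<longlonglongrightarrow> d + 0"
    using LIMSEQ_inverse_real_of_nat unfolding inverse_eq_divide by (intro tendsto_add tendsto_const)
  ultimately have "J z \<le> d"
    using x by (intro LIMSEQ_le[of "\<lambda>n. J (x n)" _ "\<lambda>n. d + 1 / real (Suc n)"]) (auto intro: less_imp_le)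
  then have min: "J z \<le> J y" for y using dle[of y] by simp
  have "f y = inner z y" for y
  proof -
    have q: "0 \<le> t * (inner z y - f y) + t\<^sup>2 * (norm y)\<^sup>2 / 2" for t
    proof -
      have "J (z + t *\<^sub>R y) = J z + (t * (inner z y - f y) + t\<^sup>2 * (norm y)\<^sup>2 / 2)"
      proof -
        have "(norm (z + t *\<^sub>R y))\<^sup>2 = (norm z)\<^sup>2 + 2 * (t * inner z y) + t\<^sup>2 * (norm y)\<^sup>2"
          unfolding power2_norm_eq_inner
          by (simp add: inner_add_left inner_add_right inner_commute power2_eq_square algebra_simps)
        then show ?thesis
          by (simp add: J_def f.add f.scaleR add_divide_distrib right_diff_distrib)
      qed
      then show ?thesis using min[of "z + t *\<^sub>R y"] by simp
    qed
    define D where "D = inner z y - f y"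
    \<comment> \<open>The quadratic in t is tested near its minimum, at t = - D / c; the added 1
      keeps c positive when y = 0.\<close>
    define c where "c = (norm y)\<^sup>2 + 1"
    have c: "c > 0" "(norm y)\<^sup>2 \<le> c" unfolding c_def by (auto intro: add_nonneg_pos)
    have "0 \<le> (- D / c) * D + (- D / c)\<^sup>2 * (norm y)\<^sup>2 / 2"
      using q[of "- D / c"] by (simp add: D_def)
    also have "\<dots> \<le> (- D / c) * D + (- D / c)\<^sup>2 * c / 2"
      using c by (intro add_left_mono divide_right_mono mult_left_mono) auto
    also have "\<dots> = - (D\<^sup>2 / (2 * c))"
      using c by (simp add: power2_eq_square field_simps)
    finally have "D\<^sup>2 / (2 * c) \<le> 0" by simp
    then have "D = 0" using c by (simp add: divide_le_0_iff)
    then show ?thesis by (simp add: D_def)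
  qed
  then show ?thesis by blast
qed

text \<open>Representing the real functionals \<open>inner (T x) y\<close> yields S. Its complex
  linearity follows by moving scalars across the real inner product, after which
  \<open>cinner_eq_inner\<close> upgrades the real adjoint identity to the complex one.\<close>

lemma cadjoint_ex1:
  assumes T: "bounded_clinear T"
  shows "\<exists>!S. bounded_clinear S \<and> (\<forall>x y. cinner (T x) y = cinner x (S y))"
proof -
  interpret T: bounded_linear T using T by (rule bounded_clinearD)
  have "\<exists>z. \<forall>x. inner (T x) y = inner z x" for y
  proof -
    have "bounded_linear (\<lambda>x. inner (T x) y)"
      using T.bounded_linear_axioms by (intro bounded_linear_intros)
    then show ?thesis by (rule riesz_representation)
  qed
  then obtain S where S: "\<And>x y. inner (T x) y = inner (S y) x" by metis
  have S': "inner (T x) y = inner x (S y)" for x y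
    using S[of x y] by (simp add: inner_commute)
  have ext: "a = b" if "\<And>x :: 'a. inner x a = inner x b" for a b
    using that[of "a - b"] by (metis eq_iff_diff_eq_0 inner_diff_right inner_eq_zero_iff)
  have Sadd: "S (y + z) = S y + S z" for y z
    by (rule ext) (simp add: S'[symmetric] inner_add_right)
  have SC: "S (c *\<^sub>C y) = c *\<^sub>C S y" for c y
  proof (rule ext)
    fix x
    have "inner x (S (c *\<^sub>C y)) = inner (T (cnj c *\<^sub>C x)) y"
      by (simp add: S'[symmetric] bounded_clinearD(2)[OF T] inner_scaleC_shift)
    also have "\<dots> = inner x (c *\<^sub>C S y)" by (simp add: S' inner_scaleC_shift)
    finally show "inner x (S (c *\<^sub>C y)) = inner x (c *\<^sub>C S y)" .
  qed
  obtain M where M: "0 < M" "\<And>x. norm (T x) \<le> norm x * M"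
    using T.pos_bounded by blast
  have "bounded_linear S"
  proof (rule bounded_linear_intro[of _ M])
    show "S (r *\<^sub>R x) = r *\<^sub>R S x" for r x by (simp add: scaleR_eq_scaleC SC)
    fix y
    have "(norm (S y))\<^sup>2 = inner (T (S y)) y"
      by (simp add: S' power2_norm_eq_inner)
    also have "\<dots> \<le> norm (T (S y)) * norm y" by (rule norm_cauchy_schwarz)
    also have "\<dots> \<le> norm (S y) * M * norm y" by (intro mult_right_mono M) auto
    finally have "norm (S y) * norm (S y) \<le> norm (S y) * (norm y * M)"
      by (simp add: power2_eq_square mult_ac)
    then show "norm (S y) \<le> norm y * M"
      using M by (cases "norm (S y) = 0") (auto simp: mult_le_cancel_left)
  qed (rule Sadd)
  then have bS: "bounded_clinear S" using SC by (simp add: bounded_clinear_def)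
  have TS: "cinner (T x) y = cinner x (S y)" for x y
    unfolding cinner_eq_inner[of "T x" y] cinner_eq_inner[of x "S y"] S' SC ..
  have uniq: "S1 = S" if "\<And>x y. cinner (T x) y = cinner x (S1 y)" for S1
  proof
    fix y show "S1 y = S y"
      by (rule cinner_ext_right) (simp only: that[symmetric] TS[symmetric])
  qed
  show ?thesis
  proof (rule ex1I)
    show "bounded_clinear S \<and> (\<forall>x y. cinner (T x) y = cinner x (S y))"
      using bS TS by simp
    show "S1 = S" if "bounded_clinear S1 \<and> (\<forall>x y. cinner (T x) y = cinner x (S1 y))" for S1
      using that by (intro uniq) simp
  qed
qed

lemma
  assumes T: "bounded_clinear T"
  shows bounded_clinear_cadjoint: "bounded_clinear (cadjoint T)"
    and cinner_cadjoint: "cinner (T x) y = cinner x (cadjoint T y)"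
proof -
  have *: "bounded_clinear (cadjoint T) \<and> (\<forall>x y. cinner (T x) y = cinner x (cadjoint T y))"
    unfolding cadjoint_def by (rule theI'[OF cadjoint_ex1[OF T]])
  show "bounded_clinear (cadjoint T)" using * by (rule conjunct1)
  show "cinner (T x) y = cinner x (cadjoint T y)" using conjunct2[OF *] by (elim allE)
qed

lemma self_adjoint_iff:
  "self_adjoint S \<longleftrightarrow> bounded_clinear S \<and> (\<forall>x y. cinner (S x) y = cinner x (S y))"
proof
  assume "self_adjoint S"
  then show "bounded_clinear S \<and> (\<forall>x y. cinner (S x) y = cinner x (S y))"
    using cinner_cadjoint[of S] unfolding self_adjoint_def by metis
next
  assume *: "bounded_clinear S \<and> (\<forall>x y. cinner (S x) y = cinner x (S y))"
  then have "cadjoint S = S"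
    unfolding cadjoint_def by (intro the1_equality cadjoint_ex1) simp_all
  then show "self_adjoint S" using * by (simp add: self_adjoint_def)
qed

lemma nonneg_operator_iff:
  "nonneg_operator S \<longleftrightarrow> bounded_clinear S \<and> (\<forall>x y. cinner (S x) y = cinner x (S y)) \<and> (\<forall>x. 0 \<le> inner (S x) x)"
proof -
  have "cinner (S f) f \<in> \<real>\<^sub>\<ge>\<^sub>0 \<longleftrightarrow> 0 \<le> inner (S f) f" if "\<forall>x y. cinner (S x) y = cinner x (S y)" for f
  proof -
    have "cinner (S f) f = cnj (cinner (S f) f)"
      using that by (simp only: cinner_commute[symmetric])
    then have "Im (cinner (S f) f) = 0" by (metis cnj.simps(2) equal_neg_zero)
    then show ?thesis by (simp add: complex_nonneg_Reals_iff Re_cinner)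
  qed
  then show ?thesis
    unfolding nonneg_operator_def self_adjoint_iff by blast
qed

section \<open>Compact non-negative operators and s-numbers\<close>

text \<open>Orthonormal families padded with zero vectors, so that finite-rank operators need no
  separate treatment.\<close>

definition semi_orthonormal :: "(nat \<Rightarrow> 'a :: complex_hilbert_space) \<Rightarrow> bool" where
  "semi_orthonormal e \<longleftrightarrow> (\<forall>i j. cinner (e i) (e j) = (if i = j \<and> e i \<noteq> 0 then 1 else 0))"

lemma cinner_sum_semi_orthonormal:
  assumes "semi_orthonormal e" "finite I"
  shows "cinner (\<Sum>i\<in>I. c i *\<^sub>C e i) (e j) = (if j \<in> I \<and> e j \<noteq> 0 then c j else 0)"
proof -
  have "cinner (\<Sum>i\<in>I. c i *\<^sub>C e i) (e j) = (\<Sum>i\<in>I. if i = j then (if e j \<noteq> 0 then c j else 0) else 0)"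
    unfolding cinner_sum_left
    by (intro sum.cong refl) (use assms(1) in \<open>auto simp: semi_orthonormal_def cinner_scaleC_left\<close>)
  then show ?thesis using assms(2) by simp
qed

lemma norm_sum_semi_orthonormal_le:
  assumes "semi_orthonormal e" "finite I"
  shows "(norm (\<Sum>i\<in>I. c i *\<^sub>C e i))\<^sup>2 \<le> (\<Sum>i\<in>I. (cmod (c i))\<^sup>2)"
proof -
  have "complex_of_real ((norm (\<Sum>i\<in>I. c i *\<^sub>C e i))\<^sup>2) =
      (\<Sum>j\<in>I. cnj (c j) * cinner (\<Sum>i\<in>I. c i *\<^sub>C e i) (e j))"
    unfolding cinner_self[symmetric] cinner_sum_right cinner_scaleC_right ..
  also have "\<dots> = (\<Sum>j\<in>I. of_real (if e j \<noteq> 0 then (cmod (c j))\<^sup>2 else 0))"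
    by (intro sum.cong refl)
      (simp add: cinner_sum_semi_orthonormal[OF assms] complex_norm_square mult.commute del: of_real_power)
  also have "\<dots> = of_real (\<Sum>j\<in>I. if e j \<noteq> 0 then (cmod (c j))\<^sup>2 else 0)"
    by simp
  finally have "(norm (\<Sum>i\<in>I. c i *\<^sub>C e i))\<^sup>2 = (\<Sum>j\<in>I. if e j \<noteq> 0 then (cmod (c j))\<^sup>2 else 0)"
    by (simp only: of_real_eq_iff)
  also have "\<dots> \<le> (\<Sum>j\<in>I. (cmod (c j))\<^sup>2)" by (intro sum_mono) auto
  finally show ?thesis .
qed

text \<open>Pythagoras. Equality survives the padding, because the coefficient at a zero vector is
  itself zero.\<close>

lemma norm_remainder_semi_orthonormal:
  assumes "semi_orthonormal e" "finite I"
  shows "(norm (x - (\<Sum>i\<in>I. cinner x (e i) *\<^sub>C e i)))\<^sup>2 = (norm x)\<^sup>2 - (\<Sum>i\<in>I. (cmod (cinner x (e i)))\<^sup>2)"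
proof -
  define y where "y = (\<Sum>i\<in>I. cinner x (e i) *\<^sub>C e i)"
  have z: "cinner x (e i) = 0" if "e i = 0" for i using that by simp
  have 1: "cinner (x - y) (e j) = 0" if "j \<in> I" for j
    unfolding y_def cinner_diff_left cinner_sum_semi_orthonormal[OF assms] using that z by auto
  have "cinner (x - y) y = 0"
    by (subst (2) y_def) (simp add: cinner_sum_right cinner_scaleC_right 1)
  then have "cinner (x - y) (x - y) = cinner x x - cinner y x"
    by (simp add: cinner_diff_right cinner_diff_left)
  also have "cinner y x = (\<Sum>i\<in>I. of_real ((cmod (cinner x (e i)))\<^sup>2))"
    unfolding y_def cinner_sum_left cinner_scaleC_left
    by (intro sum.cong refl) (subst (2) cinner_commute, simp add: complex_norm_square del: of_real_power)
  finally have "complex_of_real ((norm (x - y))\<^sup>2) = of_real ((norm x)\<^sup>2 - (\<Sum>i\<in>I. (cmod (cinner x (e i)))\<^sup>2))"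
    by (simp add: cinner_self)
  then show ?thesis unfolding y_def by (simp only: of_real_eq_iff)
qed

lemma bessel_inequality:
  assumes "semi_orthonormal e" "finite I"
  shows "(\<Sum>i\<in>I. (cmod (cinner x (e i)))\<^sup>2) \<le> (norm x)\<^sup>2"
  using norm_remainder_semi_orthonormal[OF assms, of x]
    zero_le_power2[of "norm (x - (\<Sum>i\<in>I. cinner x (e i) *\<^sub>C e i))"] by linarith

lemma norm_remainder_semi_orthonormal_le:
  assumes "semi_orthonormal e" "finite I"
  shows "norm (x - (\<Sum>i\<in>I. cinner x (e i) *\<^sub>C e i)) \<le> norm x"
  by (rule power2_le_imp_le) (simp_all add: norm_remainder_semi_orthonormal[OF assms] sum_nonneg)

lemma norm_semi_orthonormal:
  assumes "semi_orthonormal e" "e i \<noteq> 0"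
  shows "norm (e i) = 1"
proof -
  have "cinner (e i) (e i) = 1" using assms by (simp add: semi_orthonormal_def)
  then have "complex_of_real ((norm (e i))\<^sup>2) = of_real 1" by (simp only: cinner_self of_real_1)
  then show ?thesis by (simp only: of_real_eq_iff) (simp add: abs_square_eq_1)
qed

section \<open>Spectral expansion of compact positive operators\<close>

definition pos_compact :: "('a :: complex_hilbert_space \<Rightarrow> 'a) \<Rightarrow> bool" where
  "pos_compact K \<longleftrightarrow> compact_operator K \<and> (\<forall>x y. cinner (K x) y = cinner x (K y)) \<and> (\<forall>x. 0 \<le> inner (K x) x)"

lemma compact_operatorD:
  assumes "compact_operator K"
  shows "bounded_clinear K" "bounded_linear K" "K (c *\<^sub>C x) = c *\<^sub>C K x"
    "bounded B \<Longrightarrow> compact (closure (K ` B))"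
  using assms by (auto simp: compact_operator_def bounded_clinear_def)

lemma compact_operator_subseq:
  assumes K: "compact_operator K" and x: "\<And>n. norm (x n) \<le> M"
  obtains l r where "strict_mono (r :: nat \<Rightarrow> nat)" "(\<lambda>n. K (x (r n))) \<longlonglongrightarrow> l"
proof -
  have "bounded (range x)" using x by (auto simp: bounded_iff)
  then have "compact (closure (K ` range x))" using K by (rule compact_operatorD(4)[rotated])
  then have "(\<forall>n. K (x n) \<in> closure (K ` range x)) \<longrightarrow>
      (\<exists>l\<in>closure (K ` range x). \<exists>r. strict_mono (r :: nat \<Rightarrow> nat) \<and> ((\<lambda>n. K (x n)) \<circ> r) \<longlonglongrightarrow> l)"
    unfolding compact_def by (rule spec)
  moreover have "K (x n) \<in> closure (K ` range x)" for n
    by (rule subsetD[OF closure_subset]) simp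
  ultimately obtain l and r :: "nat \<Rightarrow> nat" where "strict_mono r" "((\<lambda>n. K (x n)) \<circ> r) \<longlonglongrightarrow> l"
    by auto
  then show ?thesis by (intro that[of r l]) (simp_all add: o_def)
qed

text \<open>Cauchy-Schwarz for the semi-definite form of K, obtained by testing positivity at x - t
  K x with t = 1 / mu. It converts bounds of the quadratic form into bounds of
  \<open>norm (K x)\<close>.\<close>

lemma pos_compact_norm_sq_le:
  assumes K: "pos_compact K" and \<mu>: "0 \<le> \<mu>" "\<And>y. inner (K y) y \<le> \<mu> * (norm y)\<^sup>2"
  shows "(norm (K x))\<^sup>2 \<le> \<mu> * inner (K x) x"
proof -
  interpret K: bounded_linear K using K by (auto simp: pos_compact_def compact_operator_def bounded_clinear_def)
  have sym: "inner (K y) z = inner y (K z)" for y z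
    using K by (simp add: pos_compact_def Re_cinner[symmetric])
  define N where "N = (norm (K x))\<^sup>2"
  have q: "0 \<le> inner (K x) x - 2 * t * N + t\<^sup>2 * (\<mu> * N)" for t
  proof -
    have "0 \<le> inner (K (x - t *\<^sub>R K x)) (x - t *\<^sub>R K x)"
      using K by (auto simp: pos_compact_def)
    also have "\<dots> = inner (K x) x - 2 * t * N + t\<^sup>2 * inner (K (K x)) (K x)"
    proof -
      have "inner (K (K x)) x = N" "inner (K x) (K x) = N"
        unfolding sym[of "K x" x] by (simp_all add: N_def power2_norm_eq_inner)
      then show ?thesis
        by (simp add: K.diff K.scaleR inner_diff_left inner_diff_right power2_eq_square algebra_simps)
    qed
    also have "\<dots> \<le> inner (K x) x - 2 * t * N + t\<^sup>2 * (\<mu> * N)"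
      using \<mu>(2)[of "K x"] by (intro add_left_mono mult_left_mono) (auto simp: N_def)
    finally show ?thesis .
  qed
  show ?thesis
  proof (cases "\<mu> = 0")
    case True
    have "inner (K x) x \<le> 0" using \<mu>(2)[of x] True by simp
    then have "N \<le> 0" using q[of 1] True by simp
    then show ?thesis using True by (simp add: N_def)
  next
    case False
    then have "\<mu> > 0" using \<mu> by simp
    have "0 \<le> inner (K x) x - 2 * (1 / \<mu>) * N + (1 / \<mu>)\<^sup>2 * (\<mu> * N)" by (rule q)
    also have "\<dots> = inner (K x) x - N / \<mu>"
      using \<open>\<mu> > 0\<close> by (simp add: power2_eq_square field_simps)
    finally show ?thesis using \<open>\<mu> > 0\<close> by (simp add: N_def divide_le_eq mult.commute)
  qed
qed

text \<open>A sequence maximising the Rayleigh quotient satisfies |K x - mu x|^2 <= mu (mu - <K x,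
  x>), so it consists of approximate eigenvectors; for mu > 0 the convergence of
  \<open>K (x (r n))\<close> forces that of \<open>x (r n)\<close>. For mu = 0 the chosen vector is
  0, as zero-padded families require.\<close>

lemma pos_compact_top_eigenvector:
  assumes K: "pos_compact K"
  shows "\<exists>\<mu> x. 0 \<le> \<mu> \<and> (\<forall>y. inner (K y) y \<le> \<mu> * (norm y)\<^sup>2) \<and> K x = \<mu> *\<^sub>R x \<and>
    norm x = (if \<mu> = 0 then 0 else 1)"
proof -
  interpret K: bounded_linear K using K by (auto simp: pos_compact_def compact_operator_def bounded_clinear_def)
  have pos: "0 \<le> inner (K x) x" for x using K by (auto simp: pos_compact_def)
  \<comment> \<open>The closed ball instead of the sphere: it contains 0 even if the space is
    trivial.\<close>
  define Q where "Q = (\<lambda>x. inner (K x) x) ` cball 0 1"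
  obtain M where M: "0 < M" "\<And>x. norm (K x) \<le> norm x * M" using K.pos_bounded by blast
  have bdd: "bdd_above Q"
    unfolding Q_def
  proof (rule bdd_aboveI2)
    fix x :: 'a assume "x \<in> cball 0 1"
    then have x: "norm x \<le> 1" by simp
    have "inner (K x) x \<le> norm (K x) * norm x" by (rule norm_cauchy_schwarz)
    also have "\<dots> \<le> M * 1"
      using M(2)[of x] x M(1) by (intro mult_mono order_trans[OF M(2)]) (auto intro: mult_left_le_one_le)
    finally show "inner (K x) x \<le> M" by simp
  qed
  define \<mu> where "\<mu> = Sup Q"
  have 0: "0 \<in> Q" unfolding Q_def by (intro image_eqI[of _ _ 0]) auto
  have \<mu>0: "0 \<le> \<mu>" unfolding \<mu>_def by (rule cSup_upper[OF 0 bdd])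
  have bd: "inner (K y) y \<le> \<mu> * (norm y)\<^sup>2" for y
  proof (cases "y = 0")
    case False
    have "inner (K ((1 / norm y) *\<^sub>R y)) ((1 / norm y) *\<^sub>R y) \<in> Q"
      unfolding Q_def using False by (intro imageI) auto
    then have "inner (K ((1 / norm y) *\<^sub>R y)) ((1 / norm y) *\<^sub>R y) \<le> \<mu>"
      unfolding \<mu>_def by (rule cSup_upper[OF _ bdd])
    then show ?thesis using False by (simp add: K.scaleR divide_le_eq power2_eq_square)
  qed (simp add: K.zero)
  show ?thesis
  proof (cases "\<mu> = 0")
    case True
    then show ?thesis using bd \<mu>0 by (intro exI[of _ 0] exI[of _ "0 :: 'a"]) (auto simp: K.zero)
  next
    case False
    then have \<mu>: "\<mu> > 0" using \<mu>0 by simp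
    have "\<exists>x. norm x \<le> 1 \<and> \<mu> - 1 / real (Suc n) < inner (K x) x" for n
    proof -
      have "\<mu> - 1 / real (Suc n) < Sup Q" unfolding \<mu>_def by simp
      then obtain q where "q \<in> Q" "\<mu> - 1 / real (Suc n) < q" using 0 by (auto dest!: less_cSupD[rotated])
      then show ?thesis unfolding Q_def by auto
    qed
    then obtain x where x: "\<And>n. norm (x n) \<le> 1" "\<And>n. \<mu> - 1 / real (Suc n) < inner (K (x n)) (x n)"
      by metis
    have "compact_operator K" using K by (simp add: pos_compact_def)
    then obtain l r where r: "strict_mono (r :: nat \<Rightarrow> nat)" and l: "(\<lambda>n. K (x (r n))) \<longlonglongrightarrow> l"
      using x(1) by (rule compact_operator_subseq)
    have lim0: "(\<lambda>n. 1 / real (Suc n)) \<longlonglongrightarrow> 0"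
      using LIMSEQ_inverse_real_of_nat by (simp add: inverse_eq_divide)
    have sq: "(norm (K (x n) - \<mu> *\<^sub>R x n))\<^sup>2 \<le> \<mu> * (1 / real (Suc n))" for n
    proof -
      have "(norm (K (x n) - \<mu> *\<^sub>R x n))\<^sup>2 = (norm (K (x n)))\<^sup>2 - 2 * \<mu> * inner (K (x n)) (x n) + \<mu>\<^sup>2 * (norm (x n))\<^sup>2"
        unfolding power2_norm_eq_inner
        by (simp add: inner_diff_left inner_diff_right inner_commute power2_eq_square algebra_simps)
      also have "\<dots> \<le> \<mu> * inner (K (x n)) (x n) - 2 * \<mu> * inner (K (x n)) (x n) + \<mu>\<^sup>2 * 1"
        using x(1)[of n] by (intro add_mono diff_mono mult_left_mono pos_compact_norm_sq_le K \<mu>0 bd)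
          (auto simp: power_le_one \<mu>0)
      also have "\<dots> = \<mu> * (\<mu> - inner (K (x n)) (x n))"
        by (simp add: power2_eq_square algebra_simps)
      also have "\<dots> \<le> \<mu> * (1 / real (Suc n))"
        using x(2)[of n] \<mu>0 by (intro mult_left_mono) linarith+
      finally show ?thesis .
    qed
    have "(\<lambda>n. (norm (K (x n) - \<mu> *\<^sub>R x n))\<^sup>2) \<longlonglongrightarrow> 0"
    proof (rule tendsto_sandwich[OF always_eventually always_eventually tendsto_const])
      show "(\<lambda>n. \<mu> * (1 / real (Suc n))) \<longlonglongrightarrow> 0"
        using tendsto_mult[OF tendsto_const[of \<mu>] lim0] by simp
    qed (use sq in auto)
    then have "(\<lambda>n. norm (K (x n) - \<mu> *\<^sub>R x n)) \<longlonglongrightarrow> 0"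
      using tendsto_real_sqrt by fastforce
    then have "(\<lambda>n. K (x n) - \<mu> *\<^sub>R x n) \<longlonglongrightarrow> 0" by (rule tendsto_norm_zero_cancel)
    from LIMSEQ_subseq_LIMSEQ[OF this r] have "(\<lambda>n. K (x (r n)) - \<mu> *\<^sub>R x (r n)) \<longlonglongrightarrow> 0" by (simp add: o_def)
    from tendsto_diff[OF l this] have "(\<lambda>n. \<mu> *\<^sub>R x (r n)) \<longlonglongrightarrow> l" by simp
    from tendsto_scaleR[OF tendsto_const[of "1 / \<mu>"] this] have lim: "(\<lambda>n. x (r n)) \<longlonglongrightarrow> (1 / \<mu>) *\<^sub>R l"
      using \<mu> by simp
    define z where "z = (1 / \<mu>) *\<^sub>R l"
    have "(\<lambda>n. K (x (r n))) \<longlonglongrightarrow> K z" using K.tendsto[OF lim] by (simp add: z_def)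
    then have "K z = l" using l LIMSEQ_unique by blast
    then have Kz: "K z = \<mu> *\<^sub>R z" using \<mu> by (simp add: z_def)
    have "norm z \<le> 1"
      unfolding z_def by (rule LIMSEQ_le_const2[OF tendsto_norm[OF lim]]) (use x(1) in auto)
    moreover have "1 \<le> (norm z)\<^sup>2"
    proof -
      have "(\<lambda>n. inner (K (x (r n))) (x (r n))) \<longlonglongrightarrow> inner (K z) z"
        using lim by (intro tendsto_inner K.tendsto) (auto simp: z_def)
      moreover have "(\<lambda>n. \<mu> - 1 / real (Suc (r n))) \<longlonglongrightarrow> \<mu> - 0"
        using LIMSEQ_subseq_LIMSEQ[OF lim0 r] by (intro tendsto_diff tendsto_const) (simp add: o_def)
      ultimately have "\<mu> - 0 \<le> inner (K z) z"
        using x(2) by (intro LIMSEQ_le[where X = "\<lambda>n. \<mu> - 1 / real (Suc (r n))"]) (auto intro: less_imp_le)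
      also have "\<dots> = \<mu> * (norm z)\<^sup>2" by (simp add: Kz power2_norm_eq_inner)
      finally show ?thesis using \<mu> by simp
    qed
    moreover from this have "1 \<le> norm z"
      using power2_le_imp_le[of 1 "norm z"] by simp
    ultimately have "norm z = 1" by simp
    then show ?thesis using \<mu> bd Kz by (intro exI[of _ \<mu>] exI[of _ z]) auto
  qed
qed

text \<open>Zero eigenvalues go with zero vectors, so finite rank is included. The last clause
  bounds the truncation error in operator norm by the first omitted eigenvalue; it carries the
  completeness of the expansion.\<close>

definition spectral_seq :: "('a :: complex_hilbert_space \<Rightarrow> 'a) \<Rightarrow> (nat \<Rightarrow> real) \<Rightarrow> (nat \<Rightarrow> 'a) \<Rightarrow> bool" where
  "spectral_seq K l e \<longleftrightarrow> semi_orthonormal e \<and> decseq l \<and> (\<forall>i. 0 \<le> l i) \<and> l \<longlonglongrightarrow> 0 \<and>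
     (\<forall>i. e i = 0 \<longleftrightarrow> l i = 0) \<and> (\<forall>i. K (e i) = l i *\<^sub>R e i) \<and>
     (\<forall>n x. norm (K x - (\<Sum>i<n. (of_real (l i) * cinner x (e i)) *\<^sub>C e i)) \<le> l n * norm x)"

definition top_pair :: "('a :: complex_hilbert_space \<Rightarrow> 'a) \<Rightarrow> real \<times> 'a" where
  "top_pair K = (SOME (\<mu>, x). 0 \<le> \<mu> \<and> (\<forall>y. inner (K y) y \<le> \<mu> * (norm y)\<^sup>2) \<and> K x = \<mu> *\<^sub>R x \<and>
    norm x = (if \<mu> = 0 then 0 else 1))"

lemma top_pair:
  assumes "pos_compact K"
  shows "0 \<le> fst (top_pair K)" "inner (K y) y \<le> fst (top_pair K) * (norm y)\<^sup>2"
    "K (snd (top_pair K)) = fst (top_pair K) *\<^sub>R snd (top_pair K)"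
    "norm (snd (top_pair K)) = (if fst (top_pair K) = 0 then 0 else 1)"
proof -
  have "case top_pair K of (\<mu>, x) \<Rightarrow> 0 \<le> \<mu> \<and> (\<forall>y. inner (K y) y \<le> \<mu> * (norm y)\<^sup>2) \<and> K x = \<mu> *\<^sub>R x \<and>
    norm x = (if \<mu> = 0 then 0 else 1)"
    unfolding top_pair_def by (rule someI_ex) (use pos_compact_top_eigenvector[OF assms] in simp)
  then show "0 \<le> fst (top_pair K)" "inner (K y) y \<le> fst (top_pair K) * (norm y)\<^sup>2"
    "K (snd (top_pair K)) = fst (top_pair K) *\<^sub>R snd (top_pair K)"
    "norm (snd (top_pair K)) = (if fst (top_pair K) = 0 then 0 else 1)"
    by (auto simp: case_prod_beta)
qed

definition deflate :: "('a :: complex_hilbert_space \<Rightarrow> 'a) \<Rightarrow> 'a \<Rightarrow> 'a" where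
  "deflate K = (\<lambda>y. K y - (of_real (fst (top_pair K)) * cinner y (snd (top_pair K))) *\<^sub>C snd (top_pair K))"

lemma cinner_unit_or_zero:
  assumes "norm x = 0 \<or> norm x = 1"
  shows "cinner (y - cinner y x *\<^sub>C x) x = 0"
  using assms by (auto simp: cinner_diff_left cinner_scaleC_left cinner_self)

text \<open>Subtracting the top rank-one part amounts to composing K with \<open>p\<close>, the
  projection onto the complement of the top eigenvector (the identity if that vector is 0).
  Compactness is then inherited from K, and positivity follows from <K p y, y> = <K p y, p y>. The
  kernel clause keeps earlier eigenvectors annihilated under later deflations.\<close>

lemma deflate:
  assumes K: "pos_compact K"
  shows pos_compact_deflate: "pos_compact (deflate K)"
    and deflate_top: "deflate K (snd (top_pair K)) = 0"
    and deflate_kernel: "K v = 0 \<Longrightarrow> deflate K v = 0"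
proof -
  define \<mu> where "\<mu> = fst (top_pair K)"
  define x where "x = snd (top_pair K)"
  note top = top_pair[OF K, folded \<mu>_def x_def]
  have nx: "norm x = 0 \<or> norm x = 1" using top(4) by auto
  have co: "compact_operator K" and sym: "\<And>y z. cinner (K y) z = cinner y (K z)" and pos: "\<And>y. 0 \<le> inner (K y) y"
    using K by (auto simp: pos_compact_def)
  interpret K: bounded_linear K using co by (rule compact_operatorD)
  have KC: "K (c *\<^sub>C y) = c *\<^sub>C K y" for c y using co by (rule compact_operatorD)
  define p where "p y = y - cinner y x *\<^sub>C x" for y
  have dK: "deflate K y = K (p y)" for y
    unfolding deflate_def \<mu>_def[symmetric] x_def[symmetric] p_def K.diff KC top(3)
    by (simp add: scaleR_eq_scaleC scaleC_scaleC mult.commute)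
  have px: "cinner (p y) x = 0" for y
    unfolding p_def by (rule cinner_unit_or_zero[OF nx])
  have np: "norm (p y) \<le> 2 * norm y" for y
  proof -
    have "norm (p y) \<le> norm y + cmod (cinner y x) * norm x"
      unfolding p_def by (metis norm_scaleC norm_triangle_ineq4)
    also have "\<dots> \<le> norm y + norm y * norm x * norm x"
      by (intro add_left_mono mult_right_mono norm_cinner_le) simp
    also have "\<dots> \<le> 2 * norm y" using nx by auto
    finally show ?thesis .
  qed
  have padd: "p (y + z) = p y + p z" for y z
    by (simp add: p_def cinner_add_left scaleC_add_left algebra_simps)
  have pC: "p (c *\<^sub>C y) = c *\<^sub>C p y" for c y
    by (simp add: p_def cinner_scaleC_left scaleC_scaleC complex_vector.scale_right_diff_distrib)
  have bl: "bounded_linear (\<lambda>y. K (p y))"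
  proof -
    have "bounded_linear p"
    proof (rule bounded_linear_intro[of _ 2])
      show "norm (p y) \<le> norm y * 2" for y using np[of y] by simp
      show "p (r *\<^sub>R y) = r *\<^sub>R p y" for r y by (simp add: scaleR_eq_scaleC pC)
    qed (rule padd)
    from bounded_linear_compose[OF K.bounded_linear_axioms this] show ?thesis .
  qed
  have "compact_operator (\<lambda>y. K (p y))"
    unfolding compact_operator_def bounded_clinear_def
  proof (intro conjI allI impI bl)
    show "K (p (c *\<^sub>C y)) = c *\<^sub>C K (p y)" for c y by (simp add: pC KC)
    fix B :: "'a set" assume "bounded B"
    then obtain M where M: "\<And>y. y \<in> B \<Longrightarrow> norm y \<le> M" by (auto simp: bounded_iff)
    have "bounded (p ` B)"
      unfolding bounded_iff
    proof (intro exI ballI)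
      fix z assume "z \<in> p ` B"
      then obtain y where y: "y \<in> B" "z = p y" by auto
      show "norm z \<le> 2 * M" using np[of y] M[OF y(1)] y(2) by simp
    qed
    then have "compact (closure (K ` p ` B))" by (rule compact_operatorD(4)[OF co])
    then show "compact (closure ((\<lambda>y. K (p y)) ` B))" by (simp add: image_image)
  qed
  moreover have "cinner (K (p y)) z = cinner y (K (p z))" for y z
  proof -
    have "cinner (K (p y)) z = cinner (p y) (K z)" by (rule sym)
    also have "\<dots> = cinner y (K z) - of_real \<mu> * (cinner y x * cinner x z)"
    proof -
      have "cinner x (K z) = of_real \<mu> * cinner x z"
        unfolding sym[symmetric] top(3) cinner_scaleR_left ..
      then show ?thesis
        unfolding p_def cinner_diff_left cinner_scaleC_left by (simp add: mult_ac)
    qed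
    also have "\<dots> = cinner (K y) z - of_real \<mu> * (cinner y x * cinner x z)" by (simp only: sym)
    also have "\<dots> = cinner (K y) (p z)"
    proof -
      have "cinner (K y) (p z) = cinner (K y) z - cnj (cinner z x) * cinner y (K x)"
        unfolding p_def cinner_diff_right cinner_scaleC_right sym[of y x] ..
      also have "cnj (cinner z x) = cinner x z" by (simp only: cinner_commute[symmetric])
      finally show ?thesis by (simp add: top(3) cinner_scaleR_right mult_ac)
    qed
    also have "\<dots> = cinner y (K (p z))" by (rule sym)
    finally show ?thesis .
  qed
  moreover have "0 \<le> inner (K (p y)) y" for y
  proof -
    have "cinner (K (p y)) x = 0"
      unfolding sym top(3) cinner_scaleR_right px by simp
    then have "cinner (K (p y)) y = cinner (K (p y)) (p y)"
      unfolding p_def[of y] cinner_diff_right cinner_scaleC_right by simp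
    then have "inner (K (p y)) y = inner (K (p y)) (p y)" by (simp add: Re_cinner[symmetric])
    then show ?thesis using pos by simp
  qed
  ultimately show "pos_compact (deflate K)"
    unfolding pos_compact_def dK[abs_def] by simp
  have "p x = 0" using nx by (auto simp: p_def cinner_self scaleC_one)
  then show "deflate K (snd (top_pair K)) = 0" unfolding x_def[symmetric] dK by (simp add: K.zero)
  assume v: "K v = 0"
  have "of_real \<mu> * cinner v x = cinner v (K x)" by (simp add: top(3) cinner_scaleR_right)
  also have "\<dots> = cinner (K v) x" by (simp only: sym)
  also have "\<dots> = 0" by (simp add: v)
  finally show "deflate K v = 0"
    unfolding deflate_def \<mu>_def[symmetric] x_def[symmetric] by (simp add: v)
qed

text \<open>Iterated deflation: \<open>L n\<close> is K minus its first n terms and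
  \<open>l n\<close> bounds its quadratic form, so \<open>pos_compact_norm_sq_le\<close> gives the
  error bound of the truncation.\<close>

lemma pos_compact_spectral_seq:
  assumes K: "pos_compact K"
  shows "\<exists>l e. spectral_seq K l e"
proof -
  define L where "L n = (deflate ^^ n) K" for n
  have L0: "L 0 = K" and LS: "L (Suc n) = deflate (L n)" for n by (simp_all add: L_def)
  define l where "l n = fst (top_pair (L n))" for n
  define e where "e n = snd (top_pair (L n))" for n
  have pc: "pos_compact (L n)" for n
    by (induction n) (simp_all add: L0 LS K pos_compact_deflate)
  note top = top_pair[OF pc, folded l_def e_def]
  have sym: "cinner (L n y) z = cinner y (L n z)" for n y z using pc[of n] by (auto simp: pos_compact_def)
  have blL: "bounded_linear (L n)" for n using pc[of n] by (auto simp: pos_compact_def compact_operator_def bounded_clinear_def)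
  have ker: "L n (e i) = 0" if "i < n" for i n
    using that
  proof (induction n)
    case (Suc n)
    show ?case
    proof (cases "i = n")
      case True
      then show ?thesis unfolding LS e_def by (simp add: deflate_top pc)
    next
      case False
      then show ?thesis unfolding LS using Suc by (intro deflate_kernel pc) auto
    qed
  qed simp
  have e0: "e i = 0 \<longleftrightarrow> l i = 0" for i using top(4)[of i] by (auto split: if_splits)
  have orth1: "cinner (e n) (e i) = 0" if "i < n" for i n
  proof -
    have "of_real (l n) * cinner (e n) (e i) = cinner (L n (e n)) (e i)"
      by (simp add: top(3) cinner_scaleR_left)
    also have "\<dots> = cinner (e n) (L n (e i))" by (rule sym)
    also have "\<dots> = 0" using ker[OF that] by simp
    finally show ?thesis using e0[of n] by auto
  qed
  have semi: "semi_orthonormal e"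
    unfolding semi_orthonormal_def
  proof (intro allI)
    fix i j :: nat
    consider "i < j" | "j < i" | "i = j" by linarith
    then show "cinner (e i) (e j) = (if i = j \<and> e i \<noteq> 0 then 1 else 0)"
    proof cases
      case 1
      then have "cnj (cinner (e j) (e i)) = 0" using orth1 by simp
      then show ?thesis using 1 by (simp add: cinner_commute[symmetric])
    next
      case 3
      then show ?thesis using top(4)[of i] e0[of i] by (auto simp: cinner_self)
    qed (use orth1 in simp)
  qed
  have Lsum: "L n y = K y - (\<Sum>i<n. (of_real (l i) * cinner y (e i)) *\<^sub>C e i)" for n y
    by (induction n) (simp_all add: L0 LS deflate_def l_def[symmetric] e_def[symmetric])
  have Ke: "K (e i) = l i *\<^sub>R e i" for i
  proof -
    have "L i (e i) = K (e i)"
      unfolding Lsum using orth1 by simp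
    then show ?thesis using top(3)[of i] by simp
  qed
  have dec: "l (Suc n) \<le> l n" for n
  proof (cases "l (Suc n) = 0")
    case True
    then show ?thesis using top(1)[of n] by simp
  next
    case False
    then have n1: "norm (e (Suc n)) = 1" using top(4)[of "Suc n"] by simp
    have "cinner (e (Suc n)) (e n) = 0" by (rule orth1) simp
    then have "L (Suc n) (e (Suc n)) = L n (e (Suc n))"
      unfolding LS deflate_def l_def[symmetric] e_def[symmetric] by simp
    then have "L n (e (Suc n)) = l (Suc n) *\<^sub>R e (Suc n)"
      using top(3)[of "Suc n"] by simp
    then have "inner (L n (e (Suc n))) (e (Suc n)) = l (Suc n) * (norm (e (Suc n)))\<^sup>2"
      by (simp add: power2_norm_eq_inner)
    then have "l (Suc n) = inner (L n (e (Suc n))) (e (Suc n))"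
      using n1 by simp
    also have "\<dots> \<le> l n * 1" using top(2)[of n "e (Suc n)"] n1 by simp
    finally show ?thesis by simp
  qed
  have decs: "decseq l" using dec by (rule decseq_SucI)
  have nrm: "norm (L n x) \<le> l n * norm x" for n x
  proof -
    have "(norm (L n x))\<^sup>2 \<le> l n * inner (L n x) x"
      by (rule pos_compact_norm_sq_le[OF pc top(1) top(2)])
    also have "\<dots> \<le> l n * (l n * (norm x)\<^sup>2)" by (intro mult_left_mono top)
    also have "\<dots> = (l n * norm x)\<^sup>2" by (simp add: power2_eq_square)
    finally show ?thesis by (rule power2_le_imp_le) (simp add: top(1))
  qed
  have lim: "l \<longlonglongrightarrow> 0"
  proof -
    obtain c where c: "l \<longlonglongrightarrow> c" "\<And>i. c \<le> l i"
      using decseq_convergent[OF decs, of 0] top(1) by blast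
    have "c \<ge> 0" by (rule LIMSEQ_le_const[OF c(1)]) (use top(1) in auto)
    \<comment> \<open>With c > 0 the vectors \<open>K (e i)\<close> would be pairwise at distance at
      least c, so no subsequence could converge, against compactness.\<close>
    have "c = 0"
    proof (rule ccontr)
      assume "c \<noteq> 0"
      then have c0: "c > 0" using \<open>c \<ge> 0\<close> by simp
      then have lp: "l i > 0" for i using c(2)[of i] by simp
      have ne: "norm (e i) = 1" for i using top(4)[of i] lp[of i] by simp
      have "compact_operator K" using K by (simp add: pos_compact_def)
      then obtain y r where r: "strict_mono (r :: nat \<Rightarrow> nat)" "(\<lambda>n. K (e (r n))) \<longlonglongrightarrow> y"
        by (rule compact_operator_subseq[of K e 1]) (simp add: ne)
      have far: "c \<le> norm (K (e i) - K (e j))" if "i \<noteq> j" for i j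
      proof -
        have "cinner (e i) (e j) = 0" using semi that by (simp add: semi_orthonormal_def)
        then have "inner (e i) (e j) = 0" by (simp add: Re_cinner[symmetric])
        then have "(norm (K (e i) - K (e j)))\<^sup>2 = (l i)\<^sup>2 * (norm (e i))\<^sup>2 + (l j)\<^sup>2 * (norm (e j))\<^sup>2"
          unfolding power2_norm_eq_inner Ke
          by (simp add: inner_diff_left inner_diff_right inner_commute power2_eq_square)
        then have "c\<^sup>2 \<le> (norm (K (e i) - K (e j)))\<^sup>2"
          using power_mono[OF c(2)[of i], of 2] c0 by (simp add: ne add_increasing2)
        then show ?thesis by (rule power2_le_imp_le) simp
      qed
      have "Cauchy (\<lambda>n. K (e (r n)))" using r(2) by (rule LIMSEQ_imp_Cauchy)
      then obtain M where "\<And>m n. m \<ge> M \<Longrightarrow> n \<ge> M \<Longrightarrow> norm (K (e (r m)) - K (e (r n))) < c"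
        using c0 unfolding Cauchy_iff by blast
      from this[of M "Suc M"] have "norm (K (e (r M)) - K (e (r (Suc M)))) < c" by simp
      moreover have "r M \<noteq> r (Suc M)" using r(1) by (metis n_not_Suc_n strict_mono_eq)
      ultimately show False using far by fastforce
    qed
    then show ?thesis using c by simp
  qed
  have "spectral_seq K l e"
    unfolding spectral_seq_def
    using semi decs top(1) lim e0 Ke nrm unfolding Lsum by blast
  then show ?thesis by blast
qed

lemma spectral_seqD:
  assumes "spectral_seq K l e"
  shows "semi_orthonormal e" "decseq l" "0 \<le> l i" "l \<longlonglongrightarrow> 0" "e i = 0 \<longleftrightarrow> l i = 0" "K (e i) = l i *\<^sub>R e i"
    "norm (K x - (\<Sum>i<n. (of_real (l i) * cinner x (e i)) *\<^sub>C e i)) \<le> l n * norm x"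
  using assms unfolding spectral_seq_def by auto

lemma spectral_seq_tendsto:
  assumes "spectral_seq K l e"
  shows "(\<lambda>n. \<Sum>i<n. (of_real (l i) * cinner x (e i)) *\<^sub>C e i) \<longlonglongrightarrow> K x"
proof -
  have *: "(\<lambda>n. l n * norm x) \<longlonglongrightarrow> 0"
    using tendsto_mult[OF spectral_seqD(4)[OF assms] tendsto_const[of "norm x"]] by simp
  have "(\<lambda>n. (\<Sum>i<n. (of_real (l i) * cinner x (e i)) *\<^sub>C e i) - K x) \<longlonglongrightarrow> 0"
  proof (rule Lim_null_comparison[OF always_eventually *], intro allI)
    fix n
    show "norm ((\<Sum>i<n. (of_real (l i) * cinner x (e i)) *\<^sub>C e i) - K x) \<le> l n * norm x"
      by (subst norm_minus_commute) (rule spectral_seqD(7)[OF assms])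
  qed
  then show ?thesis by (rule LIM_zero_cancel)
qed

section \<open>Eigenvalue sequences: existence and uniqueness\<close>

lemma semi_orthonormal_independent:
  assumes e: "semi_orthonormal e" and I: "finite I" "\<And>i. i \<in> I \<Longrightarrow> e i \<noteq> 0"
  shows "inj_on e I" "complex_vector.independent (e ` I)"
proof -
  show inj: "inj_on e I"
  proof (rule inj_onI)
    fix i j assume ij: "i \<in> I" "j \<in> I" "e i = e j"
    have "cinner (e i) (e i) = 1" using e I(2)[OF ij(1)] by (simp add: semi_orthonormal_def)
    then have "cinner (e i) (e j) \<noteq> 0" using ij(3) by simp
    then show "i = j" using e by (auto simp: semi_orthonormal_def split: if_splits)
  qed
  show "complex_vector.independent (e ` I)"
  proof
    assume "complex_vector.dependent (e ` I)"
    then obtain u j where u: "j \<in> I" "u (e j) \<noteq> 0" "(\<Sum>v\<in>e ` I. u v *\<^sub>C v) = 0"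
      using I(1) by (subst (asm) complex_vector.dependent_finite) auto
    have "(\<Sum>v\<in>e ` I. u v *\<^sub>C v) = (\<Sum>i\<in>I. u (e i) *\<^sub>C e i)"
      by (subst sum.reindex[OF inj]) simp
    then have "cinner (\<Sum>i\<in>I. u (e i) *\<^sub>C e i) (e j) = 0" using u(3) by simp
    then show False
      using u I cinner_sum_semi_orthonormal[OF e I(1), of "\<lambda>i. u (e i)" j] by simp
  qed
qed

lemma spectral_seq_finite:
  assumes "spectral_seq K l e" "0 < \<mu>"
  shows "finite {i. \<mu> \<le> l i}"
proof -
  have "eventually (\<lambda>i. l i < \<mu>) sequentially"
    using spectral_seqD(4)[OF assms(1)] assms(2) by (rule order_tendstoD)
  then obtain N where "\<And>i. i \<ge> N \<Longrightarrow> l i < \<mu>" by (auto simp: eventually_sequentially)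
  then have "{i. \<mu> \<le> l i} \<subseteq> {..<N}" by (auto simp: not_le[symmetric])
  then show ?thesis by (rule finite_subset) simp
qed

text \<open>By symmetry an eigenvector for mu is orthogonal to every \<open>e i\<close> with l i
  different from mu, so its expansion collapses to a finite sum.\<close>

lemma spectral_seq_eigenspace:
  assumes K: "spectral_seq K l e" and sym: "\<And>x y. cinner (K x) y = cinner x (K y)"
    and bl: "bounded_clinear K" and \<mu>: "0 < \<mu>"
  shows "eigenspace K (of_real \<mu>) = complex_vector.span (e ` {i. l i = \<mu>})"
proof
  note k = spectral_seqD[OF K]
  have fin: "finite {i. l i = \<mu>}"
    by (rule finite_subset[OF _ spectral_seq_finite[OF K \<mu>]]) auto
  show "eigenspace K (of_real \<mu>) \<subseteq> complex_vector.span (e ` {i. l i = \<mu>})"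
  proof
    fix x assume "x \<in> eigenspace K (of_real \<mu>)"
    then have x: "K x = of_real \<mu> *\<^sub>C x" by (simp add: eigenspace_def)
    have z: "cinner x (e i) = 0" if "l i \<noteq> \<mu>" for i
    proof -
      have "of_real \<mu> * cinner x (e i) = cinner (K x) (e i)" by (simp add: x cinner_scaleC_left)
      also have "\<dots> = cinner x (K (e i))" by (rule sym)
      also have "\<dots> = of_real (l i) * cinner x (e i)" by (simp add: k(6) cinner_scaleR_right)
      finally show ?thesis using that by simp
    qed
    define y where "y = (\<Sum>i\<in>{i. l i = \<mu>}. (of_real \<mu> * cinner x (e i)) *\<^sub>C e i)"
    obtain N where N: "{i. l i = \<mu>} \<subseteq> {..<N}"
      using finite_nat_iff_bounded fin by auto
    have "(\<Sum>i<n. (of_real (l i) * cinner x (e i)) *\<^sub>C e i) = y" if "n \<ge> N" for n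
    proof -
      have "y = (\<Sum>i\<in>{i. l i = \<mu>}. (of_real (l i) * cinner x (e i)) *\<^sub>C e i)"
        unfolding y_def by (rule sum.cong) auto
      also have "\<dots> = (\<Sum>i<n. (of_real (l i) * cinner x (e i)) *\<^sub>C e i)"
        by (rule sum.mono_neutral_left) (use N that z in auto)
      finally show ?thesis ..
    qed
    then have "(\<lambda>n. \<Sum>i<n. (of_real (l i) * cinner x (e i)) *\<^sub>C e i) \<longlonglongrightarrow> y"
      by (intro tendsto_eventually) (auto simp: eventually_sequentially)
    then have "K x = y" using spectral_seq_tendsto[OF K] LIMSEQ_unique by blast
    then have "x = (1 / of_real \<mu>) *\<^sub>C y"
      using \<mu> x by (simp add: scaleC_scaleC scaleC_one flip: \<open>K x = y\<close>)
    also have "\<dots> \<in> complex_vector.span (e ` {i. l i = \<mu>})"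
      unfolding y_def
      by (intro complex_vector.span_scale complex_vector.span_sum complex_vector.span_base) auto
    finally show "x \<in> complex_vector.span (e ` {i. l i = \<mu>})" .
  qed
  show "complex_vector.span (e ` {i. l i = \<mu>}) \<subseteq> eigenspace K (of_real \<mu>)"
  proof (rule complex_vector.span_minimal)
    show "e ` {i. l i = \<mu>} \<subseteq> eigenspace K (of_real \<mu>)"
      by (auto simp: eigenspace_def k(6) scaleC_of_real)
    interpret K: bounded_linear K using bl by (rule bounded_clinearD)
    show "complex_vector.subspace (eigenspace K (of_real \<mu>))"
      by (rule complex_vector.subspaceI)
        (auto simp: eigenspace_def K.zero K.add scaleC_add_right bounded_clinearD(2)[OF bl] scaleC_scaleC mult.commute)
  qed
qed

lemma spectral_seq_eigenvalue_sequence: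
  assumes K: "spectral_seq K l e" and sym: "\<And>x y. cinner (K x) y = cinner x (K y)"
    and bl: "bounded_clinear K"
  shows "eigenvalue_sequence K l"
  unfolding eigenvalue_sequence_def
proof (intro conjI allI impI)
  show "decseq l" "0 \<le> l n" for n using spectral_seqD[OF K] by auto
  fix \<mu> :: real assume \<mu>: "0 < \<mu>"
  show fin: "finite {n. l n = \<mu>}"
    by (rule finite_subset[OF _ spectral_seq_finite[OF K \<mu>]]) auto
  have nz: "e i \<noteq> 0" if "i \<in> {n. l n = \<mu>}" for i
    using that \<mu> spectral_seqD(5)[OF K, of i] by auto
  note ind = semi_orthonormal_independent[OF spectral_seqD(1)[OF K] fin nz]
  have "complex_vector.dim (eigenspace K (of_real \<mu>)) = card (e ` {i. l i = \<mu>})"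
    unfolding spectral_seq_eigenspace[OF K sym bl \<mu>]
    by (rule complex_vector.dim_span_eq_card_independent[OF ind(2)])
  then show "card {n. l n = \<mu>} = complex_vector.dim (eigenspace K (of_real \<mu>))"
    using card_image[OF ind(1)] by simp
qed

lemma decseq_initial_segment:
  fixes s :: "nat \<Rightarrow> real"
  assumes "decseq s" "finite {n. \<mu> \<le> s n}"
  shows "{n. \<mu> \<le> s n} = {..<card {n. \<mu> \<le> s n}}"
proof -
  have down: "m \<in> {n. \<mu> \<le> s n}" if "n \<in> {n. \<mu> \<le> s n}" "m \<le> n" for m n
    using that decseqD[OF assms(1), of m n] by auto
  show ?thesis
  proof (cases "{n. \<mu> \<le> s n} = {}")
    case False
    define N where "N = Max {n. \<mu> \<le> s n}"
    have N: "N \<in> {n. \<mu> \<le> s n}" unfolding N_def by (rule Max_in[OF assms(2) False])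
    have le: "n \<le> N" if "n \<in> {n. \<mu> \<le> s n}" for n
      unfolding N_def by (rule Max_ge[OF assms(2) that])
    have "{n. \<mu> \<le> s n} = {..<Suc N}"
    proof (intro Set.set_eqI iffI)
      show "n \<in> {..<Suc N}" if "n \<in> {n. \<mu> \<le> s n}" for n using le[OF that] by simp
      show "n \<in> {n. \<mu> \<le> s n}" if "n \<in> {..<Suc N}" for n using that by (intro down[OF N]) simp
    qed
    then show ?thesis by simp
  qed simp
qed

text \<open>Both sequences take the same positive values with the same multiplicities, hence have
  equally many entries above each threshold; for decreasing sequences these entries form initial
  segments. \<open>eigenvalue_sequence\<close> does not ask for convergence to 0, so finiteness of
  the segments of s is borrowed from l.\<close>

lemma eigenvalue_sequence_unique:
  assumes s: "eigenvalue_sequence K s" and l: "eigenvalue_sequence K l" and lim: "l \<longlonglongrightarrow> 0"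
  shows "s = l"
proof -
  have ceq: "card {n. s n = \<mu>} = card {n. l n = \<mu>}" "finite {n. s n = \<mu>}" "finite {n. l n = \<mu>}" if "\<mu> > 0" for \<mu>
    using s l that unfolding eigenvalue_sequence_def by auto
  have ran: "\<mu> \<in> range s \<longleftrightarrow> \<mu> \<in> range l" if "\<mu> > 0" for \<mu>
  proof -
    have "\<mu> \<in> range s \<longleftrightarrow> {n. s n = \<mu>} \<noteq> {}" "\<mu> \<in> range l \<longleftrightarrow> {n. l n = \<mu>} \<noteq> {}" by auto
    then show ?thesis using ceq[OF that] by (metis card_eq_0_iff)
  qed
  have iff: "\<mu> \<le> s n \<longleftrightarrow> \<mu> \<le> l n" if \<mu>: "\<mu> > 0" for \<mu> n
  proof -
    have "eventually (\<lambda>i. l i < \<mu>) sequentially"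
      using lim \<mu> by (rule order_tendstoD)
    then obtain N where "\<And>i. i \<ge> N \<Longrightarrow> l i < \<mu>" by (auto simp: eventually_sequentially)
    then have "{i. \<mu> \<le> l i} \<subseteq> {..<N}" by (auto simp: not_le[symmetric])
    then have finl: "finite {i. \<mu> \<le> l i}" by (rule finite_subset) simp
    define V where "V = l ` {i. \<mu> \<le> l i}"
    have V: "finite V" "\<And>v. v \<in> V \<Longrightarrow> v > 0" using finl \<mu> by (auto simp: V_def)
    have sl: "{n. \<mu> \<le> l n} = (\<Union>v\<in>V. {n. l n = v})" by (auto simp: V_def)
    have ss: "{n. \<mu> \<le> s n} = (\<Union>v\<in>V. {n. s n = v})"
    proof (intro Set.set_eqI iffI)
      fix n assume n: "n \<in> {n. \<mu> \<le> s n}"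
      then have "s n \<in> range l" using ran[of "s n"] \<mu> by auto
      then obtain i where "l i = s n" by auto
      then have "s n \<in> V" using n by (auto simp: V_def intro!: image_eqI[of _ _ i])
      then show "n \<in> (\<Union>v\<in>V. {n. s n = v})" by auto
    qed (auto simp: V_def)
    have "card {n. \<mu> \<le> s n} = (\<Sum>v\<in>V. card {n. s n = v})"
      unfolding ss by (rule card_UN_disjoint) (use V ceq in auto)
    also have "\<dots> = (\<Sum>v\<in>V. card {n. l n = v})"
      by (intro sum.cong refl ceq V)
    also have "\<dots> = card {n. \<mu> \<le> l n}"
      unfolding sl by (rule card_UN_disjoint[symmetric]) (use V ceq in auto)
    finally have c: "card {n. \<mu> \<le> s n} = card {n. \<mu> \<le> l n}" .
    have "finite {n. \<mu> \<le> s n}" unfolding ss using V ceq by auto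
    then have "{n. \<mu> \<le> s n} = {..<card {n. \<mu> \<le> s n}}"
      using s by (intro decseq_initial_segment) (auto simp: eigenvalue_sequence_def)
    moreover have "{n. \<mu> \<le> l n} = {..<card {n. \<mu> \<le> l n}}"
      using l finl by (intro decseq_initial_segment) (auto simp: eigenvalue_sequence_def)
    ultimately have "{n. \<mu> \<le> s n} = {n. \<mu> \<le> l n}" using c by simp
    then show ?thesis by blast
  qed
  have nn: "0 \<le> s n" "0 \<le> l n" for n using s l by (auto simp: eigenvalue_sequence_def)
  show ?thesis
  proof
    fix n
    show "s n = l n"
      \<comment> \<open>Each of the two values serves as the threshold for the other; thresholds
        must be positive, hence the cases of zero.\<close>
      using iff[of "s n" n] iff[of "l n" n] nn[of n] by (cases "s n = 0"; cases "l n = 0") auto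
  qed
qed

lemma the_eigenvalue_sequence:
  assumes K: "spectral_seq K l e" and sym: "\<And>x y. cinner (K x) y = cinner x (K y)"
    and bl: "bounded_clinear K"
  shows "(THE s. eigenvalue_sequence K s) = l"
proof (rule the_equality)
  show l: "eigenvalue_sequence K l" by (rule spectral_seq_eigenvalue_sequence[OF K sym bl])
  show "s = l" if "eigenvalue_sequence K s" for s
    using eigenvalue_sequence_unique[OF that l spectral_seqD(4)[OF K]] .
qed

section \<open>Square roots, moduli and s-numbers\<close>

lemma tendsto_cinner_left:
  assumes "(f \<longlongrightarrow> x) F"
  shows "((\<lambda>n. cinner (f n) y) \<longlongrightarrow> cinner x y) F"
  unfolding cinner_eq_inner[of _ y] by (intro tendsto_Complex tendsto_inner assms tendsto_const)

lemma tendsto_cinner_right: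
  assumes "(f \<longlongrightarrow> x) F"
  shows "((\<lambda>n. cinner y (f n)) \<longlongrightarrow> cinner y x) F"
proof -
  have "((\<lambda>n. cnj (cinner (f n) y)) \<longlongrightarrow> cnj (cinner x y)) F"
    by (intro tendsto_cnj tendsto_cinner_left assms)
  then show ?thesis by (simp only: cinner_commute[symmetric])
qed

lemma bounded_clinear_scaleC: "bounded_linear (\<lambda>x :: 'a :: complex_hilbert_space. c *\<^sub>C x)"
  by (rule bounded_linear_intro[of _ "cmod c"])
    (simp_all add: scaleC_add_right scaleR_eq_scaleC scaleC_scaleC norm_scaleC mult.commute)

text \<open>The root is the series with coefficients sqrt (l i). Uniqueness among all non-negative
  roots, compact or not, is what the definite description in \<open>abs_operator\<close> demands:
  every root S' is determined on the \<open>e i\<close>, and on the remainders y it is small because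
  |S' y|^2 = <K y, y>.\<close>

lemma pos_compact_sqrt_spectral:
  assumes K: "pos_compact K" and sp: "spectral_seq K l e"
  shows "\<exists>S. nonneg_operator S \<and> (\<forall>x. S (S x) = K x) \<and> spectral_seq S (\<lambda>i. sqrt (l i)) e \<and>
    (\<forall>S'. nonneg_operator S' \<longrightarrow> (\<forall>x. S' (S' x) = K x) \<longrightarrow> S' = S)"
proof -
  note sp' = spectral_seqD[OF sp]
  define P where "P n x = (\<Sum>i<n. (of_real (sqrt (l i)) * cinner x (e i)) *\<^sub>C e i)" for n x
  have sqdec: "sqrt (l n) \<le> sqrt (l m)" if "m \<le> n" for m n
    using decseqD[OF sp'(2) that] by simp
  \<comment> \<open>In the tail all coefficients are at most sqrt (l m), and Bessel's inequality
    bounds the rest.\<close>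
  have diff: "norm (P n x - P m x) \<le> sqrt (l m) * norm x" if "m \<le> n" for m n x
  proof -
    have "P n x - P m x = (\<Sum>i\<in>{m..<n}. (of_real (sqrt (l i)) * cinner x (e i)) *\<^sub>C e i)"
    proof -
      have "{..<n} = {..<m} \<union> {m..<n}" "{..<m} \<inter> {m..<n} = {}" using that by auto
      then show ?thesis unfolding P_def by (simp add: sum.union_disjoint)
    qed
    then have "(norm (P n x - P m x))\<^sup>2 \<le> (\<Sum>i\<in>{m..<n}. (cmod (of_real (sqrt (l i)) * cinner x (e i)))\<^sup>2)"
      using norm_sum_semi_orthonormal_le[OF sp'(1)] by simp
    also have "\<dots> \<le> (\<Sum>i\<in>{m..<n}. l m * (cmod (cinner x (e i)))\<^sup>2)"
    proof (rule sum_mono)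
      fix i assume i: "i \<in> {m..<n}"
      have "(cmod (of_real (sqrt (l i)) * cinner x (e i)))\<^sup>2 = l i * (cmod (cinner x (e i)))\<^sup>2"
        using sp'(3)[of i] by (simp add: norm_mult power_mult_distrib)
      also have "\<dots> \<le> l m * (cmod (cinner x (e i)))\<^sup>2"
        using i decseqD[OF sp'(2), of m i] by (intro mult_right_mono) auto
      finally show "(cmod (of_real (sqrt (l i)) * cinner x (e i)))\<^sup>2 \<le> l m * (cmod (cinner x (e i)))\<^sup>2" .
    qed
    also have "\<dots> = l m * (\<Sum>i\<in>{m..<n}. (cmod (cinner x (e i)))\<^sup>2)" by (simp add: sum_distrib_left)
    also have "\<dots> \<le> l m * (norm x)\<^sup>2"
      by (intro mult_left_mono bessel_inequality sp') auto
    also have "\<dots> = (sqrt (l m) * norm x)\<^sup>2" using sp'(3)[of m] by (simp add: power_mult_distrib)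
    finally show ?thesis by (rule power2_le_imp_le) (simp add: sp'(3))
  qed
  have sq0: "(\<lambda>n. sqrt (l n)) \<longlonglongrightarrow> 0" using tendsto_real_sqrt[OF sp'(4)] by simp
  have conv: "convergent (\<lambda>n. P n x)" for x
  proof (rule Cauchy_convergent, rule CauchyI)
    fix c :: real assume c: "c > 0"
    have "(\<lambda>n. sqrt (l n) * norm x) \<longlonglongrightarrow> 0"
      using tendsto_mult[OF sq0 tendsto_const[of "norm x"]] by simp
    then have "eventually (\<lambda>n. sqrt (l n) * norm x < c) sequentially"
      using c by (rule order_tendstoD)
    then obtain M where M: "\<And>n. n \<ge> M \<Longrightarrow> sqrt (l n) * norm x < c" by (auto simp: eventually_sequentially)
    show "\<exists>M. \<forall>m\<ge>M. \<forall>n\<ge>M. norm (P m x - P n x) < c"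
    proof (intro exI[of _ M] allI impI)
      fix m n assume mn: "M \<le> m" "M \<le> n"
      show "norm (P m x - P n x) < c"
      proof (cases "m \<le> n")
        case True
        then show ?thesis using diff[OF True, of x] M[OF mn(1)] by (simp add: norm_minus_commute)
      next
        case False
        then have "n \<le> m" by simp
        then show ?thesis using diff[of n m x] M[OF mn(2)] by linarith
      qed
    qed
  qed
  define S where "S x = lim (\<lambda>n. P n x)" for x
  have S: "(\<lambda>n. P n x) \<longlonglongrightarrow> S x" for x
    unfolding S_def using conv convergent_LIMSEQ_iff by blast
  have Sdiff: "norm (S x - P m x) \<le> sqrt (l m) * norm x" for x m
  proof (rule LIMSEQ_le_const2)
    show "(\<lambda>n. norm (P n x - P m x)) \<longlonglongrightarrow> norm (S x - P m x)"
      by (intro tendsto_norm tendsto_diff S tendsto_const)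
    show "\<exists>N. \<forall>n\<ge>N. norm (P n x - P m x) \<le> sqrt (l m) * norm x" using diff by blast
  qed
  have Padd: "P n (x + y) = P n x + P n y" for n x y
    by (simp add: P_def cinner_add_left distrib_left scaleC_add_left sum.distrib)
  have PC: "P n (c *\<^sub>C x) = c *\<^sub>C P n x" for n c x
    by (simp add: P_def cinner_scaleC_left complex_vector.scale_sum_right scaleC_scaleC mult_ac)
  have Sadd: "S (x + y) = S x + S y" for x y
    using tendsto_add[OF S[of x] S[of y]] S[of "x + y"] unfolding Padd by (rule LIMSEQ_unique[rotated])
  have SC: "S (c *\<^sub>C x) = c *\<^sub>C S x" for c x
  proof (rule LIMSEQ_unique)
    show "(\<lambda>n. P n (c *\<^sub>C x)) \<longlonglongrightarrow> S (c *\<^sub>C x)" by (rule S)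
    show "(\<lambda>n. P n (c *\<^sub>C x)) \<longlonglongrightarrow> c *\<^sub>C S x"
      unfolding PC by (rule bounded_linear.tendsto[OF bounded_clinear_scaleC S])
  qed
  have bS: "bounded_linear S"
  proof (rule bounded_linear_intro[of _ "sqrt (l 0)"])
    show "S (r *\<^sub>R x) = r *\<^sub>R S x" for r x by (simp add: scaleR_eq_scaleC SC)
    show "norm (S x) \<le> norm x * sqrt (l 0)" for x
      using Sdiff[of x 0] by (simp add: P_def mult.commute)
  qed (rule Sadd)
  have bcS: "bounded_clinear S" using bS SC by (simp add: bounded_clinear_def)
  have Psym: "cinner (P n x) y = cinner x (P n y)" for n x y
    unfolding P_def cinner_sum_left cinner_sum_right
  proof (intro sum.cong refl)
    fix i
    have "cnj (cinner y (e i)) = cinner (e i) y" by (simp only: cinner_commute[symmetric])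
    then show "cinner ((of_real (sqrt (l i)) * cinner x (e i)) *\<^sub>C e i) y =
        cinner x ((of_real (sqrt (l i)) * cinner y (e i)) *\<^sub>C e i)"
      by (simp add: cinner_scaleC_left cinner_scaleC_right mult_ac)
  qed
  have Ssym: "cinner (S x) y = cinner x (S y)" for x y
    using tendsto_cinner_left[OF S[of x], of y] tendsto_cinner_right[OF S[of y], of x]
    unfolding Psym by (rule LIMSEQ_unique)
  have Ppos: "0 \<le> inner (P n x) x" for n x
  proof -
    have "cinner (P n x) x = (\<Sum>i<n. of_real (sqrt (l i) * (cmod (cinner x (e i)))\<^sup>2))"
      unfolding P_def cinner_sum_left
    proof (intro sum.cong refl)
      fix i
      have "cinner (e i) x = cnj (cinner x (e i))" by (rule cinner_commute)
      then show "cinner ((of_real (sqrt (l i)) * cinner x (e i)) *\<^sub>C e i) x = of_real (sqrt (l i) * (cmod (cinner x (e i)))\<^sup>2)"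
        by (simp add: cinner_scaleC_left complex_norm_square del: of_real_power)
    qed
    then have "inner (P n x) x = (\<Sum>i<n. sqrt (l i) * (cmod (cinner x (e i)))\<^sup>2)"
      unfolding Re_cinner[symmetric] by (simp only: Re_complex_of_real of_real_sum[symmetric])
    then show ?thesis using sp'(3) by (simp add: sum_nonneg)
  qed
  have Spos: "0 \<le> inner (S x) x" for x
    by (rule LIMSEQ_le_const[OF tendsto_inner[OF S tendsto_const]]) (use Ppos in auto)
  have nS: "nonneg_operator S"
    unfolding nonneg_operator_iff using bcS Ssym Spos by simp
  have root_e: "S' (e i) = sqrt (l i) *\<^sub>R e i"
    if S': "nonneg_operator S'" and SS: "\<And>x. S' (S' x) = K x" for S' i
  proof (cases "l i = 0")
    case True
    then have "e i = 0" using sp'(5) by simp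
    moreover have "bounded_linear S'" using S' by (simp add: nonneg_operator_iff bounded_clinear_def)
    ultimately show ?thesis by (simp add: linear_0 bounded_linear.linear)
  next
    case False
    then have li: "l i > 0" using sp'(3)[of i] by simp
    interpret S': bounded_linear S' using S' by (simp add: nonneg_operator_iff bounded_clinear_def)
    define v where "v = S' (e i) - sqrt (l i) *\<^sub>R e i"
    \<comment> \<open>This is (S' + sqrt l) (S' - sqrt l) e = K e - l e = 0; the first factor is
      injective because S' is non-negative and sqrt l > 0.\<close>
    have "S' v + sqrt (l i) *\<^sub>R v = 0"
      using li by (simp add: v_def S'.diff S'.scaleR SS sp'(6) scaleR_diff_right)
    then have "inner (S' v) v + sqrt (l i) * (norm v)\<^sup>2 = 0"
      by (metis inner_add_left inner_scaleR_left inner_zero_left power2_norm_eq_inner)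
    moreover have "0 \<le> inner (S' v) v" using S' by (simp add: nonneg_operator_iff)
    moreover have "0 \<le> sqrt (l i) * (norm v)\<^sup>2" using li by simp
    ultimately have "sqrt (l i) * (norm v)\<^sup>2 = 0" by linarith
    then have "v = 0" using li by simp
    then show ?thesis by (simp add: v_def)
  qed
  have Se: "S (e i) = sqrt (l i) *\<^sub>R e i" for i
  proof (rule LIMSEQ_unique[OF S])
    have "P n (e i) = sqrt (l i) *\<^sub>R e i" if "n > i" for n
    proof -
      have "P n (e i) = (\<Sum>j<n. if j = i then sqrt (l i) *\<^sub>R e i else 0)"
        unfolding P_def
      proof (intro sum.cong refl)
        fix j
        show "(of_real (sqrt (l j)) * cinner (e i) (e j)) *\<^sub>C e j = (if j = i then sqrt (l i) *\<^sub>R e i else 0)"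
          using sp'(1) by (cases "e i = 0") (auto simp: semi_orthonormal_def scaleC_of_real)
      qed
      then show ?thesis using that by simp
    qed
    then show "(\<lambda>n. P n (e i)) \<longlonglongrightarrow> sqrt (l i) *\<^sub>R e i"
      by (intro tendsto_eventually) (auto simp: eventually_sequentially intro!: exI[of _ "Suc i"])
  qed
  interpret S: bounded_linear S by (rule bS)
  have SS: "S (S x) = K x" for x
  proof (rule LIMSEQ_unique)
    show "(\<lambda>n. S (P n x)) \<longlonglongrightarrow> S (S x)" by (intro S.tendsto S)
    have "S (P n x) = (\<Sum>i<n. (of_real (l i) * cinner x (e i)) *\<^sub>C e i)" for n
    proof -
      have "S (P n x) = (\<Sum>i<n. (of_real (sqrt (l i)) * cinner x (e i)) *\<^sub>C (sqrt (l i) *\<^sub>R e i))"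
        by (simp add: P_def S.sum SC Se)
      also have "\<dots> = (\<Sum>i<n. (of_real (l i) * cinner x (e i)) *\<^sub>C e i)"
      proof (intro sum.cong refl)
        fix i
        have "complex_of_real (l i) = of_real (sqrt (l i)) * of_real (sqrt (l i))"
          using sp'(3)[of i] by (simp flip: of_real_mult)
        then show "(of_real (sqrt (l i)) * cinner x (e i)) *\<^sub>C (sqrt (l i) *\<^sub>R e i) =
            (of_real (l i) * cinner x (e i)) *\<^sub>C e i"
          by (simp add: scaleR_eq_scaleC scaleC_scaleC mult_ac)
      qed
      finally show ?thesis .
    qed
    then show "(\<lambda>n. S (P n x)) \<longlonglongrightarrow> K x" using spectral_seq_tendsto[OF sp] by simp
  qed
  have uniq: "S' = S" if S': "nonneg_operator S'" and SS': "\<And>x. S' (S' x) = K x" for S'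
  proof
    fix x
    interpret S': bounded_linear S' using S' by (simp add: nonneg_operator_iff bounded_clinear_def)
    have S'C: "S' (c *\<^sub>C y) = c *\<^sub>C S' y" for c y using S' by (simp add: nonneg_operator_iff bounded_clinear_def)
    define y where "y n = x - (\<Sum>i<n. cinner x (e i) *\<^sub>C e i)" for n
    have S'y: "S' (y n) = S' x - P n x" for n
      unfolding y_def S'.diff S'.sum S'C root_e[OF S' SS'] P_def
      by (simp add: scaleR_eq_scaleC scaleC_scaleC mult.commute)
    have ny: "norm (y n) \<le> norm x" for n
      unfolding y_def by (rule norm_remainder_semi_orthonormal_le[OF sp'(1) finite_lessThan])
    have bl: "bounded_linear K" and KC: "K (c *\<^sub>C z) = c *\<^sub>C K z" for c z
      using K by (auto simp: pos_compact_def compact_operator_def bounded_clinear_def)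
    interpret K: bounded_linear K by (rule bl)
    have "K (y n) = K x - (\<Sum>i<n. (of_real (l i) * cinner x (e i)) *\<^sub>C e i)" for n
      unfolding y_def K.diff K.sum KC sp'(6) by (simp add: scaleR_eq_scaleC scaleC_scaleC mult.commute)
    then have Ky: "norm (K (y n)) \<le> l n * norm x" for n using sp'(7) by simp
    have b: "(norm (S' x - P n x))\<^sup>2 \<le> l n * (norm x * norm x)" for n
    proof -
      have "cinner (S' (S' (y n))) (y n) = cinner (S' (y n)) (S' (y n))"
        using S' by (simp only: nonneg_operator_iff)
      then have "(norm (S' (y n)))\<^sup>2 = inner (K (y n)) (y n)"
        by (simp only: SS' power2_norm_eq_inner Re_cinner[symmetric])
      also have "\<dots> \<le> norm (K (y n)) * norm (y n)" by (rule norm_cauchy_schwarz)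
      also have "\<dots> \<le> l n * norm x * norm x" by (intro mult_mono Ky ny mult_nonneg_nonneg sp') auto
      finally show ?thesis by (simp add: S'y)
    qed
    have lim: "(\<lambda>n. l n * (norm x * norm x)) \<longlonglongrightarrow> 0"
      using tendsto_mult[OF sp'(4) tendsto_const[of "norm x * norm x"]] by simp
    have "(\<lambda>n. (norm (S' x - P n x))\<^sup>2) \<longlonglongrightarrow> 0"
      by (rule Lim_null_comparison[OF always_eventually lim]) (simp add: b)
    from tendsto_real_sqrt[OF this] have "(\<lambda>n. norm (S' x - P n x)) \<longlonglongrightarrow> 0" by simp
    then have "(\<lambda>n. S' x - P n x) \<longlonglongrightarrow> 0" by (rule tendsto_norm_zero_cancel)
    from tendsto_diff[OF tendsto_const[of "S' x"] this] have "(\<lambda>n. P n x) \<longlonglongrightarrow> S' x" by simp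
    then show "S' x = S x" by (rule LIMSEQ_unique[OF _ S])
  qed
  have "spectral_seq S (\<lambda>i. sqrt (l i)) e"
    unfolding spectral_seq_def
  proof (intro conjI allI)
    show "decseq (\<lambda>i. sqrt (l i))" using sqdec by (simp add: decseq_def)
    show "norm (S x - (\<Sum>i<n. (complex_of_real (sqrt (l i)) * cinner x (e i)) *\<^sub>C e i)) \<le> sqrt (l n) * norm x" for n x
      using Sdiff[of x n] by (simp add: P_def)
  qed (use sp' sq0 Se in auto)
  then show ?thesis using nS SS uniq by blast
qed

lemma pos_compact_cadjoint_comp:
  assumes T: "compact_operator T"
  shows "pos_compact (\<lambda>x. cadjoint T (T x))" "inner (cadjoint T (T x)) x = (norm (T x))\<^sup>2"
proof -
  have bT: "bounded_clinear T" using T by (rule compact_operatorD)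
  define S where "S = cadjoint T"
  have S: "bounded_clinear S" and TS: "cinner (T x) y = cinner x (S y)" for x y
    unfolding S_def using bounded_clinear_cadjoint[OF bT] cinner_cadjoint[OF bT] by auto
  have bl: "bounded_linear (\<lambda>x. S (T x))"
    by (rule bounded_linear_compose[OF bounded_clinearD(1)[OF S] bounded_clinearD(1)[OF bT]])
  have ST: "cinner (S (T x)) y = cinner (T x) (T y)" for x y
  proof -
    have "cinner (S (T x)) y = cnj (cinner y (S (T x)))" by (rule cinner_commute)
    also have "cinner y (S (T x)) = cinner (T y) (T x)" by (rule TS[symmetric])
    finally show ?thesis by (simp only: cinner_commute[symmetric])
  qed
  have "inner (S (T x)) x = (norm (T x))\<^sup>2" for x
    unfolding Re_cinner[symmetric] ST by (simp only: Re_cinner power2_norm_eq_inner)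
  then show *: "inner (cadjoint T (T x)) x = (norm (T x))\<^sup>2" for x unfolding S_def .
  have "compact_operator (\<lambda>x. S (T x))"
    unfolding compact_operator_def bounded_clinear_def
  proof (intro conjI allI impI bl)
    show "S (T (c *\<^sub>C x)) = c *\<^sub>C S (T x)" for c x
      by (simp add: bounded_clinearD(2)[OF S] bounded_clinearD(2)[OF bT])
    fix B :: "'a set" assume "bounded B"
    then have "compact (closure (T ` B))" by (rule compact_operatorD(4)[OF T])
    moreover have "continuous_on (closure (T ` B)) S"
      by (rule linear_continuous_on[OF bounded_clinearD(1)[OF S]])
    ultimately have c: "compact (S ` closure (T ` B))" by (rule compact_continuous_image[rotated])
    have "(\<lambda>x. S (T x)) ` B \<subseteq> S ` closure (T ` B)"
      using closure_subset[of "T ` B"] by auto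
    then have "closure ((\<lambda>x. S (T x)) ` B) \<subseteq> S ` closure (T ` B)"
      by (rule closure_minimal[OF _ compact_imp_closed[OF c]])
    then have "S ` closure (T ` B) \<inter> closure ((\<lambda>x. S (T x)) ` B) = closure ((\<lambda>x. S (T x)) ` B)" by auto
    then show "compact (closure ((\<lambda>x. S (T x)) ` B))"
      using compact_Int_closed[OF c closed_closure, of "(\<lambda>x. S (T x)) ` B"] by simp
  qed
  moreover have "cinner (S (T x)) y = cinner x (S (T y))" for x y
    unfolding ST by (rule TS)
  moreover have "0 \<le> inner (S (T x)) x" for x using *[of x] unfolding S_def by simp
  ultimately show "pos_compact (\<lambda>x. cadjoint T (T x))"
    unfolding pos_compact_def S_def by blast
qed

text \<open>Schmidt expansion, from the eigenvectors \<open>e\<close> of the adjoint of T times T.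
  The left vectors \<open>T (e i)\<close> stay unnormalised, so vanishing singular values need no
  separate case.\<close>

lemma compact_operator_svd:
  assumes T: "compact_operator T"
  shows "\<exists>t e. semi_orthonormal e \<and> decseq t \<and> (\<forall>i. 0 \<le> t i) \<and> t \<longlonglongrightarrow> 0 \<and>
    (\<forall>i. norm (T (e i)) = t i) \<and> (\<forall>n x. norm (T x - (\<Sum>i<n. cinner x (e i) *\<^sub>C T (e i))) \<le> t n * norm x) \<and>
    (\<forall>n. s_number T (Suc n) = t n)"
proof -
  define K where "K = (\<lambda>x. cadjoint T (T x))"
  have K: "pos_compact K" and KT: "inner (K x) x = (norm (T x))\<^sup>2" for x
    unfolding K_def by (rule pos_compact_cadjoint_comp[OF T])+
  obtain l e where sp: "spectral_seq K l e" using pos_compact_spectral_seq[OF K] by blast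
  note sp' = spectral_seqD[OF sp]
  obtain S where S: "nonneg_operator S" "\<And>x. S (S x) = K x" "spectral_seq S (\<lambda>i. sqrt (l i)) e"
      "\<And>S'. nonneg_operator S' \<Longrightarrow> (\<And>x. S' (S' x) = K x) \<Longrightarrow> S' = S"
    using pos_compact_sqrt_spectral[OF K sp] by blast
  have comp: "S' \<circ> S' = cadjoint T \<circ> T \<longleftrightarrow> (\<forall>x. S' (S' x) = K x)" for S'
    by (simp add: K_def fun_eq_iff)
  have absT: "abs_operator T = S"
    unfolding abs_operator_def comp
  proof (rule the_equality)
    show "nonneg_operator S \<and> (\<forall>x. S (S x) = K x)" using S(1,2) by simp
    show "S' = S" if "nonneg_operator S' \<and> (\<forall>x. S' (S' x) = K x)" for S'
      using that by (intro S(4)) simp_all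
  qed
  have "(THE s. eigenvalue_sequence S s) = (\<lambda>i. sqrt (l i))"
    by (rule the_eigenvalue_sequence[OF S(3)]) (use S(1) in \<open>auto simp: nonneg_operator_iff\<close>)
  then have sn: "s_number T (Suc n) = sqrt (l n)" for n
    by (simp add: s_number_def absT)
  note spS = spectral_seqD[OF S(3)]
  have bT: "bounded_linear T" and TC: "T (c *\<^sub>C x) = c *\<^sub>C T x" for c x
    using T by (rule compact_operatorD)+
  interpret T: bounded_linear T by (rule bT)
  have Te: "norm (T (e i)) = sqrt (l i)" for i
  proof -
    have "(norm (T (e i)))\<^sup>2 = l i * (norm (e i))\<^sup>2"
      unfolding KT[symmetric] sp'(6) by (simp add: power2_norm_eq_inner)
    also have "\<dots> = l i"
      using sp'(5)[of i] norm_semi_orthonormal[OF sp'(1), of i] by (cases "e i = 0") simp_all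
    finally show ?thesis by (metis real_sqrt_unique norm_ge_zero)
  qed
  have rem: "norm (T x - (\<Sum>i<n. cinner x (e i) *\<^sub>C T (e i))) \<le> sqrt (l n) * norm x" for n x
  proof -
    define y where "y = x - (\<Sum>i<n. cinner x (e i) *\<^sub>C e i)"
    have Ty: "T x - (\<Sum>i<n. cinner x (e i) *\<^sub>C T (e i)) = T y"
      by (simp add: y_def T.diff T.sum TC)
    have ny: "norm y \<le> norm x"
      unfolding y_def by (rule norm_remainder_semi_orthonormal_le[OF sp'(1) finite_lessThan])
    have bl: "bounded_linear K" and KC: "K (c *\<^sub>C z) = c *\<^sub>C K z" for c z
      using K by (auto simp: pos_compact_def compact_operator_def bounded_clinear_def)
    interpret K: bounded_linear K by (rule bl)
    have "K y = K x - (\<Sum>i<n. (of_real (l i) * cinner x (e i)) *\<^sub>C e i)"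
      unfolding y_def K.diff K.sum KC sp'(6) by (simp add: scaleR_eq_scaleC scaleC_scaleC mult.commute)
    then have Ky: "norm (K y) \<le> l n * norm x" using sp'(7) by simp
    have "(norm (T y))\<^sup>2 = inner (K y) y" by (rule KT[symmetric])
    also have "\<dots> \<le> norm (K y) * norm y" by (rule norm_cauchy_schwarz)
    also have "\<dots> \<le> l n * norm x * norm x" by (intro mult_mono Ky ny mult_nonneg_nonneg sp') auto
    also have "\<dots> = (sqrt (l n) * norm x)\<^sup>2" using sp'(3)[of n] by (simp add: power_mult_distrib power2_eq_square)
    finally show ?thesis unfolding Ty by (rule power2_le_imp_le) (simp add: sp'(3))
  qed
  show ?thesis
    by (intro exI conjI allI) (rule spS(1-4) Te rem sn)+
qed

text \<open>C is itself a non-negative square root of its adjoint times itself, so by uniqueness it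
  equals its modulus and its s-numbers are its own eigenvalues.\<close>

lemma nonneg_compact_spectral_seq:
  assumes C: "nonneg_operator C" "compact_operator C"
  shows "\<exists>l v. spectral_seq C l v \<and> (\<forall>n. s_number C (Suc n) = l n)"
proof -
  have sym: "cinner (C x) y = cinner x (C y)" for x y using C(1) by (simp only: nonneg_operator_iff)
  have pc: "pos_compact C" using C unfolding nonneg_operator_iff pos_compact_def by blast
  obtain l v where sp: "spectral_seq C l v" using pos_compact_spectral_seq[OF pc] by blast
  have Cad: "cadjoint C = C" using C(1) by (simp add: nonneg_operator_def self_adjoint_def)
  define K where "K = (\<lambda>x. cadjoint C (C x))"
  have K: "pos_compact K" unfolding K_def by (rule pos_compact_cadjoint_comp[OF C(2)])
  obtain k e where "spectral_seq K k e" using pos_compact_spectral_seq[OF K] by blast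
  from pos_compact_sqrt_spectral[OF K this] obtain S where
    S: "\<And>S'. nonneg_operator S' \<Longrightarrow> (\<And>x. S' (S' x) = K x) \<Longrightarrow> S' = S" by blast
  have CK: "C (C x) = K x" for x by (simp add: K_def Cad)
  have comp: "S' \<circ> S' = cadjoint C \<circ> C \<longleftrightarrow> (\<forall>x. S' (S' x) = K x)" for S'
    by (simp add: K_def fun_eq_iff)
  have "abs_operator C = C"
    unfolding abs_operator_def comp
  proof (rule the_equality)
    show "nonneg_operator C \<and> (\<forall>x. C (C x) = K x)" using C(1) CK by simp
    show "S' = C" if "nonneg_operator S' \<and> (\<forall>x. S' (S' x) = K x)" for S'
      using that S[of S'] S[OF C(1) CK] by simp
  qed
  moreover have "(THE s. eigenvalue_sequence C s) = l"
    by (rule the_eigenvalue_sequence[OF sp sym]) (use C in \<open>simp add: nonneg_operator_iff\<close>)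
  ultimately have "s_number C (Suc n) = l n" for n by (simp add: s_number_def)
  then show ?thesis using sp by blast
qed

section \<open>Determinants\<close>

text \<open>In the Leibniz formula permutations are some of the maps from indices to indices, and
  the sum over all maps is the expanded product of the row sums.\<close>

lemma norm_det_le_prod_row_sums:
  fixes M :: "complex mat"
  assumes M: "M \<in> carrier_mat n n"
  shows "norm (Determinant.det M) \<le> (\<Prod>i<n. \<Sum>j<n. norm (M $$ (i, j)))"
proof -
  have "norm (Determinant.det M) \<le>
      (\<Sum>p | p permutes {0..<n}. norm (signof p * (\<Prod>i = 0..<n. M $$ (i, p i))))"
    unfolding det_def'[OF M] by (rule norm_sum)
  also have "\<dots> = (\<Sum>p | p permutes {0..<n}. \<Prod>i<n. norm (M $$ (i, p i)))"
    by (intro sum.cong refl) (auto simp: norm_mult prod_norm sign_def lessThan_atLeast0)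
  \<comment> \<open>A permutation is the identity outside {..<n}, whereas \<open>PiE\<close> wants
    \<open>undefined\<close> there; \<open>restrict\<close> mediates.\<close>
  also have "\<dots> = (\<Sum>g\<in>(\<lambda>p. restrict p {..<n}) ` {p. p permutes {0..<n}}. \<Prod>i<n. norm (M $$ (i, g i)))"
  proof (subst sum.reindex)
    show "inj_on (\<lambda>p. restrict p {..<n}) {p. p permutes {0..<n}}"
    proof (rule inj_onI)
      fix p q assume p: "p \<in> {p. p permutes {0..<n}}" and q: "q \<in> {p. p permutes {0..<n}}"
        and eq: "restrict p {..<n} = restrict q {..<n}"
      show "p = q"
      proof
        fix x show "p x = q x"
        proof (cases "x < n")
          case True
          then show ?thesis using fun_cong[OF eq, of x] by simp
        next
          case False
          then show ?thesis using p q by (auto simp: permutes_def)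
        qed
      qed
    qed
  qed (auto intro!: sum.cong)
  also have "\<dots> \<le> (\<Sum>g\<in>PiE {..<n} (\<lambda>_. {..<n}). \<Prod>i<n. norm (M $$ (i, g i)))"
  proof (rule sum_mono2)
    show "(\<lambda>p. restrict p {..<n}) ` {p. p permutes {0..<n}} \<subseteq> PiE {..<n} (\<lambda>_. {..<n})"
      by (auto dest: permutes_in_image)
  qed (auto intro: finite_PiE prod_nonneg)
  also have "\<dots> = (\<Prod>i<n. \<Sum>j<n. norm (M $$ (i, j)))"
    by (rule prod_sum_PiE[symmetric]) auto
  finally show ?thesis .
qed

text \<open>Since 1 - z B = z (1/z - B), this is the characteristic polynomial at 1/z, rescaled by
  z^n.\<close>

lemma det_one_minus_eq_prod:
  fixes B :: "complex mat"
  assumes B: "B \<in> carrier_mat n n" and f: "char_poly B = (\<Prod>a\<leftarrow>as. [:- a, 1:])" "length as = n"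
    and z: "z \<noteq> 0"
  shows "Determinant.det (1\<^sub>m n - z \<cdot>\<^sub>m B) = (\<Prod>a\<leftarrow>as. 1 - z * a)"
proof -
  have "1\<^sub>m n - z \<cdot>\<^sub>m B = z \<cdot>\<^sub>m (- char_matrix B (1 / z))"
    using B z by (intro eq_matI) (auto simp: char_matrix_def field_simps)
  then have "Determinant.det (1\<^sub>m n - z \<cdot>\<^sub>m B) = z ^ n * poly (char_poly B) (1 / z)"
    using B by (simp add: char_poly_matrix[OF B]) (simp add: char_matrix_def)
  also have "\<dots> = (\<Prod>a\<leftarrow>as. 1 - z * a)"
    unfolding f(1) f(2)[symmetric]
  proof (induction as)
    case (Cons a as)
    have "z ^ length (a # as) * poly (\<Prod>b\<leftarrow>a # as. [:- b, 1:]) (1 / z) =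
        (z * (1 / z - a)) * (z ^ length as * poly (\<Prod>b\<leftarrow>as. [:- b, 1:]) (1 / z))"
      by (simp add: algebra_simps)
    also have "z * (1 / z - a) = 1 - z * a"
      using z by (simp add: right_diff_distrib)
    finally show ?case
      using Cons.IH by simp
  qed simp
  finally show ?thesis .
qed

text \<open>The list consists of the eigenvalues of the matrix with blocks diag l, P, Q, S, an
  eigenvector being written as a pair (a, b). The estimate splits det(1 - z B) into the determinant
  of the diagonal block and that of its Schur complement, to which the row-sum bound
  applies.\<close>

lemma obtain_block_eigenvalues:
  fixes l :: "nat \<Rightarrow> complex" and P Q S :: "nat \<Rightarrow> nat \<Rightarrow> complex"
  obtains \<mu>s :: "complex list" where
    "\<And>\<mu>. \<mu> \<in> set \<mu>s \<Longrightarrow> \<exists>a b. (\<exists>i<n. a i \<noteq> 0 \<or> b i \<noteq> 0) \<and>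
       (\<forall>i<n. l i * a i + (\<Sum>j<n. P i j * b j) = \<mu> * a i) \<and>
       (\<forall>k<n. (\<Sum>i<n. Q k i * a i) + (\<Sum>j<n. S k j * b j) = \<mu> * b k)"
    "\<And>z. z \<noteq> 0 \<Longrightarrow> (\<And>i. i < n \<Longrightarrow> z * l i \<noteq> 1) \<Longrightarrow>
       norm (\<Prod>\<mu>\<leftarrow>\<mu>s. 1 - z * \<mu>) \<le> (\<Prod>i<n. norm (1 - z * l i)) *
         (\<Prod>k<n. \<Sum>j<n. norm (of_bool (k = j) - z * S k j - (\<Sum>i<n. z^2 * Q k i * P i j / (1 - z * l i))))"
proof -
  define L where "L = Matrix.mat n n (\<lambda>(i, j). if i = j then l i else 0)"
  define P' where "P' = Matrix.mat n n (\<lambda>(i, j). P i j)"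
  define Q' where "Q' = Matrix.mat n n (\<lambda>(i, j). Q i j)"
  define S' where "S' = Matrix.mat n n (\<lambda>(i, j). S i j)"
  have carr: "L \<in> carrier_mat n n" "P' \<in> carrier_mat n n" "Q' \<in> carrier_mat n n" "S' \<in> carrier_mat n n"
    by (auto simp: L_def P'_def Q'_def S'_def)
  define B where "B = four_block_mat L P' Q' S'"
  have B: "B \<in> carrier_mat (n + n) (n + n)"
    unfolding B_def using carr by auto
  obtain \<mu>s where \<mu>s: "char_poly B = (\<Prod>a\<leftarrow>\<mu>s. [:- a, 1:])" "length \<mu>s = n + n"
    using char_poly_factorized[OF B] by auto
  show ?thesis
  proof (rule that[of \<mu>s])
    fix \<mu> assume "\<mu> \<in> set \<mu>s"
    then have "poly (char_poly B) \<mu> = 0"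
      unfolding \<mu>s(1) by (induction \<mu>s) auto
    then obtain v where v: "v \<in> carrier_vec (n + n)" "v \<noteq> 0\<^sub>v (n + n)" "B *\<^sub>v v = \<mu> \<cdot>\<^sub>v v"
      using B by (auto simp: eigenvalue_root_char_poly[OF B, symmetric] eigenvalue_def eigenvector_def)
    define v1 where "v1 = vec_first v n"
    define v2 where "v2 = vec_last v n"
    have vc: "v1 \<in> carrier_vec n" "v2 \<in> carrier_vec n" and vv: "v = v1 @\<^sub>v v2"
      using v(1) by (auto simp: v1_def v2_def)
    have eq: "(L *\<^sub>v v1 + P' *\<^sub>v v2) @\<^sub>v (Q' *\<^sub>v v1 + S' *\<^sub>v v2) = \<mu> \<cdot>\<^sub>v (v1 @\<^sub>v v2)"
      using v(3) unfolding vv B_def by (subst (asm) four_block_mat_mult_vec) (use carr vc in auto)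
    have L': "(L *\<^sub>v v1) $ i = l i * v1 $ i" if "i < n" for i
    proof -
      have "(L *\<^sub>v v1) $ i = (\<Sum>j = 0..<n. (if i = j then l i else 0) * v1 $ j)"
        using that vc by (auto simp: L_def scalar_prod_def)
      also have "\<dots> = (\<Sum>j = 0..<n. if i = j then l i * v1 $ j else 0)"
        by (intro sum.cong) auto
      finally show ?thesis using that by simp
    qed
    have e1: "l i * v1 $ i + (\<Sum>j<n. P i j * v2 $ j) = \<mu> * v1 $ i" if "i < n" for i
      using arg_cong[OF eq, of "\<lambda>w. w $ i"] that vc carr
      by (simp add: L'[OF that] del: index_mult_mat_vec)
        (simp add: P'_def scalar_prod_def lessThan_atLeast0)
    have e2: "(\<Sum>i<n. Q k i * v1 $ i) + (\<Sum>j<n. S k j * v2 $ j) = \<mu> * v2 $ k" if "k < n" for k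
      using arg_cong[OF eq, of "\<lambda>w. w $ (n + k)"] that vc carr
      by (simp add: Q'_def S'_def scalar_prod_def lessThan_atLeast0)
    have "\<exists>i<n. v1 $ i \<noteq> 0 \<or> v2 $ i \<noteq> 0"
    proof (rule ccontr)
      assume *: "\<not> ?thesis"
      have "v = 0\<^sub>v (n + n)"
        unfolding vv using * vc by (intro eq_vecI) auto
      then show False using v(2) by simp
    qed
    then show "\<exists>a b. (\<exists>i<n. a i \<noteq> 0 \<or> b i \<noteq> 0) \<and>
       (\<forall>i<n. l i * a i + (\<Sum>j<n. P i j * b j) = \<mu> * a i) \<and>
       (\<forall>k<n. (\<Sum>i<n. Q k i * a i) + (\<Sum>j<n. S k j * b j) = \<mu> * b k)"
      using e1 e2 by (intro exI[of _ "\<lambda>i. v1 $ i"] exI[of _ "\<lambda>i. v2 $ i"]) auto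
  next
    fix z :: complex assume z: "z \<noteq> 0" and zl: "\<And>i. i < n \<Longrightarrow> z * l i \<noteq> 1"
    define E where "E = Matrix.mat n n (\<lambda>(i, j). if i = j then 1 - z * l i else 0)"
    define E' where "E' = Matrix.mat n n (\<lambda>(i, j). if i = j then 1 / (1 - z * l i) else 0)"
    define F where "F = Matrix.mat n n (\<lambda>(i, j). z * P i j / (1 - z * l i))"
    \<comment> \<open>The Schur complement of the block 1 - z diag l.\<close>
    define M where "M = Matrix.mat n n (\<lambda>(k, j). of_bool (k = j) - z * S k j -
      (\<Sum>i<n. z^2 * Q k i * P i j / (1 - z * l i)))"
    define G where "G = Matrix.mat n n (\<lambda>(k, i). - z * Q k i / (1 - z * l i))"
    have c: "E \<in> carrier_mat n n" "E' \<in> carrier_mat n n" "F \<in> carrier_mat n n" "M \<in> carrier_mat n n"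
        "G \<in> carrier_mat n n"
      by (auto simp: E_def E'_def F_def M_def G_def)
    have N_blocks: "1\<^sub>m (n + n) - z \<cdot>\<^sub>m B = four_block_mat E (- z \<cdot>\<^sub>m P') (- z \<cdot>\<^sub>m Q') (1\<^sub>m n - z \<cdot>\<^sub>m S')"
      unfolding B_def using carr c
      by (intro eq_matI) (auto simp: E_def L_def P'_def Q'_def S'_def)
    have diag: "(\<Sum>j = 0..<n. (if i = j then c else 0) * y j) = c * y i" if "i < n"
      for i c and y :: "nat \<Rightarrow> complex"
    proof -
      have "(\<Sum>j = 0..<n. (if i = j then c else 0) * y j) = (\<Sum>j = 0..<n. if i = j then c * y j else 0)"
        by (intro sum.cong) auto
      then show ?thesis using that by simp
    qed
    have diag': "(\<Sum>j = 0..<n. y j * (if j = i then x j else 0)) = y i * x i" if "i < n"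
      for i and x y :: "nat \<Rightarrow> complex"
    proof -
      have "(\<Sum>j = 0..<n. y j * (if j = i then x j else 0)) = (\<Sum>j = 0..<n. if j = i then y j * x j else 0)"
        by (intro sum.cong) auto
      then show ?thesis using that by simp
    qed
    have canc: "(1 - z * l i) * (x / (1 - z * l i)) = x" if "i < n" for i x
      using zl[OF that] by simp
    have b1: "E * E' + (- z \<cdot>\<^sub>m P') * 0\<^sub>m n n = 1\<^sub>m n"
      using carr c zl
      by (intro eq_matI) (auto simp: E_def E'_def scalar_prod_def diag)
    have b2: "E * F + (- z \<cdot>\<^sub>m P') * 1\<^sub>m n = 0\<^sub>m n n"
      using carr c zl
      by (intro eq_matI) (auto simp: E_def F_def P'_def scalar_prod_def diag canc simp del: times_divide_eq_right)
    have b3: "(- z \<cdot>\<^sub>m Q') * E' + (1\<^sub>m n - z \<cdot>\<^sub>m S') * 0\<^sub>m n n = G"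
    proof (rule eq_matI)
      fix i j assume "i < dim_row G" "j < dim_col G"
      then have ij: "i < n" "j < n" using c by auto
      have "((- z \<cdot>\<^sub>m Q') * E') $$ (i, j) = (\<Sum>k = 0..<n. (- z * Q i k) * (if k = j then 1 / (1 - z * l k) else 0))"
        using ij carr c by (simp add: Q'_def E'_def scalar_prod_def)
      also have "\<dots> = (- z * Q i j) * (1 / (1 - z * l j))"
        by (rule diag'[OF ij(2)])
      finally show "((- z \<cdot>\<^sub>m Q') * E' + (1\<^sub>m n - z \<cdot>\<^sub>m S') * 0\<^sub>m n n) $$ (i, j) = G $$ (i, j)"
        using ij carr c by (simp add: G_def)
    qed (use c carr in auto)
    have b4: "(- z \<cdot>\<^sub>m Q') * F + (1\<^sub>m n - z \<cdot>\<^sub>m S') * 1\<^sub>m n = M"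
    proof (rule eq_matI)
      fix i j assume "i < dim_row M" "j < dim_col M"
      then have ij: "i < n" "j < n" using c by auto
      have "((- z \<cdot>\<^sub>m Q') * F) $$ (i, j) = - (\<Sum>k<n. z^2 * Q i k * P k j / (1 - z * l k))"
        using ij carr c unfolding sum_negf[symmetric]
        by (simp add: Q'_def F_def scalar_prod_def lessThan_atLeast0 power2_eq_square mult_ac)
      moreover have "((1\<^sub>m n - z \<cdot>\<^sub>m S') * 1\<^sub>m n) $$ (i, j) = of_bool (i = j) - z * S i j"
        using ij carr by (simp add: S'_def)
      ultimately show "((- z \<cdot>\<^sub>m Q') * F + (1\<^sub>m n - z \<cdot>\<^sub>m S') * 1\<^sub>m n) $$ (i, j) = M $$ (i, j)"
        using ij carr c by (simp add: M_def)
    qed (use c carr in auto)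
    have cc: "- z \<cdot>\<^sub>m P' \<in> carrier_mat n n" "- z \<cdot>\<^sub>m Q' \<in> carrier_mat n n"
        "1\<^sub>m n - z \<cdot>\<^sub>m S' \<in> carrier_mat n n"
      using carr by auto
    define N where "N = 1\<^sub>m (n + n) - z \<cdot>\<^sub>m B"
    \<comment> \<open>Right multiplication by W performs the elimination: it turns the diagonal
      block into 1 and clears the upper right block, leaving M in the lower right corner.\<close>
    define W where "W = four_block_mat E' F (0\<^sub>m n n) (1\<^sub>m n)"
    define W' where "W' = four_block_mat (1\<^sub>m n) (0\<^sub>m n n) G M"
    have NW: "N \<in> carrier_mat (n + n) (n + n)" "W \<in> carrier_mat (n + n) (n + n)"
      unfolding N_def W_def using B c by auto
    have prod: "N * W = W'"
      unfolding N_def N_blocks W_def W'_def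
      by (simp only: mult_four_block_mat[OF c(1) cc c(2,3) zero_carrier_mat one_carrier_mat] b1 b2 b3 b4)
    have detE': "Determinant.det E' = (\<Prod>i<n. 1 / (1 - z * l i))"
    proof -
      have "upper_triangular E'"
        by (simp add: E'_def upper_triangular_def)
      then have "Determinant.det E' = prod_list (diag_mat E')"
        using c(2) by (rule det_upper_triangular)
      also have "\<dots> = (\<Prod>i<n. 1 / (1 - z * l i))"
        unfolding prod_list_diag_prod by (simp add: E'_def lessThan_atLeast0)
      finally show ?thesis .
    qed
    have "Determinant.det N * Determinant.det W = Determinant.det W'"
      unfolding prod[symmetric] using det_mult[OF NW] by simp
    moreover have "Determinant.det W = (\<Prod>i<n. 1 / (1 - z * l i))"
      unfolding W_def using det_four_block_mat_lower_left_zero[OF c(2,3) refl one_carrier_mat] detE' by simp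
    moreover have "Determinant.det W' = Determinant.det M"
      unfolding W'_def using det_four_block_mat_upper_right_zero[OF one_carrier_mat refl c(5,4)] by simp
    moreover have inv: "(\<Prod>i<n. 1 / (1 - z * l i)) = 1 / (\<Prod>i<n. 1 - z * l i)"
      by (simp add: prod_dividef)
    have nz: "(\<Prod>i<n. 1 - z * l i) \<noteq> 0"
      using zl by simp
    ultimately have "(\<Prod>\<mu>\<leftarrow>\<mu>s. 1 - z * \<mu>) * (\<Prod>i<n. 1 / (1 - z * l i)) = Determinant.det M"
      using det_one_minus_eq_prod[OF B \<mu>s z] by (simp add: N_def)
    then have "(\<Prod>\<mu>\<leftarrow>\<mu>s. 1 - z * \<mu>) = (\<Prod>i<n. 1 - z * l i) * Determinant.det M"
      using nz unfolding inv by (simp add: divide_eq_eq mult.commute)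
    moreover have "norm (Determinant.det M) \<le> (\<Prod>k<n. \<Sum>j<n. norm (of_bool (k = j) - z * S k j - (\<Sum>i<n. z^2 * Q k i * P i j / (1 - z * l i))))"
      using norm_det_le_prod_row_sums[OF c(4)] by (simp add: M_def)
    ultimately show "norm (\<Prod>\<mu>\<leftarrow>\<mu>s. 1 - z * \<mu>) \<le> (\<Prod>i<n. norm (1 - z * l i)) *
         (\<Prod>k<n. \<Sum>j<n. norm (of_bool (k = j) - z * S k j - (\<Sum>i<n. z^2 * Q k i * P i j / (1 - z * l i))))"
      by (simp add: norm_mult prod_norm mult_left_mono prod_nonneg)
  qed
qed

section \<open>Means of logarithms over circles\<close>

lemma has_integral_cis_multiple:
  "((\<lambda>t. cis (of_int m * t)) has_integral (if m = 0 then of_real (2 * pi) else 0)) {0..2 * pi}"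
proof (cases "m = 0")
  case True
  then show ?thesis
    using has_integral_const_real[of "1 :: complex" 0 "2 * pi"] by (simp add: scaleR_conv_of_real)
next
  case False
  have "((\<lambda>t. cis (of_int m * t)) has_integral
      (cis (of_int m * (2 * pi)) / (\<i> * of_int m) - cis (of_int m * 0) / (\<i> * of_int m))) {0..2 * pi}"
  proof (rule fundamental_theorem_of_calculus)
    fix t :: real
    have "((\<lambda>z. exp (\<i> * (of_int m * z)) / (\<i> * of_int m)) has_field_derivative
        exp (\<i> * (of_int m * of_real t))) (at (of_real t))"
      using False by (auto intro!: derivative_eq_intros simp: field_simps)
    from has_vector_derivative_real_field[OF this, of "{0..2 * pi}"]
    show "((\<lambda>t. cis (of_int m * t) / (\<i> * of_int m)) has_vector_derivative cis (of_int m * t))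
        (at t within {0..2 * pi})"
      by (simp add: cis_conv_exp)
  qed simp
  moreover have "cis (of_int m * (2 * pi)) = 1"
    using cis_multiple_2pi[of "of_int m"] by (simp add: mult_ac)
  ultimately show ?thesis
    using False by simp
qed

lemma has_integral_Re_power_cis_cos:
  fixes \<mu> :: complex
  assumes "n > 0"
  shows "((\<lambda>t. Re (c * (\<mu> * cis t) ^ n) * cos (real k * t)) has_integral
    (if n = k then pi * Re (c * \<mu> ^ n) else 0)) {0..2 * pi}"
proof -
  have eq: "Re (c * (\<mu> * cis t) ^ n) * cos (real k * t) =
     Re (c * \<mu> ^ n / 2 * (cis (of_int (int n + int k) * t) + cis (of_int (int n - int k) * t)))" for t
  proof -
    have "complex_of_real (cos (real k * t)) = (cis (real k * t) + cis (- (real k * t))) / 2"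
      by (simp add: complex_eq_iff)
    moreover have "(\<mu> * cis t) ^ n = \<mu> ^ n * cis (real n * t)"
      by (simp add: power_mult_distrib Complex.DeMoivre)
    ultimately have "c * (\<mu> * cis t) ^ n * of_real (cos (real k * t)) =
      c * \<mu> ^ n / 2 * (cis (real n * t) * cis (real k * t) + cis (real n * t) * cis (- (real k * t)))"
      by (simp only:) (simp add: algebra_simps)
    also have "\<dots> = c * \<mu> ^ n / 2 * (cis (of_int (int n + int k) * t) + cis (of_int (int n - int k) * t))"
      by (simp add: cis_mult algebra_simps)
    finally have *: "c * (\<mu> * cis t) ^ n * of_real (cos (real k * t)) = \<dots>" .
    have "Re (w * of_real x) = Re w * x" for w x
      by simp
    then show ?thesis
      using arg_cong[OF *, of Re] by metis
  qed
  have "((\<lambda>t. c * \<mu> ^ n / 2 * (cis (of_int (int n + int k) * t) + cis (of_int (int n - int k) * t)))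
     has_integral (c * \<mu> ^ n / 2 * ((if int n + int k = 0 then of_real (2 * pi) else 0) +
       (if int n - int k = 0 then of_real (2 * pi) else 0)))) {0..2 * pi}"
    by (intro has_integral_mult_right has_integral_add has_integral_cis_multiple)
  then have "((\<lambda>t. Re (c * \<mu> ^ n / 2 * (cis (of_int (int n + int k) * t) + cis (of_int (int n - int k) * t))))
     has_integral Re (c * \<mu> ^ n / 2 * ((if int n + int k = 0 then of_real (2 * pi) else 0) +
       (if int n - int k = 0 then of_real (2 * pi) else 0)))) {0..2 * pi}"
    by (rule has_integral_Re)
  moreover have "Re (c * \<mu> ^ n / 2 * ((if int n + int k = 0 then of_real (2 * pi) else 0) +
       (if int n - int k = 0 then of_real (2 * pi) else 0))) = (if n = k then pi * Re (c * \<mu> ^ n) else 0)"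
    using assms by auto
  ultimately show ?thesis
    unfolding eq by simp
qed

text \<open>Real part of the power series of ln (1 - mu z) on the unit circle, integrated termwise;
  convergence is uniform because norm mu < 1.\<close>

lemma has_integral_ln_norm_one_minus_cos:
  fixes \<mu> :: complex
  assumes \<mu>: "norm \<mu> < 1"
  shows "((\<lambda>t. ln (norm (1 - \<mu> * cis t)) * cos (real k * t)) has_integral
    (if k = 0 then 0 else - pi * Re (\<mu> ^ k) / real k)) {0..2 * pi}"
proof -
  \<comment> \<open>The term n = 0 vanishes because 1 / 0 = 0.\<close>
  define a where "a = (\<lambda>n t. Re (- (1 / of_nat n) * (\<mu> * cis t) ^ n) * cos (real k * t))"
  have sums: "(\<lambda>n. a n t) sums (ln (norm (1 - \<mu> * cis t)) * cos (real k * t))" for t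
  proof -
    have lt: "norm (- (\<mu> * cis t)) < 1" using \<mu> by (simp add: norm_mult)
    have "(\<lambda>n. (-1) ^ Suc n / of_nat n * (- (\<mu> * cis t)) ^ n) sums ln (1 + - (\<mu> * cis t))"
      by (rule Ln_series[OF lt])
    moreover have "(-1) ^ Suc n / of_nat n * (- (\<mu> * cis t)) ^ n = - (1 / of_nat n) * (\<mu> * cis t) ^ n" for n
      by (subst power_minus) (simp add: power_mult_distrib[symmetric])
    ultimately have "(\<lambda>n. - (1 / of_nat n) * (\<mu> * cis t) ^ n) sums ln (1 - \<mu> * cis t)"
      by (simp only: add_uminus_conv_diff)
    then have "(\<lambda>n. Re (- (1 / of_nat n) * (\<mu> * cis t) ^ n)) sums Re (ln (1 - \<mu> * cis t))"
      by (rule sums_Re)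
    moreover have "1 - \<mu> * cis t \<noteq> 0"
      using lt by auto
    ultimately show ?thesis
      unfolding a_def by (intro sums_mult2) simp
  qed
  have unif: "uniform_limit {0..2 * pi} (\<lambda>N t. \<Sum>n<N. a n t)
      (\<lambda>t. ln (norm (1 - \<mu> * cis t)) * cos (real k * t)) sequentially"
  proof -
    have "uniform_limit {0..2 * pi} (\<lambda>N t. \<Sum>n<N. a n t) (\<lambda>t. suminf (\<lambda>n. a n t)) sequentially"
    proof (rule Weierstrass_m_test)
      show "summable (\<lambda>n. norm \<mu> ^ n)"
        using \<mu> by (simp add: summable_geometric)
      fix n and t :: real assume "t \<in> {0..2 * pi}"
      have "norm (a n t) \<le> norm (- (1 / of_nat n) * (\<mu> * cis t) ^ n) * 1"
        unfolding a_def real_norm_def abs_mult by (intro mult_mono abs_Re_le_cmod) auto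
      also have "\<dots> = 1 / real n * norm \<mu> ^ n"
        by (simp add: norm_mult norm_power norm_divide)
      also have "\<dots> \<le> 1 * norm \<mu> ^ n"
        by (intro mult_right_mono) (auto simp: divide_le_eq)
      finally show "norm (a n t) \<le> norm \<mu> ^ n" by simp
    qed
    then show ?thesis
      using sums by (simp add: sums_iff)
  qed
  have int: "((\<lambda>t. \<Sum>n<N. a n t) has_integral
      (\<Sum>n<N. if n \<noteq> 0 \<and> n = k then - pi * Re (\<mu> ^ k) / real k else 0)) {0..2 * pi}" for N
  proof (intro has_integral_sum finite_lessThan)
    fix n
    show "(a n has_integral (if n \<noteq> 0 \<and> n = k then - pi * Re (\<mu> ^ k) / real k else 0)) {0..2 * pi}"
    proof (cases "n = 0")
      case True
      then show ?thesis by (simp add: a_def)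
    next
      case False
      have "Re (- (1 / of_nat n) * \<mu> ^ n) = - Re (\<mu> ^ n) / real n"
        by (simp add: Re_divide_of_nat)
      then show ?thesis
        using has_integral_Re_power_cis_cos[of n "- (1 / of_nat n)" \<mu> k] False
        unfolding a_def by (auto simp del: times_divide_eq_left)
    qed
  qed
  obtain I J where IJ: "\<And>N. ((\<lambda>t. \<Sum>n<N. a n t) has_integral I N) {0..2 * pi}"
      "((\<lambda>t. ln (norm (1 - \<mu> * cis t)) * cos (real k * t)) has_integral J) {0..2 * pi}"
      "(I \<longlongrightarrow> J) sequentially"
  proof (rule uniform_limit_integral[OF unif])
    show "continuous_on {0..2 * pi} (\<lambda>t. \<Sum>n<N. a n t)" for N
      unfolding a_def by (intro continuous_intros)
  qed auto
  have "I = (\<lambda>N. \<Sum>n<N. if n \<noteq> 0 \<and> n = k then - pi * Re (\<mu> ^ k) / real k else 0)"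
    using IJ(1) int by (auto intro: has_integral_unique)
  moreover have "(\<lambda>n. if n \<noteq> 0 \<and> n = k then - pi * Re (\<mu> ^ k) / real k else 0) sums
      (if k = 0 then 0 else - pi * Re (\<mu> ^ k) / real k)"
  proof -
    have "(\<lambda>n. if n = k then (if k = 0 then 0 else - pi * Re (\<mu> ^ k) / real k) else 0) sums
        (if k = 0 then 0 else - pi * Re (\<mu> ^ k) / real k)"
      by (rule sums_single)
    moreover have "(\<lambda>n. if n = k then (if k = 0 then 0 else - pi * Re (\<mu> ^ k) / real k) else 0) =
        (\<lambda>n. if n \<noteq> 0 \<and> n = k then - pi * Re (\<mu> ^ k) / real k else 0)"
      by auto
    ultimately show ?thesis by simp
  qed
  ultimately have "J = (if k = 0 then 0 else - pi * Re (\<mu> ^ k) / real k)"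
    using IJ(3) by (simp add: sums_def LIMSEQ_unique)
  then show ?thesis using IJ(2) by simp
qed

text \<open>The \<open>k\<close>-th cosine coefficient of \<open>\<theta> \<mapsto> ln \<bar>1 - \<mu> r e\<^sup>i\<^sup>\<theta>\<bar>\<close>; the case
  \<open>r * norm \<mu> > 1\<close> is only meant for \<open>\<mu> > 0\<close>.\<close>

definition log_coeff :: "nat \<Rightarrow> complex \<Rightarrow> real \<Rightarrow> real" where
  "log_coeff k \<mu> r =
     (if k = 0 then (if r * norm \<mu> \<le> 1 then 0 else ln (r * norm \<mu>))
      else if r * norm \<mu> \<le> 1 then - Re (\<mu> ^ k) * r ^ k / (2 * real k)
      else - 1 / (2 * real k * (r * norm \<mu>) ^ k))"

text \<open>Outside, |1 - q e^(it)| = q |1 - e^(it) / q| with q = r * norm mu > 1 reduces to the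
  case inside; the term ln q only affects k = 0. The circle through the singularity is
  excluded.\<close>

lemma has_integral_log_coeff:
  assumes r: "0 \<le> r" and \<mu>: "r * norm \<mu> < 1 \<or> (\<mu> = of_real (norm \<mu>) \<and> r * norm \<mu> > 1)"
  shows "((\<lambda>t. ln (norm (1 - \<mu> * of_real r * cis t)) * cos (real k * t)) has_integral
    (2 * pi * log_coeff k \<mu> r)) {0..2 * pi}"
proof (cases "r * norm \<mu> < 1")
  case True
  then have *: "norm (\<mu> * of_real r) < 1"
    using r by (simp add: norm_mult mult.commute)
  have eq: "(if k = 0 then 0 else - pi * Re ((\<mu> * of_real r) ^ k) / real k) = 2 * pi * log_coeff k \<mu> r"
    using True by (auto simp: log_coeff_def power_mult_distrib simp flip: of_real_power)
  show ?thesis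
    using has_integral_ln_norm_one_minus_cos[OF *, of k] unfolding eq .
next
  case False
  define q where "q = r * norm \<mu>"
  have q: "q > 1" and \<mu>q: "\<mu> * of_real r = of_real q"
  proof -
    show "q > 1" using \<mu> False by (auto simp: q_def)
    have "\<mu> = of_real (norm \<mu>)" using \<mu> False by auto
    then have "\<mu> * of_real r = of_real (norm \<mu>) * of_real r" by metis
    then show "\<mu> * of_real r = of_real q" by (simp add: q_def mult.commute)
  qed
  have eq: "ln (norm (1 - of_real q * cis t)) = ln q + ln (norm (1 - of_real (1 / q) * cis t))" for t
  proof -
    have "norm (1 - of_real q * cis t) = norm (cis t) * norm (cis (- t) - of_real q)"
      unfolding norm_mult[symmetric] by (simp add: algebra_simps cis_mult)
    also have "\<dots> = norm (cnj (cis (- t) - of_real q))"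
      unfolding complex_mod_cnj by simp
    also have "cnj (cis (- t) - of_real q) = - of_real q * (1 - of_real (1 / q) * cis t)"
      using q by (simp add: cis_cnj algebra_simps)
    also have "norm \<dots> = q * norm (1 - of_real (1 / q) * cis t)"
      using q by (simp add: norm_mult)
    finally have *: "norm (1 - of_real q * cis t) = q * norm (1 - of_real (1 / q) * cis t)" .
    have "of_real (1 / q) * cis t \<noteq> 1"
    proof
      assume "of_real (1 / q) * cis t = 1"
      then have "norm (of_real (1 / q) * cis t) = 1" by simp
      then show False using q by (simp add: norm_mult norm_divide)
    qed
    then show ?thesis
      unfolding * using q by (subst ln_mult) auto
  qed
  have 1: "((\<lambda>t. ln q * cos (real k * t)) has_integral (if k = 0 then 2 * pi * ln q else 0)) {0..2 * pi}"
  proof (cases "k = 0")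
    case True
    then show ?thesis using has_integral_const_real[of "ln q" 0 "2 * pi"] by simp
  next
    case False
    have "((\<lambda>t. Re (cis (of_int (int k) * t))) has_integral Re 0) {0..2 * pi}"
      using has_integral_Re[OF has_integral_cis_multiple[of "int k"]] False by simp
    then have "((\<lambda>t. cos (real k * t)) has_integral 0) {0..2 * pi}" by simp
    from has_integral_mult_right[OF this, of "ln q"] show ?thesis using False by simp
  qed
  have "norm (of_real (1 / q) :: complex) < 1"
    using q by (simp add: norm_divide)
  from has_integral_add[OF 1 has_integral_ln_norm_one_minus_cos[OF this, of k]]
  have "((\<lambda>t. ln (norm (1 - of_real q * cis t)) * cos (real k * t)) has_integral
      ((if k = 0 then 2 * pi * ln q else 0) +
       (if k = 0 then 0 else - pi * Re (of_real (1 / q) ^ k) / real k))) {0..2 * pi}"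
    unfolding eq by (simp add: algebra_simps)
  moreover have "((if k = 0 then 2 * pi * ln q else 0) +
       (if k = 0 then 0 else - pi * Re (of_real (1 / q) ^ k) / real k)) = 2 * pi * log_coeff k \<mu> r"
  proof -
    have "Re (of_real (1 / q) ^ k) = 1 / q ^ k"
      by (simp add: power_one_over flip: of_real_power)
    then show ?thesis
      using q by (simp add: log_coeff_def flip: q_def)
  qed
  ultimately show ?thesis
    unfolding \<mu>q by simp
qed

section \<open>Fejer weights and the radial kernel\<close>

lemma fejer_kernel_nonneg:
  fixes t :: real
  shows "0 \<le> 1 + (\<Sum>k=1..<d. 2 * (1 - real k / real d) * cos (real k * t))"
proof (cases "d = 0")
  case False
  \<comment> \<open>Adding the exponential of index d to the sum adds every frequency k from 1 to d
    once more to the squared modulus, which is exactly the increase of the coefficients.\<close>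
  have *: "real d + (\<Sum>k=1..<d. 2 * (real d - real k) * cos (real k * t)) = (norm (\<Sum>j<d. cis (real j * t)))\<^sup>2" for d
  proof (induction d)
    case (Suc d)
    have "(norm (\<Sum>j<Suc d. cis (real j * t)))\<^sup>2 =
        (norm (\<Sum>j<d. cis (real j * t)))\<^sup>2 + 1 + 2 * ((\<Sum>j<d. cis (real j * t)) \<bullet> cis (real d * t))"
      by (simp add: power2_norm_eq_inner inner_add_left inner_add_right inner_commute)
        (simp add: inner_complex_def flip: power2_eq_square)
    also have "(\<Sum>j<d. cis (real j * t)) \<bullet> cis (real d * t) = (\<Sum>j<d. cos (real (d - j) * t))"
      unfolding inner_sum_left
      by (intro sum.cong refl) (simp add: inner_complex_def of_nat_diff left_diff_distrib cos_diff)
    also have "\<dots> = (\<Sum>k=1..<Suc d. cos (real k * t))"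
      by (rule sum.reindex_bij_witness[of _ "\<lambda>k. d - k" "\<lambda>j. d - j"]) auto
    finally have "(norm (\<Sum>j<Suc d. cis (real j * t)))\<^sup>2 =
        real d + (\<Sum>k=1..<d. 2 * (real d - real k) * cos (real k * t)) + 1 +
          2 * (\<Sum>k=1..<Suc d. cos (real k * t))"
      by (simp only: Suc.IH)
    moreover have "(\<Sum>k=1..<Suc d. 2 * (real (Suc d) - real k) * cos (real k * t)) =
        (\<Sum>k=1..<Suc d. 2 * (real d - real k) * cos (real k * t)) + 2 * (\<Sum>k=1..<Suc d. cos (real k * t))"
      unfolding sum_distrib_left sum.distrib[symmetric] by (intro sum.cong refl) (simp add: algebra_simps)
    moreover have "(\<Sum>k=1..<Suc d. 2 * (real d - real k) * cos (real k * t)) =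
        (\<Sum>k=1..<d. 2 * (real d - real k) * cos (real k * t))"
      by (cases "d = 0") auto
    ultimately show ?case by simp
  qed simp
  have "1 + (\<Sum>k=1..<d. 2 * (1 - real k / real d) * cos (real k * t)) =
      (real d + (\<Sum>k=1..<d. 2 * (real d - real k) * cos (real k * t))) / real d"
    using False by (simp add: add_divide_distrib sum_divide_distrib field_simps)
  then show ?thesis unfolding * by simp
qed simp

text \<open>The quantity is f(0) for the Fejer weights. As d grows it tends to -1/s^2 + sum of 2 /
  (k^2 - s^2) = -(pi/s) cot(pi s), positive for 1/2 < s < 1. The proof compares with the borderline
  s = 1/2, where the series telescopes to 4 = 1/s^2.\<close>

lemma fejer_weight_pos:
  fixes s :: real
  assumes s: "1 / 2 < s" "s < 1"
  obtains d where "0 < - 1 / s\<^sup>2 + (\<Sum>k=1..<d. 2 * (1 - real k / real d) / ((real k)\<^sup>2 - s\<^sup>2))"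
proof -
  have tele: "(\<Sum>k=1..m. 2 / ((real k)\<^sup>2 - (1/2)\<^sup>2)) = 4 - 2 / (real m + 1 / 2)" for m
  proof (induction m)
    case (Suc m)
    have "real (Suc m) ^ 2 - (1/2)\<^sup>2 = (real m + 1/2) * (real m + 3/2)"
      by (simp add: power2_eq_square algebra_simps)
    then have "2 / (real (Suc m) ^ 2 - (1/2)\<^sup>2) = 2 / (real m + 1/2) - 2 / (real (Suc m) + 1/2)"
      by (simp add: field_simps)
    then show ?case using Suc by simp
  qed simp
  have pos: "(real k)\<^sup>2 - s\<^sup>2 > 0" if "k \<ge> 1" for k
  proof -
    have "s\<^sup>2 < 1\<^sup>2" using s by (intro power_strict_mono) auto
    moreover have "1\<^sup>2 \<le> (real k)\<^sup>2" using that by (intro power_mono) auto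
    ultimately show ?thesis by simp
  qed
  have s2: "(1/2)\<^sup>2 < s\<^sup>2" using s by (intro power_strict_mono) auto
  have "(\<lambda>m. 4 - 2 / (real m + 1 / 2)) \<longlonglongrightarrow> 4" by real_asymp
  moreover have "1 / s\<^sup>2 < 4"
    using s2 by (simp add: field_simps power2_eq_square)
  ultimately have "eventually (\<lambda>m. 1 / s\<^sup>2 < 4 - 2 / (real m + 1 / 2)) sequentially"
    by (rule order_tendstoD)
  then obtain m where m: "1 / s\<^sup>2 < 4 - 2 / (real m + 1 / 2)"
    by (auto simp: eventually_sequentially)
  have "4 - 2 / (real m + 1 / 2) \<le> (\<Sum>k=1..m. 2 / ((real k)\<^sup>2 - s\<^sup>2))"
    unfolding tele[symmetric]
  proof (rule sum_mono)
    fix k assume "k \<in> {1..m}"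
    then show "2 / ((real k)\<^sup>2 - (1 / 2)\<^sup>2) \<le> 2 / ((real k)\<^sup>2 - s\<^sup>2)"
      using s2 pos[of k] by (intro divide_left_mono mult_pos_pos) auto
  qed
  then have m': "1 / s\<^sup>2 < (\<Sum>k=1..m. 2 / ((real k)\<^sup>2 - s\<^sup>2))" using m by simp
  \<comment> \<open>Finitely many terms already exceed 1 / s^2, and on these the Fejer weights tend
    to 2 as d grows; the remaining terms are non-negative.\<close>
  have "(\<lambda>d. (\<Sum>k=1..m. 2 * (1 - real k / real d) / ((real k)\<^sup>2 - s\<^sup>2))) \<longlonglongrightarrow> (\<Sum>k=1..m. 2 * (1 - 0) / ((real k)\<^sup>2 - s\<^sup>2))"
  proof (intro tendsto_sum tendsto_divide tendsto_mult tendsto_const)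
    fix k assume "k \<in> {1..m}"
    then show "(real k)\<^sup>2 - s\<^sup>2 \<noteq> 0" using pos[of k] by auto
    show "(\<lambda>d. 1 - real k / real d) \<longlonglongrightarrow> 1 - 0" by real_asymp
  qed
  then have "eventually (\<lambda>d. 1 / s\<^sup>2 < (\<Sum>k=1..m. 2 * (1 - real k / real d) / ((real k)\<^sup>2 - s\<^sup>2))) sequentially"
    using m' by (intro order_tendstoD) auto
  then have "eventually (\<lambda>d. d > m \<and> 1 / s\<^sup>2 < (\<Sum>k=1..m. 2 * (1 - real k / real d) / ((real k)\<^sup>2 - s\<^sup>2))) sequentially"
    using eventually_gt_at_top eventually_conj by blast
  then obtain d where d: "d > m" "1 / s\<^sup>2 < (\<Sum>k=1..m. 2 * (1 - real k / real d) / ((real k)\<^sup>2 - s\<^sup>2))"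
    by (auto simp: eventually_sequentially)
  have "(\<Sum>k=1..m. 2 * (1 - real k / real d) / ((real k)\<^sup>2 - s\<^sup>2)) \<le>
      (\<Sum>k=1..<d. 2 * (1 - real k / real d) / ((real k)\<^sup>2 - s\<^sup>2))"
  proof (rule sum_mono2)
    fix k assume "k \<in> {1..<d} - {1..m}"
    then have "k \<ge> 1" "real k / real d \<le> 1" by auto
    then show "0 \<le> 2 * (1 - real k / real d) / ((real k)\<^sup>2 - s\<^sup>2)"
      using pos[of k] by simp
  qed (use d in auto)
  then show ?thesis using d by (intro that[of d]) simp
qed

text \<open>A solution of (r d/dr)^2 phi = s^2 phi, of order r^-s at 0 and vanishing at r =
  R.\<close>

definition radial_kernel :: "real \<Rightarrow> real \<Rightarrow> real \<Rightarrow> real" where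
  "radial_kernel s R r = r powr (- s) - r powr s * R powr (- 2 * s)"

lemma radial_kernel_nonneg:
  assumes "0 < s" "0 \<le> r" "r \<le> R"
  shows "0 \<le> radial_kernel s R r"
proof (cases "r = 0")
  case False
  then have "r powr s * R powr (- 2 * s) \<le> r powr s * r powr (- 2 * s)"
    using assms by (intro mult_left_mono powr_mono2') auto
  also have "\<dots> = r powr (- s)"
    by (simp flip: powr_add)
  finally show ?thesis by (simp add: radial_kernel_def)
qed (use assms in \<open>simp add: radial_kernel_def\<close>)

lemma radial_kernel_le: "radial_kernel s R r \<le> r powr (- s)"
  by (simp add: radial_kernel_def)

lemma has_integral_power_radial_kernel:
  assumes s: "0 < s" "s < 1" and k: "k \<ge> 1" and b: "0 < b"
  shows "((\<lambda>r. r ^ k * radial_kernel s R r / r) has_integral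
     (b ^ k * ((real k + s) * b powr (- s) - (real k - s) * (b powr s * R powr (- 2 * s)))) / ((real k)\<^sup>2 - s\<^sup>2)) {0..b}"
proof -
  have ks: "real k - s > 0" "real k + s > 0" using s k by auto
  have "((\<lambda>r. r powr (real k - s - 1) - R powr (- 2 * s) * r powr (real k + s - 1)) has_integral
      (b powr (real k - s - 1 + 1) / (real k - s - 1 + 1) -
       R powr (- 2 * s) * (b powr (real k + s - 1 + 1) / (real k + s - 1 + 1)))) {0..b}"
    using ks b by (intro has_integral_diff has_integral_mult_right has_integral_powr_from_0) auto
  also have "(b powr (real k - s - 1 + 1) / (real k - s - 1 + 1) -
       R powr (- 2 * s) * (b powr (real k + s - 1 + 1) / (real k + s - 1 + 1))) =
      (b ^ k * ((real k + s) * b powr (- s) - (real k - s) * (b powr s * R powr (- 2 * s)))) / ((real k)\<^sup>2 - s\<^sup>2)"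
  proof -
    have "b powr (real k - s) = b ^ k * b powr (- s)" "b powr (real k + s) = b ^ k * b powr s"
      using b by (simp_all add: powr_diff powr_add powr_minus powr_realpow divide_inverse)
    moreover have "(real k)\<^sup>2 - s\<^sup>2 = (real k - s) * (real k + s)"
      by (simp add: power2_eq_square algebra_simps)
    ultimately show ?thesis
      using ks by (simp add: field_simps)
  qed
  finally have *: "((\<lambda>r. r powr (real k - s - 1) - R powr (- 2 * s) * r powr (real k + s - 1)) has_integral
    (b ^ k * ((real k + s) * b powr (- s) - (real k - s) * (b powr s * R powr (- 2 * s)))) / ((real k)\<^sup>2 - s\<^sup>2)) {0..b}" .
  show ?thesis
  proof (rule has_integral_eq[OF _ *])
    fix r assume "r \<in> {0..b}"
    show "r powr (real k - s - 1) - R powr (- 2 * s) * r powr (real k + s - 1) = r ^ k * radial_kernel s R r / r"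
    proof (cases "r = 0")
      case False
      then have r: "r > 0" using \<open>r \<in> {0..b}\<close> by auto
      have "r powr (real k - s - 1) = r ^ k * r powr (- s) / r"
           "r powr (real k + s - 1) = r ^ k * r powr s / r"
        using r by (simp_all add: powr_diff powr_add powr_minus powr_realpow divide_inverse)
      then show ?thesis
        using r by (simp add: radial_kernel_def field_simps)
    qed simp
  qed
qed

text \<open>\<open>j1\<close> stands for r j'. Both j and the kernel solve Euler equations, with
  constants c^2 and s^2, so their Wronskian divided by c^2 - s^2 is an antiderivative with respect
  to dr / r. At R the kernel is zero and \<open>j1 R\<close> drops out.\<close>

lemma has_integral_euler_radial_kernel:
  fixes j j1 :: "real \<Rightarrow> real"
  assumes a: "0 < a" "a \<le> R" and c: "c\<^sup>2 \<noteq> s\<^sup>2"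
    and j: "\<And>r. a \<le> r \<Longrightarrow> (j has_real_derivative j1 r / r) (at r)"
    and j1: "\<And>r. a \<le> r \<Longrightarrow> (j1 has_real_derivative c\<^sup>2 * j r / r) (at r)"
  shows "((\<lambda>r. j r * radial_kernel s R r / r) has_integral
      (2 * s * R powr (- s) * j R - j1 a * radial_kernel s R a
        - s * j a * (a powr (- s) + a powr s * R powr (- 2 * s))) / (c\<^sup>2 - s\<^sup>2)) {a..R}"
proof -
  \<comment> \<open>r times the derivative of the kernel.\<close>
  define \<phi>1 where "\<phi>1 = (\<lambda>r. - s * (r powr (- s) + r powr s * R powr (- 2 * s)))"
  define H where "H = (\<lambda>r. (j1 r * radial_kernel s R r - j r * \<phi>1 r) / (c\<^sup>2 - s\<^sup>2))"
  have pw: "((\<lambda>r. r powr e) has_real_derivative e * r powr e / r) (at r)" if "r > 0" for e r :: real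
    using that by (auto intro!: derivative_eq_intros simp: powr_diff)
  have \<phi>: "(radial_kernel s R has_real_derivative \<phi>1 r / r) (at r)" if "r > 0" for r
    unfolding radial_kernel_def[abs_def] \<phi>1_def using that
    by (intro DERIV_cong[OF DERIV_diff[OF pw[of r "- s"] DERIV_cmult_right[OF pw[of r s]]]])
      (simp_all add: field_simps)
  have \<phi>1: "(\<phi>1 has_real_derivative s\<^sup>2 * radial_kernel s R r / r) (at r)" if "r > 0" for r
    unfolding radial_kernel_def \<phi>1_def using that
    by (intro DERIV_cong[OF DERIV_cmult[OF DERIV_add[OF pw[of r "- s"] DERIV_cmult_right[OF pw[of r s]]]]])
      (simp_all add: field_simps power2_eq_square)
  have "((\<lambda>r. j r * radial_kernel s R r / r) has_integral (H R - H a)) {a..R}"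
  proof (rule fundamental_theorem_of_calculus[OF a(2)])
    fix r assume "r \<in> {a..R}"
    then have r: "r > 0" "a \<le> r" using a by auto
    have "(H has_real_derivative ((c\<^sup>2 * j r / r * radial_kernel s R r + \<phi>1 r / r * j1 r) -
       (j1 r / r * \<phi>1 r + s\<^sup>2 * radial_kernel s R r / r * j r)) / (c\<^sup>2 - s\<^sup>2)) (at r)"
      unfolding H_def
      by (intro DERIV_cdivide DERIV_diff DERIV_mult' DERIV_mult j j1 \<phi> \<phi>1 r)
    also have "(c\<^sup>2 * j r / r * radial_kernel s R r + \<phi>1 r / r * j1 r) -
       (j1 r / r * \<phi>1 r + s\<^sup>2 * radial_kernel s R r / r * j r) =
       (c\<^sup>2 - s\<^sup>2) * (j r * radial_kernel s R r / r)"
      by (simp add: algebra_simps diff_divide_distrib)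
    also have "\<dots> / (c\<^sup>2 - s\<^sup>2) = j r * radial_kernel s R r / r"
      by (rule nonzero_mult_div_cancel_left) (use c in simp)
    finally show "(H has_vector_derivative j r * radial_kernel s R r / r) (at r within {a..R})"
      by (simp add: has_real_derivative_iff_has_vector_derivative has_vector_derivative_at_within)
  qed
  moreover have "H R - H a = (2 * s * R powr (- s) * j R - j1 a * radial_kernel s R a
        - s * j a * (a powr (- s) + a powr s * R powr (- 2 * s))) / (c\<^sup>2 - s\<^sup>2)"
  proof -
    have RR: "R powr s * R powr (- 2 * s) = R powr (- s)"
      using a by (simp flip: powr_add)
    have 1: "j1 R * radial_kernel s R R - j R * \<phi>1 R = 2 * s * R powr (- s) * j R"
      unfolding radial_kernel_def \<phi>1_def RR by (simp add: algebra_simps)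
    have 2: "j1 a * radial_kernel s R a - j a * \<phi>1 a =
        j1 a * radial_kernel s R a + s * j a * (a powr (- s) + a powr s * R powr (- 2 * s))"
      unfolding \<phi>1_def by (simp add: algebra_simps)
    show ?thesis
      unfolding H_def 1 2 by (simp add: diff_divide_distrib add_divide_distrib)
  qed
  ultimately show ?thesis by simp
qed

text \<open>One-dimensional Green's formula. As a function of r, \<open>log_coeff\<close> solves the
  Euler equation with constant k^2 on both sides of 1 / norm mu, and r times its derivative jumps
  there by 1: from -1/2 to 1/2 for k > 0, from 0 to 1 for k = 0. The jump produces the kernel value
  at 1 / norm mu.\<close>

lemma has_integral_log_coeff_radial:
  assumes s: "0 < s" "s < 1" and R: "0 < R"
    and \<mu>: "R * norm \<mu> \<le> 1 \<or> \<mu> = of_real (norm \<mu>)"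
  shows "((\<lambda>r. log_coeff k \<mu> r * radial_kernel s R r / r) has_integral
     (2 * s * R powr (- s) * log_coeff k \<mu> R -
       (if R * norm \<mu> \<le> 1 then 0 else radial_kernel s R (1 / norm \<mu>))) / ((real k)\<^sup>2 - s\<^sup>2)) {0..R}"
proof -
  have ks: "(real k)\<^sup>2 \<noteq> s\<^sup>2"
  proof
    assume "(real k)\<^sup>2 = s\<^sup>2"
    then have "real k = s" using s by (simp add: power2_eq_iff_nonneg)
    then show False using s by (cases k) auto
  qed
  have inner: "((\<lambda>r. log_coeff k \<mu> r * radial_kernel s R r / r) has_integral
      (if k = 0 then 0 else - Re (\<mu> ^ k) / (2 * real k) *
      ((b ^ k * ((real k + s) * b powr (- s) - (real k - s) * (b powr s * R powr (- 2 * s)))) / ((real k)\<^sup>2 - s\<^sup>2)))) {0..b}"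
    if b: "0 < b" "b * norm \<mu> \<le> 1" for b
  proof -
    have le: "r * norm \<mu> \<le> 1" if "r \<in> {0..b}" for r
      using that b(2) by (auto intro: order_trans[OF mult_right_mono])
    show ?thesis
    proof (cases "k = 0")
      case True
      show ?thesis
        by (rule has_integral_eq[of _ "\<lambda>_. 0"]) (use True le in \<open>auto simp: log_coeff_def\<close>)
    next
      case False
      show ?thesis
      proof (rule has_integral_eq)
        show "((\<lambda>r. - Re (\<mu> ^ k) / (2 * real k) * (r ^ k * radial_kernel s R r / r)) has_integral
          (if k = 0 then 0 else - Re (\<mu> ^ k) / (2 * real k) *
          ((b ^ k * ((real k + s) * b powr (- s) - (real k - s) * (b powr s * R powr (- 2 * s)))) / ((real k)\<^sup>2 - s\<^sup>2)))) {0..b}"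
          unfolding if_not_P[OF False]
          by (intro has_integral_mult_right has_integral_power_radial_kernel s b) (use False in simp)
      qed (use False le in \<open>simp add: log_coeff_def\<close>)
    qed
  qed
  show ?thesis
  proof (cases "R * norm \<mu> \<le> 1")
    case True
    have "R powr s * R powr (- 2 * s) = R powr (- s)"
      using R by (simp flip: powr_add)
    then have X: "R ^ k * ((real k + s) * R powr (- s) - (real k - s) * (R powr s * R powr (- 2 * s))) =
        2 * s * R powr (- s) * R ^ k"
      by (simp add: algebra_simps)
    have "(if k = 0 then 0 else - Re (\<mu> ^ k) / (2 * real k) *
      ((R ^ k * ((real k + s) * R powr (- s) - (real k - s) * (R powr s * R powr (- 2 * s)))) / ((real k)\<^sup>2 - s\<^sup>2))) =
      (2 * s * R powr (- s) * log_coeff k \<mu> R) / ((real k)\<^sup>2 - s\<^sup>2)"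
      using True unfolding X by (simp add: log_coeff_def)
    then show ?thesis
      using inner[OF R True] True by simp
  next
    case False
    define q where "q = norm \<mu>"
    have "q \<noteq> 0" "R * q > 1" using False by (auto simp: q_def)
    moreover have "q \<ge> 0" by (simp add: q_def)
    ultimately have q: "q > 0" "R * q > 1" by auto
    have \<mu>q: "\<mu> = of_real q" using \<mu> False by (auto simp: q_def)
    define b where "b = 1 / q"
    have b: "0 < b" "b \<le> R" "b * q = 1" using q by (auto simp: b_def field_simps)
    \<comment> \<open>At r * q = 1 both branches of \<open>log_coeff\<close> coincide, so the outer
      formula holds on the closed interval from b on.\<close>
    have ge: "log_coeff k \<mu> r = (if k = 0 then ln (r * q) else - 1 / (2 * real k * (r * q) ^ k))" if "b \<le> r" for r
    proof -
      have "r * q \<ge> 1" using that q by (simp add: b_def field_simps)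
      then show ?thesis
        by (cases "r * q = 1")
          (auto simp: log_coeff_def \<mu>q power_mult_distrib[symmetric] mult.commute q less_imp_le simp flip: of_real_power)
    qed
    define j where "j = (\<lambda>r. if k = 0 then ln (r * q) else - 1 / (2 * real k * (r * q) ^ k))"
    define j1 where "j1 = (\<lambda>r. if k = 0 then 1 else 1 / (2 * (r * q) ^ k))"
    have dpow: "((\<lambda>r. 1 / (r * q) ^ k) has_real_derivative - real k * (1 / (r * q) ^ k) / r) (at r)"
      if "r > 0" for r
    proof -
      have "((\<lambda>r. (r * q) ^ k) has_real_derivative real k * (r * q) ^ k / r) (at r)"
      proof (cases k)
        case (Suc m)
        have "((\<lambda>r. r * q) has_real_derivative q) (at r)"
          by (auto intro!: derivative_eq_intros)
        from DERIV_power_Suc[OF this, of m] show ?thesis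
          unfolding Suc by (rule DERIV_cong) (use that in \<open>simp add: field_simps\<close>)
      qed simp
      moreover have "(r * q) ^ k \<noteq> 0" using that q by simp
      ultimately have "((\<lambda>r. inverse ((r * q) ^ k)) has_real_derivative
          - (real k * (r * q) ^ k / r * inverse (((r * q) ^ k) ^ Suc (Suc 0)))) (at r)"
        by (rule DERIV_inverse_fun)
      also have "- (real k * F / r * inverse (F ^ Suc (Suc 0))) = - real k * (1 / F) / r" if "F \<noteq> 0" for F
        using that by (simp add: field_simps)
      finally show ?thesis
        using \<open>(r * q) ^ k \<noteq> 0\<close> by (simp add: inverse_eq_divide)
    qed
    have dj: "(j has_real_derivative j1 r / r) (at r)" if "r > 0" for r
    proof (cases "k = 0")
      case True
      then show ?thesis using that q unfolding j_def j1_def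
        by (auto intro!: derivative_eq_intros)
    next
      case False
      then show ?thesis
        using DERIV_cmult[OF dpow[OF that], of "- 1 / (2 * real k)"] by (simp add: j_def j1_def mult.assoc)
    qed
    have dj1: "(j1 has_real_derivative (real k)\<^sup>2 * j r / r) (at r)" if "r > 0" for r
    proof (cases "k = 0")
      case True
      then show ?thesis unfolding j1_def by simp
    next
      case False
      then show ?thesis
        using DERIV_cmult[OF dpow[OF that], of "1 / 2"] by (simp add: j_def j1_def power2_eq_square mult.assoc)
    qed
    have outer: "((\<lambda>r. j r * radial_kernel s R r / r) has_integral
      (2 * s * R powr (- s) * j R - j1 b * radial_kernel s R b
        - s * j b * (b powr (- s) + b powr s * R powr (- 2 * s))) / ((real k)\<^sup>2 - s\<^sup>2)) {b..R}"
      using b by (intro has_integral_euler_radial_kernel ks dj dj1) auto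
    then have outer': "((\<lambda>r. log_coeff k \<mu> r * radial_kernel s R r / r) has_integral
      (2 * s * R powr (- s) * j R - j1 b * radial_kernel s R b
        - s * j b * (b powr (- s) + b powr s * R powr (- 2 * s))) / ((real k)\<^sup>2 - s\<^sup>2)) {b..R}"
      by (rule has_integral_eq[rotated]) (auto simp: ge j_def)
    have jR: "j R = log_coeff k \<mu> R" using ge b by (simp add: j_def)
    have rk: "radial_kernel s R b = b powr (- s) - b powr s * R powr (- 2 * s)"
      by (simp add: radial_kernel_def)
    have "b * norm \<mu> \<le> 1" using b by (simp add: q_def)
    note inner' = inner[OF b(1) this]
    have "(if k = 0 then 0 else - Re (\<mu> ^ k) / (2 * real k) *
      ((b ^ k * ((real k + s) * b powr (- s) - (real k - s) * (b powr s * R powr (- 2 * s)))) / ((real k)\<^sup>2 - s\<^sup>2))) +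
      (2 * s * R powr (- s) * j R - j1 b * radial_kernel s R b
        - s * j b * (b powr (- s) + b powr s * R powr (- 2 * s))) / ((real k)\<^sup>2 - s\<^sup>2) =
      (2 * s * R powr (- s) * log_coeff k \<mu> R - radial_kernel s R b) / ((real k)\<^sup>2 - s\<^sup>2)"
    proof (cases "k = 0")
      case True
      then show ?thesis unfolding jR using b by (simp add: j1_def j_def)
    next
      case False
      have 1: "Re (\<mu> ^ k) * b ^ k = 1"
        using b by (simp add: \<mu>q mult.commute flip: of_real_power power_mult_distrib)
      have 2: "j b = - 1 / (2 * real k)" "j1 b = 1 / 2"
        using b False by (simp_all add: j_def j1_def)
      have 3: "- Re (\<mu> ^ k) / (2 * real k) * (b ^ k * X / Y) = - X / (2 * real k) / Y" for X Y
      proof -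
        have "- Re (\<mu> ^ k) / (2 * real k) * (b ^ k * X / Y) = - (Re (\<mu> ^ k) * b ^ k) * X / (2 * real k) / Y"
          by simp
        then show ?thesis unfolding 1 by simp
      qed
      \<comment> \<open>The boundary terms at b from the inner and the outer interval, with P - Q
        the kernel at b: all but the jump cancels.\<close>
      have 4: "- ((real k + s) * P - (real k - s) * Q) / (2 * real k) / D +
          (J - 1 / 2 * (P - Q) - s * (- 1 / (2 * real k)) * (P + Q)) / D = (J - (P - Q)) / D" for P Q J D
      proof -
        have "- ((real k + s) * P - (real k - s) * Q) / (2 * real k) +
          (J - 1 / 2 * (P - Q) - s * (- 1 / (2 * real k)) * (P + Q)) = J - (P - Q)"
          using False by (simp add: field_simps)
        then show ?thesis by (simp only: add_divide_distrib[symmetric])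
      qed
      show ?thesis
        unfolding 2 jR rk if_not_P[OF False] 3 4 ..
    qed
    then show ?thesis
      using has_integral_combine[OF less_imp_le[OF b(1)] b(2) inner' outer'] False
      by (simp add: b_def q_def)
  qed
qed

section \<open>Elementary estimates for the lower bound of u\<close>

lemma half_le_sin:
  fixes x :: real
  assumes "0 \<le> x" "x \<le> pi / 2"
  shows "x / 2 \<le> sin x"
proof (cases "x \<le> pi / 3")
  case True
  have "sin 0 - 0 / 2 \<le> sin x - x / 2"
  proof (rule DERIV_nonneg_imp_nondecreasing[OF assms(1), of "\<lambda>x. sin x - x / 2"])
    fix y assume y: "0 \<le> y" "y \<le> x"
    have "cos (pi / 3) \<le> cos y"
      using y True by (intro cos_monotone_0_pi_le) auto
    then have "0 \<le> cos y - 1 / 2" by (simp add: cos_60)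
    then show "\<exists>z. ((\<lambda>x. sin x - x / 2) has_real_derivative z) (at y) \<and> 0 \<le> z"
      by (intro exI[of _ "cos y - 1 / 2"]) (auto intro!: derivative_eq_intros)
  qed
  then show ?thesis by simp
next
  case False
  \<comment> \<open>Beyond pi/3 crude numbers decide: sin x >= sqrt 3 / 2 >= 4/5, while x / 2 <=
    pi/4 < 4/5.\<close>
  have "8 / 5 \<le> sqrt 3"
    by (rule real_le_rsqrt) (simp add: power2_eq_square)
  then have "4 / 5 \<le> sqrt 3 / 2" by simp
  also have "\<dots> = sin (pi / 3)" by (simp add: sin_60)
  also have "\<dots> \<le> sin x"
    using False assms by (intro sin_monotone_2pi_le) auto
  finally have "4 / 5 \<le> sin x" .
  moreover have "x / 2 \<le> 4 / 5"
    using assms pi_less_4 pi_approx by auto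
  ultimately show ?thesis by simp
qed

text \<open>The positive ray, which carries the points 1 / l i, is met at both ends of [0, 2 pi].
  The singularity of the lower bound of u there is dominated by two powers, integrable for p <
  1.\<close>

lemma sin_half_powr_le:
  fixes t :: real
  assumes p: "0 < p" and t: "0 < t" "t < 2 * pi"
  shows "sin (t / 2) powr (- p) \<le> 4 powr p * (t powr (- p) + (2 * pi - t) powr (- p))"
proof -
  have aux: "sin (t / 2) powr (- p) \<le> 4 powr p * x powr (- p)" if "x / 4 \<le> sin (t / 2)" "0 < x" for x
  proof -
    have "sin (t / 2) powr (- p) \<le> (x / 4) powr (- p)"
      using that p by (intro powr_mono2') auto
    also have "\<dots> = 4 powr p * x powr (- p)"
      using that by (simp add: powr_divide powr_minus field_simps)
    finally show ?thesis .
  qed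
  show ?thesis
  proof (cases "t \<le> pi")
    case True
    then have "t / 2 / 2 \<le> sin (t / 2)" using t by (intro half_le_sin) auto
    then have "sin (t / 2) powr (- p) \<le> 4 powr p * t powr (- p)" using t by (intro aux) auto
    also have "\<dots> \<le> 4 powr p * (t powr (- p) + (2 * pi - t) powr (- p))" by (intro mult_left_mono) auto
    finally show ?thesis .
  next
    case False
    then have "(pi - t / 2) / 2 \<le> sin (pi - t / 2)" using t by (intro half_le_sin) auto
    then have "sin (t / 2) powr (- p) \<le> 4 powr p * (2 * pi - t) powr (- p)" using t by (intro aux) auto
    also have "\<dots> \<le> 4 powr p * (t powr (- p) + (2 * pi - t) powr (- p))" by (intro mult_left_mono) auto
    finally show ?thesis .
  qed
qed

lemma integrable_powr_ends:
  assumes "p < 1"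
  shows "(\<lambda>t. t powr (- p) + (2 * pi - t) powr (- p)) integrable_on {0..2 * pi}"
proof (rule integrable_add)
  obtain i where i: "((\<lambda>t. t powr (- p)) has_integral i) {0..2 * pi}"
    using has_integral_powr_from_0[of "- p" "2 * pi"] assms by auto
  then show "(\<lambda>t. t powr (- p)) integrable_on {0..2 * pi}" by (auto simp: integrable_on_def)
  have "((\<lambda>t. (- 1 * t + 2 * pi) powr (- p)) has_integral (1 / \<bar>- 1 :: real\<bar> ^ DIM(real)) *\<^sub>R i)
      ((\<lambda>x. (1 / (- 1)) *\<^sub>R x + - ((1 / (- 1)) *\<^sub>R (2 * pi))) ` cbox 0 (2 * pi))"
    using has_integral_affinity[of "\<lambda>t. t powr (- p)" i 0 "2 * pi" "- 1" "2 * pi"] i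
    by (simp add: algebra_simps)
  moreover have "(\<lambda>x::real. (1 / (- 1)) *\<^sub>R x + - ((1 / (- 1)) *\<^sub>R (2 * pi))) ` cbox 0 (2 * pi) = {0..2 * pi}"
  proof -
    have "(\<lambda>x::real. (1 / (- 1)) *\<^sub>R x + - ((1 / (- 1)) *\<^sub>R (2 * pi))) = (\<lambda>x. 2 * pi - x)" by auto
    then show ?thesis by (simp add: image_diff_atLeastAtMost)
  qed
  ultimately show "(\<lambda>t. (2 * pi - t) powr (- p)) integrable_on {0..2 * pi}"
    by (auto simp: integrable_on_def algebra_simps)
qed

text \<open>Subadditivity (1 + x)^p <= 1 + x^p followed by the logarithm. It trades the linear
  growth in each factor 1 + y tau_k for y^p and a sum of tau_k^p.\<close>

lemma ln_one_plus_le_powr: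
  fixes x p :: real
  assumes "0 \<le> x" "0 < p" "p \<le> 1"
  shows "ln (1 + x) \<le> x powr p / p"
proof (cases "x = 0")
  case False
  have "(1 + x) powr p \<le> 1 + x powr p"
  proof -
    have "1 = 1 / (1 + x) + x / (1 + x)" using assms False by (simp add: field_simps)
    also have "\<dots> \<le> (1 / (1 + x)) powr p + (x / (1 + x)) powr p"
    proof (intro add_mono)
      have *: "y \<le> y powr p" if "0 < y" "y \<le> 1" for y :: real
        using powr_mono'[of p 1 y] that assms by simp
      show "1 / (1 + x) \<le> (1 / (1 + x)) powr p" "x / (1 + x) \<le> (x / (1 + x)) powr p"
        using assms False by (intro *; simp add: field_simps)+
    qed
    also have "\<dots> = (1 + x powr p) / (1 + x) powr p"
      using assms by (simp add: powr_divide add_divide_distrib)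
    finally show ?thesis using assms by (simp add: field_simps)
  qed
  moreover have "0 < 1 + x powr p" by (intro add_pos_nonneg) auto
  ultimately have "ln ((1 + x) powr p) \<le> ln (1 + x powr p)"
    using assms by (subst ln_le_cancel_iff) auto
  also have "\<dots> \<le> x powr p"
    by (rule ln_add_one_self_le_self) simp
  finally show ?thesis using assms by (simp add: ln_powr field_simps)
qed (use assms in simp)

text \<open>Green's formula in the disc of radius R, for u = -log |D| and the test function
  \<open>radial_kernel\<close> times f. The mean of u w over circles, integrated against the kernel,
  equals a boundary term minus f(0) times the kernel values at the points 1 / l i. The lower bounds
  on u control the integral (g1 on (0, 1], g2 on [1, R]) and the boundary term. The first factor on
  the left is f(0); the right-hand side depends on none of R, n, N.\<close>

lemma zeros_weighted_sum_le:
  fixes l :: "nat \<Rightarrow> real" and m :: "nat \<Rightarrow> complex" and w :: "nat \<Rightarrow> real" and n N :: nat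
  defines "u \<equiv> \<lambda>r t. (\<Sum>i<n. ln (norm (1 - of_real (l i) * of_real r * cis t))) -
    (\<Sum>j<N. ln (norm (1 - m j * of_real r * cis t)))"
  assumes s: "0 < s" "s < 1" and p: "s < p1" "p2 < s" and R: "1 \<le> R"
    and w: "\<And>k. k \<in> {1..<d} \<Longrightarrow> 0 \<le> w k"
    and W: "\<And>t. 0 \<le> 1 + (\<Sum>k=1..<d. w k * cos (real k * t))"
    and l: "\<And>i. i < n \<Longrightarrow> 0 \<le> l i" "\<And>i. i < n \<Longrightarrow> R * l i \<noteq> 1"
    and m: "\<And>j. j < N \<Longrightarrow> R * norm (m j) < 1"
    and g: "\<And>t. 0 \<le> g1 t" "\<And>t. 0 \<le> g2 t" "(g1 has_integral I1) {0..2 * pi}" "(g2 has_integral I2) {0..2 * pi}"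
    and u1: "\<And>r t. 0 < r \<Longrightarrow> r \<le> R \<Longrightarrow> 0 < t \<Longrightarrow> t < 2 * pi \<Longrightarrow> - (r powr p1 * g1 t) \<le> u r t"
    and u2: "\<And>r t. 0 < r \<Longrightarrow> r \<le> R \<Longrightarrow> 0 < t \<Longrightarrow> t < 2 * pi \<Longrightarrow> - (r powr p2 * g2 t) \<le> u r t"
  shows "(- 1 / s\<^sup>2 + (\<Sum>k=1..<d. w k / ((real k)\<^sup>2 - s\<^sup>2))) *
      (\<Sum>i<n. if R * l i \<le> 1 then 0 else radial_kernel s R (1 / l i) - 2 * s * R powr (- s) * ln (R * l i))
    \<le> (1 + (\<Sum>k=1..<d. w k)) * I1 / (2 * pi) / (p1 - s) + (1 + (\<Sum>k=1..<d. w k)) * I2 / (2 * pi) / (s - p2)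
      + 2 * s * ((\<Sum>k=1..<d. w k / ((real k)\<^sup>2 - s\<^sup>2)) * (2 * I2 / (2 * pi)))"
proof -
  define c where "c k r = (\<Sum>i<n. log_coeff k (of_real (l i)) r) - (\<Sum>j<N. log_coeff k (m j) r)" for k r
  \<comment> \<open>Cosine coefficients of the solution of f'' + s^2 f = -w, where w has constant
    term 1; its own constant term is -1/s^2.\<close>
  define f where "f k = w k / ((real k)\<^sup>2 - s\<^sup>2)" for k
  define Wm where "Wm = 1 + (\<Sum>k=1..<d. w k)"
  define Sing where "Sing = (\<lambda>i. 1 / l i) ` {..<n}"
  have fin: "finite Sing" by (simp add: Sing_def)
  have nl: "norm (complex_of_real (l i)) = l i" if "i < n" for i using l(1)[OF that] by simp
  have ge: "- (I2 * r / (2 * pi)) \<le> v / (2 * pi)"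
    if "((\<lambda>t. u0 t) has_integral v) {0..2 * pi}" "\<And>t. 0 < t \<Longrightarrow> t < 2 * pi \<Longrightarrow> - (r * g t) \<le> u0 t"
      "(g has_integral I2) {0..2 * pi}" for u0 v r g I2
  proof -
    have "((\<lambda>t. - (r * g t)) has_integral - (r * I2)) {0<..<2 * pi}"
      using that(3) by (intro has_integral_neg has_integral_mult_right) (simp add: has_integral_Icc_iff_Ioo)
    moreover have "(u0 has_integral v) {0<..<2 * pi}"
      using that(1) by (simp add: has_integral_Icc_iff_Ioo)
    ultimately have "- (r * I2) \<le> v"
      by (rule has_integral_le) (use that(2) in auto)
    then have "- (I2 * r) \<le> v" by (simp add: mult.commute)
    then have "- (I2 * r) / (2 * pi) \<le> v / (2 * pi)" by (intro divide_right_mono) auto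
    then show ?thesis by simp
  qed
  have coeff: "((\<lambda>t. u r t * cos (real k * t)) has_integral 2 * pi * c k r) {0..2 * pi}"
    if r: "0 < r" "r \<le> R" "r \<notin> Sing" for r k
  proof -
    have "((\<lambda>t. (\<Sum>i<n. ln (norm (1 - of_real (l i) * of_real r * cis t)) * cos (real k * t)) -
        (\<Sum>j<N. ln (norm (1 - m j * of_real r * cis t)) * cos (real k * t))) has_integral
        ((\<Sum>i<n. 2 * pi * log_coeff k (of_real (l i)) r) - (\<Sum>j<N. 2 * pi * log_coeff k (m j) r))) {0..2 * pi}"
    proof (intro has_integral_diff has_integral_sum finite_lessThan has_integral_log_coeff)
      fix i assume i: "i \<in> {..<n}"
      have "r * l i \<noteq> 1"
      proof
        assume *: "r * l i = 1"
        then have "l i \<noteq> 0" by auto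
        with * have "r = 1 / l i" by (simp add: eq_divide_eq)
        then show False using r i by (auto simp: Sing_def)
      qed
      then show "r * norm (complex_of_real (l i)) < 1 \<or> complex_of_real (l i) =
          of_real (norm (complex_of_real (l i))) \<and> r * norm (complex_of_real (l i)) > 1"
        using nl i by auto
    next
      fix j assume "j \<in> {..<N}"
      then have "R * norm (m j) < 1" using m by auto
      moreover have "r * norm (m j) \<le> R * norm (m j)" using r by (intro mult_right_mono) auto
      ultimately show "r * norm (m j) < 1 \<or> m j = of_real (norm (m j)) \<and> r * norm (m j) > 1" by auto
    qed (use r in auto)
    then show ?thesis
      unfolding u_def c_def by (simp add: left_diff_distrib sum_distrib_right sum_distrib_left right_diff_distrib)
  qed
  have Wle: "1 + (\<Sum>k=1..<d. w k * cos (real k * t)) \<le> Wm" for t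
    unfolding Wm_def using w by (intro add_left_mono sum_mono) (simp add: mult_left_le)
  \<comment> \<open>The mean of u w over the circle of radius r. As w >= 0, lower bounds of u pass
    to \<open>U\<close>.\<close>
  define U where "U r = c 0 r + (\<Sum>k=1..<d. w k * c k r)" for r
  have Uint: "((\<lambda>t. u r t * (1 + (\<Sum>k=1..<d. w k * cos (real k * t)))) has_integral 2 * pi * U r) {0..2 * pi}"
    if r: "0 < r" "r \<le> R" "r \<notin> Sing" for r
  proof -
    have "((\<lambda>t. u r t * cos (real 0 * t) + (\<Sum>k=1..<d. w k * (u r t * cos (real k * t)))) has_integral
        2 * pi * c 0 r + (\<Sum>k=1..<d. w k * (2 * pi * c k r))) {0..2 * pi}"
      by (intro has_integral_add has_integral_sum has_integral_mult_right coeff r) auto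
    moreover have "2 * pi * c 0 r + (\<Sum>k=1..<d. w k * (2 * pi * c k r)) = 2 * pi * U r"
      by (simp add: U_def algebra_simps sum_distrib_left)
    moreover have "u r t * cos (real 0 * t) + (\<Sum>k=1..<d. w k * (u r t * cos (real k * t))) =
        u r t * (1 + (\<Sum>k=1..<d. w k * cos (real k * t)))" for t
      by (simp add: algebra_simps sum_distrib_left)
    ultimately show ?thesis by (simp only:)
  qed
  have Uge: "- (I * Wm / (2 * pi) * r powr p) \<le> U r"
    if r: "0 < r" "r \<le> R" "r \<notin> Sing" and g: "\<And>t. 0 \<le> g t" "(g has_integral I) {0..2 * pi}"
      and ug: "\<And>t. 0 < t \<Longrightarrow> t < 2 * pi \<Longrightarrow> - (r powr p * g t) \<le> u r t" for r p g I
  proof -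
    have "- (I * (r powr p * Wm) / (2 * pi)) \<le> 2 * pi * U r / (2 * pi)"
    proof (rule ge[OF Uint[OF r] _ g(2)])
      fix t :: real assume t: "0 < t" "t < 2 * pi"
      let ?w = "1 + (\<Sum>k=1..<d. w k * cos (real k * t))"
      have "r powr p * g t * ?w \<le> r powr p * g t * Wm"
        using Wle[of t] g(1)[of t] by (intro mult_left_mono) auto
      then have "- (r powr p * Wm * g t) \<le> - (r powr p * g t) * ?w"
        by (simp add: mult_ac)
      also have "\<dots> \<le> u r t * ?w"
        using ug[OF t] W[of t] by (intro mult_right_mono) auto
      finally show "- (r powr p * Wm * g t) \<le> u r t * ?w" .
    qed
    then show ?thesis by (simp add: mult_ac)
  qed
  have ks: "(real k)\<^sup>2 - s\<^sup>2 > 0" if "k \<ge> 1" for k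
  proof -
    have "s\<^sup>2 < 1\<^sup>2" using s by (intro power_strict_mono) auto
    moreover have "1\<^sup>2 \<le> (real k)\<^sup>2" using that by (intro power_mono) auto
    ultimately show ?thesis by simp
  qed
  have f: "0 \<le> f k" if "k \<in> {1..<d}" for k
    unfolding f_def using that w[OF that] ks[of k] by auto
  define \<Phi> where "\<Phi> i = (if R * l i \<le> 1 then 0 else radial_kernel s R (1 / l i))" for i
  define \<Phi>s where "\<Phi>s = (\<Sum>i<n. \<Phi> i)"
  have cint: "((\<lambda>r. c k r * radial_kernel s R r / r) has_integral
      (2 * s * R powr (- s) * c k R - \<Phi>s) / ((real k)\<^sup>2 - s\<^sup>2)) {0..R}" for k
  proof -
    have "((\<lambda>r. (\<Sum>i<n. log_coeff k (of_real (l i)) r * radial_kernel s R r / r) -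
        (\<Sum>j<N. log_coeff k (m j) r * radial_kernel s R r / r)) has_integral
      (\<Sum>i<n. (2 * s * R powr (- s) * log_coeff k (of_real (l i)) R - (if R * norm (complex_of_real (l i)) \<le> 1 then 0
           else radial_kernel s R (1 / norm (complex_of_real (l i))))) / ((real k)\<^sup>2 - s\<^sup>2)) -
      (\<Sum>j<N. (2 * s * R powr (- s) * log_coeff k (m j) R - (if R * norm (m j) \<le> 1 then 0
           else radial_kernel s R (1 / norm (m j)))) / ((real k)\<^sup>2 - s\<^sup>2))) {0..R}"
    proof (intro has_integral_diff has_integral_sum finite_lessThan has_integral_log_coeff_radial s)
      fix i assume "i \<in> {..<n}"
      then show "R * norm (complex_of_real (l i)) \<le> 1 \<or> complex_of_real (l i) = of_real (norm (complex_of_real (l i)))"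
        using nl by auto
    next
      fix j assume "j \<in> {..<N}"
      then show "R * norm (m j) \<le> 1 \<or> m j = of_real (norm (m j))" using m by force
    qed (use R in auto)
    moreover have "(\<Sum>i<n. (2 * s * R powr (- s) * log_coeff k (of_real (l i)) R - (if R * norm (complex_of_real (l i)) \<le> 1 then 0
           else radial_kernel s R (1 / norm (complex_of_real (l i))))) / ((real k)\<^sup>2 - s\<^sup>2)) =
        (2 * s * R powr (- s) * (\<Sum>i<n. log_coeff k (of_real (l i)) R) - \<Phi>s) / ((real k)\<^sup>2 - s\<^sup>2)"
      unfolding \<Phi>s_def \<Phi>_def sum_divide_distrib[symmetric] sum_distrib_left sum_subtractf[symmetric]
      by (intro arg_cong2[where f = "(/)"] sum.cong refl) (simp add: l(1))
    moreover have "(\<Sum>j<N. (2 * s * R powr (- s) * log_coeff k (m j) R - (if R * norm (m j) \<le> 1 then 0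
           else radial_kernel s R (1 / norm (m j)))) / ((real k)\<^sup>2 - s\<^sup>2)) =
        (2 * s * R powr (- s) * (\<Sum>j<N. log_coeff k (m j) R)) / ((real k)\<^sup>2 - s\<^sup>2)"
      unfolding sum_divide_distrib[symmetric] sum_distrib_left
      by (intro arg_cong2[where f = "(/)"] sum.cong refl) (use m in \<open>force\<close>)
    moreover have "(\<Sum>i<n. log_coeff k (of_real (l i)) r * radial_kernel s R r / r) -
        (\<Sum>j<N. log_coeff k (m j) r * radial_kernel s R r / r) = c k r * radial_kernel s R r / r" for r
      unfolding c_def left_diff_distrib sum_distrib_right diff_divide_distrib sum_divide_distrib ..
    ultimately show ?thesis
      by (simp add: c_def diff_divide_distrib[symmetric] right_diff_distrib)
        (simp add: diff_divide_distrib algebra_simps)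
  qed
  \<comment> \<open>The value f(0), not a Fourier coefficient.\<close>
  define f0 where "f0 = - 1 / s\<^sup>2 + (\<Sum>k=1..<d. f k)"
  \<comment> \<open>The mean of u (f(0) - f(t)) over the boundary circle. Since f(0) is the maximum
    of f, it is bounded below by the lower bound of u, and f(0) times the mean of u is left
    over.\<close>
  define B where "B = (\<Sum>k=1..<d. f k * (c 0 R - c k R))"
  define S where "S = 2 * s * R powr (- s) * (f0 * c 0 R - B) - f0 * \<Phi>s"
  have Sint: "((\<lambda>r. U r * radial_kernel s R r / r) has_integral S) {0..R}"
  proof -
    have "((\<lambda>r. c 0 r * radial_kernel s R r / r + (\<Sum>k=1..<d. w k * (c k r * radial_kernel s R r / r))) has_integral
      (2 * s * R powr (- s) * c 0 R - \<Phi>s) / ((real 0)\<^sup>2 - s\<^sup>2) +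
      (\<Sum>k=1..<d. w k * ((2 * s * R powr (- s) * c k R - \<Phi>s) / ((real k)\<^sup>2 - s\<^sup>2)))) {0..R}"
      by (intro has_integral_add has_integral_sum has_integral_mult_right cint) auto
    moreover have "(2 * s * R powr (- s) * c 0 R - \<Phi>s) / ((real 0)\<^sup>2 - s\<^sup>2) +
      (\<Sum>k=1..<d. w k * ((2 * s * R powr (- s) * c k R - \<Phi>s) / ((real k)\<^sup>2 - s\<^sup>2))) = S"
    proof -
      have 1: "(\<Sum>k=1..<d. w k * ((2 * s * R powr (- s) * c k R - \<Phi>s) / ((real k)\<^sup>2 - s\<^sup>2))) =
          2 * s * R powr (- s) * (\<Sum>k=1..<d. f k * c k R) - (\<Sum>k=1..<d. f k) * \<Phi>s"
        unfolding sum_distrib_left sum_distrib_right sum_subtractf[symmetric]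
        by (intro sum.cong refl) (simp add: f_def diff_divide_distrib right_diff_distrib)
      have 2: "B = (\<Sum>k=1..<d. f k) * c 0 R - (\<Sum>k=1..<d. f k * c k R)"
        unfolding B_def right_diff_distrib sum_subtractf sum_distrib_right ..
      show ?thesis
        unfolding 1 S_def 2 f0_def by (simp add: diff_divide_distrib algebra_simps)
    qed
    moreover have "c 0 r * radial_kernel s R r / r + (\<Sum>k=1..<d. w k * (c k r * radial_kernel s R r / r)) =
        U r * radial_kernel s R r / r" for r
      unfolding U_def distrib_right sum_distrib_right add_divide_distrib sum_divide_distrib
      by (simp add: mult.assoc)
    ultimately show ?thesis by simp
  qed
  define K1 where "K1 = I1 * Wm / (2 * pi)"
  define K2 where "K2 = I2 * Wm / (2 * pi)"
  have I: "0 \<le> I1" "0 \<le> I2"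
    using has_integral_nonneg[OF g(3)] has_integral_nonneg[OF g(4)] g by auto
  have "Wm \<ge> 0" unfolding Wm_def using w by (intro add_nonneg_nonneg sum_nonneg) auto
  then have K: "0 \<le> K1" "0 \<le> K2" using I by (auto simp: K1_def K2_def)
  \<comment> \<open>Changing the integrand on the finite set \<open>Sing\<close> leaves its integral
    unchanged and makes the lower bound valid at every radius.\<close>
  define h where "h = (\<lambda>r. if r \<in> Sing then 0 else U r * radial_kernel s R r / r)"
  have hint: "(h has_integral S) {0..R}"
    by (rule has_integral_spike_finite[OF fin _ Sint]) (simp add: h_def)
  have hge: "- (K * r powr (p - s - 1)) \<le> h r"
    if r: "0 \<le> r" "r \<le> R" and K: "0 \<le> K" and U: "0 < r \<Longrightarrow> r \<notin> Sing \<Longrightarrow> - (K * r powr p) \<le> U r" for r p K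
  proof (cases "r = 0 \<or> r \<in> Sing")
    case True
    then show ?thesis using K by (auto simp: h_def)
  next
    case False
    then have r0: "r > 0" using r by auto
    have rk: "0 \<le> radial_kernel s R r" "radial_kernel s R r \<le> r powr (- s)"
      using radial_kernel_nonneg[of s r R] radial_kernel_le s r by auto
    have "K * r powr p * radial_kernel s R r / r \<le> K * r powr p * r powr (- s) / r"
      using K rk r0 by (intro divide_right_mono mult_left_mono) auto
    also have "\<dots> = K * r powr (p - s - 1)"
      using r0 by (simp add: powr_diff powr_minus divide_inverse)
    finally have "- (K * r powr (p - s - 1)) \<le> - (K * r powr p) * radial_kernel s R r / r" by simp
    also have "\<dots> \<le> U r * radial_kernel s R r / r"
      using U False r0 rk by (intro divide_right_mono mult_right_mono) auto
    finally show ?thesis using False by (simp add: h_def)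
  qed
  have hi: "h integrable_on {0..1}" "h integrable_on {1..R}"
    using hint R by (auto intro: integrable_subinterval_real simp: integrable_on_def[of h "{0..R}"])
  \<comment> \<open>Near 0 the exponent p1 - s - 1 exceeds -1.\<close>
  have "((\<lambda>r. r powr (p1 - s - 1)) has_integral (1 powr (p1 - s - 1 + 1) / (p1 - s - 1 + 1))) {0..1}"
    using p by (intro has_integral_powr_from_0) auto
  then have "((\<lambda>r. - (K1 * r powr (p1 - s - 1))) has_integral - (K1 * (1 / (p1 - s)))) {0..1}"
    by (intro has_integral_neg has_integral_mult_right) simp
  then have h1: "- (K1 * (1 / (p1 - s))) \<le> integral {0..1} h"
  proof (rule has_integral_le[OF _ integrable_integral[OF hi(1)]])
    fix r :: real assume r: "r \<in> {0..1}"
    show "- (K1 * r powr (p1 - s - 1)) \<le> h r"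
    proof (rule hge[OF _ _ K(1)])
      assume "0 < r" "r \<notin> Sing"
      then show "- (K1 * r powr p1) \<le> U r"
        unfolding K1_def using r R by (intro Uge[OF _ _ _ g(1) g(3)] u1) auto
    qed (use r R in auto)
  qed
  \<comment> \<open>On [1, R] the exponent p2 - s - 1 is below -1, so the integral is at most 1 / (s
    - p2) for every R.\<close>
  have "((\<lambda>r. r powr (p2 - s - 1)) has_integral (R powr (p2 - s) / (p2 - s) - 1 powr (p2 - s) / (p2 - s))) {1..R}"
  proof (rule fundamental_theorem_of_calculus[OF R])
    fix r assume "r \<in> {1..R}"
    then have "((\<lambda>r. r powr (p2 - s) / (p2 - s)) has_real_derivative r powr (p2 - s - 1)) (at r)"
      using p DERIV_cdivide[OF has_real_derivative_powr[of r "p2 - s"], of "p2 - s"] by simp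
    then show "((\<lambda>r. r powr (p2 - s) / (p2 - s)) has_vector_derivative r powr (p2 - s - 1)) (at r within {1..R})"
      by (simp add: has_real_derivative_iff_has_vector_derivative has_vector_derivative_at_within)
  qed
  then have "((\<lambda>r. - (K2 * r powr (p2 - s - 1))) has_integral - (K2 * (R powr (p2 - s) / (p2 - s) - 1 powr (p2 - s) / (p2 - s)))) {1..R}"
    by (intro has_integral_neg has_integral_mult_right) simp
  then have "- (K2 * (R powr (p2 - s) / (p2 - s) - 1 powr (p2 - s) / (p2 - s))) \<le> integral {1..R} h"
  proof (rule has_integral_le[OF _ integrable_integral[OF hi(2)]])
    fix r :: real assume r: "r \<in> {1..R}"
    show "- (K2 * r powr (p2 - s - 1)) \<le> h r"
    proof (rule hge[OF _ _ K(2)])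
      assume "0 < r" "r \<notin> Sing"
      then show "- (K2 * r powr p2) \<le> U r"
        unfolding K2_def using r R by (intro Uge[OF _ _ _ g(2) g(4)] u2) auto
    qed (use r R in auto)
  qed
  moreover have "K2 * (R powr (p2 - s) / (p2 - s) - 1 powr (p2 - s) / (p2 - s)) \<le> K2 * (1 / (s - p2))"
  proof (rule mult_left_mono[OF _ K(2)])
    have "R powr (p2 - s) / (p2 - s) \<le> 0"
      using p by (intro divide_nonneg_neg) auto
    moreover have "- (1 / (p2 - s)) = 1 / (s - p2)"
      by (metis minus_diff_eq minus_divide_right)
    ultimately show "R powr (p2 - s) / (p2 - s) - 1 powr (p2 - s) / (p2 - s) \<le> 1 / (s - p2)" by simp
  qed
  ultimately have h2: "- (K2 * (1 / (s - p2))) \<le> integral {1..R} h" by simp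
  have "integral {0..1} h + integral {1..R} h = S"
    using Henstock_Kurzweil_Integration.integral_combine[OF _ R, where a = 0 and f = h] hint
    by (auto simp: integral_unique has_integral_integrable)
  then have Sge: "- (K1 * (1 / (p1 - s))) - K2 * (1 / (s - p2)) \<le> S"
    using h1 h2 by simp
  have Rn: "R \<notin> Sing"
  proof
    assume "R \<in> Sing"
    then obtain i where "i < n" "R = 1 / l i" by (auto simp: Sing_def)
    then show False using l(2)[of i] R by (cases "l i = 0") auto
  qed
  have Bk: "- (2 * I2 / (2 * pi) * R powr p2) \<le> c 0 R - c k R" for k
  proof -
    have "((\<lambda>t. u R t * cos (real 0 * t) - u R t * cos (real k * t)) has_integral 2 * pi * c 0 R - 2 * pi * c k R) {0..2 * pi}"
      using R Rn by (intro has_integral_diff coeff) auto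
    then have "- (I2 * (2 * R powr p2) / (2 * pi)) \<le> (2 * pi * c 0 R - 2 * pi * c k R) / (2 * pi)"
    proof (rule ge[OF _ _ g(4)])
      fix t :: real assume t: "0 < t" "t < 2 * pi"
      have "R powr p2 * g2 t * (1 - cos (real k * t)) \<le> R powr p2 * g2 t * 2"
        using g(2)[of t] cos_ge_minus_one[of "real k * t"] by (intro mult_left_mono) auto
      then have "- (2 * R powr p2 * g2 t) \<le> - (R powr p2 * g2 t) * (1 - cos (real k * t))"
        by (simp add: mult_ac)
      also have "\<dots> \<le> u R t * (1 - cos (real k * t))"
        using u2[of R t] t R by (intro mult_right_mono) auto
      finally show "- (2 * R powr p2 * g2 t) \<le> u R t * cos (real 0 * t) - u R t * cos (real k * t)"
        by (simp add: right_diff_distrib)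
    qed
    then show ?thesis by (simp add: diff_divide_distrib mult_ac)
  qed
  have Bge: "- ((\<Sum>k=1..<d. f k) * (2 * I2 / (2 * pi) * R powr p2)) \<le> B"
    unfolding B_def sum_distrib_right sum_negf[symmetric]
  proof (rule sum_mono)
    fix k assume "k \<in> {1..<d}"
    from mult_left_mono[OF Bk[of k] f[OF this]]
    show "- (f k * (2 * I2 / (2 * pi) * R powr p2)) \<le> f k * (c 0 R - c k R)" by simp
  qed
  have "- (2 * s * R powr (- s) * B) \<le> 2 * s * R powr (- s) * ((\<Sum>k=1..<d. f k) * (2 * I2 / (2 * pi) * R powr p2))"
    using mult_left_mono[OF Bge, of "2 * s * R powr (- s)"] s by simp
  also have "\<dots> = 2 * s * ((\<Sum>k=1..<d. f k) * (2 * I2 / (2 * pi))) * R powr (p2 - s)"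
  proof -
    have *: "R powr (p2 - s) = R powr (- s) * R powr p2"
      by (simp flip: powr_add)
    show ?thesis unfolding * by (simp only: mult_ac)
  qed
  also have "\<dots> \<le> 2 * s * ((\<Sum>k=1..<d. f k) * (2 * I2 / (2 * pi))) * 1"
  proof (rule mult_left_mono)
    show "R powr (p2 - s) \<le> 1" using powr_mono[of "p2 - s" 0 R] R p by simp
    show "0 \<le> 2 * s * ((\<Sum>k=1..<d. f k) * (2 * I2 / (2 * pi)))"
      using s I f by (intro mult_nonneg_nonneg sum_nonneg) auto
  qed
  finally have B': "- (2 * s * R powr (- s) * B) \<le> 2 * s * ((\<Sum>k=1..<d. f k) * (2 * I2 / (2 * pi)))" by simp
  \<comment> \<open>Jensen's formula: the \<open>m j\<close> contribute nothing because their
    reciprocals lie outside the disc. This is where the absence of zeros of D enters, together with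
    the missing kernel terms of the \<open>m j\<close> in \<open>cint\<close>.\<close>
  have c0: "c 0 R = (\<Sum>i<n. if R * l i \<le> 1 then 0 else ln (R * l i))"
  proof -
    have "log_coeff 0 (of_real (l i)) R = (if R * l i \<le> 1 then 0 else ln (R * l i))" if "i < n" for i
      using l(1)[OF that] by (simp add: log_coeff_def)
    moreover have "log_coeff 0 (m j) R = 0" if "j < N" for j
      using m[OF that] by (simp add: log_coeff_def)
    ultimately show ?thesis by (simp add: c_def)
  qed
  have "(\<Sum>i<n. if R * l i \<le> 1 then 0 else radial_kernel s R (1 / l i) - 2 * s * R powr (- s) * ln (R * l i)) =
      \<Phi>s - 2 * s * R powr (- s) * c 0 R"
    unfolding c0 \<Phi>s_def \<Phi>_def sum_distrib_left sum_subtractf[symmetric] by (intro sum.cong refl) auto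
  then have "f0 * (\<Sum>i<n. if R * l i \<le> 1 then 0 else radial_kernel s R (1 / l i) - 2 * s * R powr (- s) * ln (R * l i)) =
      f0 * (\<Phi>s - 2 * s * R powr (- s) * c 0 R)"
    by (simp only:)
  also have "\<dots> = - S - 2 * s * R powr (- s) * B"
    by (simp add: S_def algebra_simps)
  also have "\<dots> \<le> K1 * (1 / (p1 - s)) + K2 * (1 / (s - p2)) + 2 * s * ((\<Sum>k=1..<d. f k) * (2 * I2 / (2 * pi)))"
    using Sge B' by linarith
  finally show ?thesis
    unfolding f0_def f_def K1_def K2_def Wm_def
    by (simp only: mult.commute[of I1] mult.commute[of I2] times_divide_eq_right mult_1_right)
qed

section \<open>Truncations and the final contradiction\<close>

text \<open>Otherwise truncations of arbitrarily large index have unit eigenvectors u with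
  eigenvalues of modulus at least 1/R. By compactness of A and closeness of B to A, a subsequence of
  the u converges to a unit eigenvector of A for a non-zero eigenvalue, which the spectrum {0}
  forbids.\<close>

lemma volterra_approx_eigenvalues:
  fixes A :: "'a :: complex_hilbert_space \<Rightarrow> 'a" and B :: "nat \<Rightarrow> 'a \<Rightarrow> 'a"
  assumes A: "volterra_operator A"
    and B: "\<And>n c x. B n (c *\<^sub>C x) = c *\<^sub>C B n x"
    and close: "\<And>n x. norm (A x - B n x) \<le> \<epsilon> n * norm x" "\<epsilon> \<longlonglongrightarrow> 0"
    and R: "0 < R"
  shows "eventually (\<lambda>n. \<forall>\<mu> x. x \<noteq> 0 \<longrightarrow> B n x = \<mu> *\<^sub>C x \<longrightarrow> R * cmod \<mu> < 1) sequentially"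
proof (rule ccontr)
  assume "\<not> ?thesis"
  then have "\<forall>k. \<exists>n\<ge>k. \<exists>\<mu> x. x \<noteq> 0 \<and> B n x = \<mu> *\<^sub>C x \<and> R * cmod \<mu> \<ge> 1"
    unfolding eventually_sequentially by (auto simp: not_less)
  then obtain N \<mu> x where N: "\<And>k. N k \<ge> k" and x: "\<And>k. x k \<noteq> 0" "\<And>k. B (N k) (x k) = \<mu> k *\<^sub>C x k"
      and \<mu>: "\<And>k. R * cmod (\<mu> k) \<ge> 1"
    by metis
  define u where "u k = (1 / of_real (norm (x k))) *\<^sub>C x k" for k
  \<comment> \<open>The reciprocals are bounded by R, so a convergent subsequence exists without an
    upper bound for the eigenvalues.\<close>
  define \<nu> where "\<nu> k = 1 / \<mu> k" for k
  have nu: "norm (u k) = 1" for k using x(1)[of k] by (simp add: u_def norm_scaleC norm_divide)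
  have \<mu>0: "\<mu> k \<noteq> 0" for k using \<mu>[of k] by auto
  have Bu: "B (N k) (u k) = \<mu> k *\<^sub>C u k" for k
    unfolding u_def B x(2) by (simp only: scaleC_scaleC mult.commute)
  have \<nu>R: "cmod (\<nu> k) \<le> R" for k
  proof -
    have "cmod (\<mu> k) > 0" using \<mu>0 by simp
    then show ?thesis using \<mu>[of k] by (simp add: \<nu>_def norm_divide divide_le_eq)
  qed
  have err: "norm (u k - \<nu> k *\<^sub>C A (u k)) \<le> R * \<bar>\<epsilon> (N k)\<bar>" for k
  proof -
    have "\<nu> k *\<^sub>C B (N k) (u k) = u k" using \<mu>0[of k] by (simp add: Bu scaleC_scaleC \<nu>_def scaleC_one)
    then have "u k - \<nu> k *\<^sub>C A (u k) = \<nu> k *\<^sub>C (B (N k) (u k) - A (u k))"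
      by (simp add: complex_vector.scale_right_diff_distrib)
    then have "norm (u k - \<nu> k *\<^sub>C A (u k)) = cmod (\<nu> k) * norm (A (u k) - B (N k) (u k))"
      by (simp add: norm_scaleC norm_minus_commute)
    also have "\<dots> \<le> R * \<bar>\<epsilon> (N k)\<bar>"
      using close(1)[of "u k" "N k"] nu[of k] R by (intro mult_mono \<nu>R) auto
    finally show ?thesis .
  qed
  have co: "compact_operator A" using A by (simp add: volterra_operator_def)
  interpret A: bounded_linear A using co by (rule compact_operatorD)
  have AC: "A (c *\<^sub>C y) = c *\<^sub>C A y" for c y using co by (rule compact_operatorD)
  obtain y r where r: "strict_mono (r :: nat \<Rightarrow> nat)" "(\<lambda>k. A (u (r k))) \<longlonglongrightarrow> y"
    using co by (rule compact_operator_subseq[of A u 1]) (simp add: nu)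
  have "bounded (range (\<lambda>k. \<nu> (r k)))" using \<nu>R by (auto simp: bounded_iff)
  then obtain \<nu>0 q where q: "strict_mono (q :: nat \<Rightarrow> nat)" "((\<lambda>k. \<nu> (r k)) \<circ> q) \<longlonglongrightarrow> \<nu>0"
    using bounded_imp_convergent_subsequence by blast
  define h where "h k = r (q k)" for k
  have h: "strict_mono h" using r(1) q(1) by (auto simp: h_def strict_mono_def)
  have limA: "(\<lambda>k. A (u (h k))) \<longlonglongrightarrow> y"
    using LIMSEQ_subseq_LIMSEQ[OF r(2) q(1)] by (simp add: o_def h_def)
  have lim\<nu>: "(\<lambda>k. \<nu> (h k)) \<longlonglongrightarrow> \<nu>0" using q(2) by (simp add: o_def h_def)
  have "filterlim (\<lambda>k. N (h k)) at_top sequentially"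
  proof (rule filterlim_at_top_mono[OF filterlim_subseq[OF h]])
    show "eventually (\<lambda>k. h k \<le> N (h k)) sequentially" using N by simp
  qed
  then have "(\<lambda>k. \<epsilon> (N (h k))) \<longlonglongrightarrow> 0" by (rule filterlim_compose[OF close(2)])
  then have lim\<epsilon>: "(\<lambda>k. R * \<bar>\<epsilon> (N (h k))\<bar>) \<longlonglongrightarrow> 0"
    using tendsto_mult[OF tendsto_const[of R] tendsto_rabs_zero] by fastforce
  have "(\<lambda>k. u (h k) - \<nu> (h k) *\<^sub>C A (u (h k))) \<longlonglongrightarrow> 0"
    by (rule Lim_null_comparison[OF always_eventually lim\<epsilon>]) (use err in blast)
  moreover have "(\<lambda>k. \<nu> (h k) *\<^sub>C A (u (h k))) \<longlonglongrightarrow> \<nu>0 *\<^sub>C y"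
  proof -
    have "(\<lambda>k. cmod (\<nu> (h k) - \<nu>0) * norm (A (u (h k))) + norm (\<nu>0 *\<^sub>C (A (u (h k)) - y))) \<longlonglongrightarrow>
        0 * norm y + norm (\<nu>0 *\<^sub>C 0 :: 'a)"
    proof (intro tendsto_intros limA)
      show "(\<lambda>k. cmod (\<nu> (h k) - \<nu>0)) \<longlonglongrightarrow> 0"
        using lim\<nu> by (simp add: LIM_zero tendsto_norm_zero)
      show "(\<lambda>k. \<nu>0 *\<^sub>C (A (u (h k)) - y)) \<longlonglongrightarrow> \<nu>0 *\<^sub>C 0"
        using limA by (intro bounded_linear.tendsto[OF bounded_clinear_scaleC] LIM_zero)
    qed
    then have *: "(\<lambda>k. cmod (\<nu> (h k) - \<nu>0) * norm (A (u (h k))) + norm (\<nu>0 *\<^sub>C (A (u (h k)) - y))) \<longlonglongrightarrow> 0"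
      by simp
    have "(\<lambda>k. \<nu> (h k) *\<^sub>C A (u (h k)) - \<nu>0 *\<^sub>C y) \<longlonglongrightarrow> 0"
    proof (rule Lim_null_comparison[OF always_eventually *], intro allI)
      fix k
      have "\<nu> (h k) *\<^sub>C A (u (h k)) - \<nu>0 *\<^sub>C y = (\<nu> (h k) - \<nu>0) *\<^sub>C A (u (h k)) + \<nu>0 *\<^sub>C (A (u (h k)) - y)"
        by (simp add: complex_vector.scale_left_diff_distrib complex_vector.scale_right_diff_distrib)
      then show "norm (\<nu> (h k) *\<^sub>C A (u (h k)) - \<nu>0 *\<^sub>C y) \<le>
          cmod (\<nu> (h k) - \<nu>0) * norm (A (u (h k))) + norm (\<nu>0 *\<^sub>C (A (u (h k)) - y))"
        using norm_triangle_ineq[of "(\<nu> (h k) - \<nu>0) *\<^sub>C A (u (h k))" "\<nu>0 *\<^sub>C (A (u (h k)) - y)"]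
        by (simp only: norm_scaleC[of "\<nu> (h k) - \<nu>0"])
    qed
    then show ?thesis by (rule LIM_zero_cancel)
  qed
  ultimately have limu: "(\<lambda>k. u (h k)) \<longlonglongrightarrow> \<nu>0 *\<^sub>C y"
    using tendsto_add by fastforce
  define z where "z = \<nu>0 *\<^sub>C y"
  have "(\<lambda>k. norm (u (h k))) \<longlonglongrightarrow> norm z" unfolding z_def by (intro tendsto_norm limu)
  then have nz: "norm z = 1" by (simp add: nu LIMSEQ_const_iff)
  have "A z = y" using LIMSEQ_unique[OF A.tendsto[OF limu] limA] by (simp add: z_def)
  then have z: "z = \<nu>0 *\<^sub>C A z" by (simp add: z_def)
  have "\<nu>0 \<noteq> 0" using z nz by auto
  then have "1 / \<nu>0 \<notin> cspectrum A"
    using A by (simp add: volterra_operator_def quasinilpotent_def)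
  then obtain Q where Q: "bounded_clinear Q" "\<And>x. Q (A x - (1 / \<nu>0) *\<^sub>C x) = x"
    unfolding cspectrum_def by auto
  have "A z - (1 / \<nu>0) *\<^sub>C z = 0"
    by (subst (2) z) (use \<open>\<nu>0 \<noteq> 0\<close> in \<open>simp add: scaleC_scaleC scaleC_one\<close>)
  then have "z = Q 0" using Q(2)[of z] by simp
  also have "Q 0 = 0"
    by (rule linear_0[OF bounded_linear.linear[OF bounded_clinearD(1)[OF Q(1)]]])
  finally show False using nz by simp
qed

text \<open>Applied with w = r l it gives r l / |1 - z l| <= 1 / sin(t/2) on the ray of angle t, a
  resolvent bound independent of the eigenvalues l of C.\<close>

lemma sin_half_mult_le:
  fixes t w :: real
  assumes w: "0 \<le> w"
  shows "\<bar>sin (t / 2)\<bar> * w \<le> cmod (1 - of_real w * cis t)"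
proof (rule power2_le_imp_le)
  define c where "c = cos t"
  have c: "-1 \<le> c" "c \<le> 1" by (auto simp: c_def)
  have "(cmod (1 - of_real w * cis t))\<^sup>2 = (1 - w * c)\<^sup>2 + (w * sin t)\<^sup>2"
    by (simp add: cmod_power2 c_def)
  also have "(w * sin t)\<^sup>2 = w\<^sup>2 * (1 - c\<^sup>2)"
    by (simp add: power_mult_distrib sin_squared_eq c_def)
  finally have 1: "(cmod (1 - of_real w * cis t))\<^sup>2 = 1 - 2 * w * c + w\<^sup>2"
    by (simp add: power2_eq_square algebra_simps)
  have "c = 1 - 2 * (sin (t / 2))\<^sup>2"
    using cos_double_sin[of "t / 2"] by (simp add: c_def)
  then have 2: "(\<bar>sin (t / 2)\<bar> * w)\<^sup>2 = w\<^sup>2 * ((1 - c) / 2)"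
    by (simp add: power_mult_distrib)
  \<comment> \<open>The difference of the squares. For c > 0 it dominates (1 - w c)^2, because c^2
    <= (1 + c) / 2.\<close>
  have "0 \<le> 1 - 2 * w * c + w\<^sup>2 * ((1 + c) / 2)"
  proof (cases "c \<le> 0")
    case True
    then have "w * c \<le> 0" using w by (simp add: mult_nonneg_nonpos)
    moreover have "0 \<le> w\<^sup>2 * ((1 + c) / 2)" using c by simp
    ultimately show ?thesis by linarith
  next
    case False
    have "c * c \<le> 1 * c" using False c by (intro mult_right_mono) auto
    then have "c\<^sup>2 \<le> (1 + c) / 2" using c by (simp add: power2_eq_square)
    then have "w\<^sup>2 * c\<^sup>2 \<le> w\<^sup>2 * ((1 + c) / 2)" by (intro mult_left_mono) auto
    moreover have "0 \<le> (1 - w * c)\<^sup>2" by simp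
    moreover have "(1 - w * c)\<^sup>2 = 1 - 2 * w * c + w\<^sup>2 * c\<^sup>2"
      by (simp add: power2_eq_square algebra_simps)
    ultimately show ?thesis by linarith
  qed
  then show "(\<bar>sin (t / 2)\<bar> * w)\<^sup>2 \<le> (cmod (1 - of_real w * cis t))\<^sup>2"
    unfolding 1 2 by (simp add: field_simps)
qed simp

text \<open>The finite-rank operator factors through 2n coordinates: x goes to the numbers <x, v_i>,
  <x, phi_j>, and (a, b) goes back to a vector. Composing in the other order gives the block matrix
  with entries l, P, Q, S, whose non-zero eigenvalues are eigenvalues of the operator. The entries
  of its Schur complement differ from those of the identity by at most a constant times tau_k
  tau_j.\<close>

lemma finite_rank_determinant_bound:
  fixes v \<phi> \<psi> :: "nat \<Rightarrow> 'a :: complex_hilbert_space"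
  assumes v: "semi_orthonormal v" and l: "\<And>i. 0 \<le> l i" "\<And>i. v i = 0 \<Longrightarrow> l i = 0"
    and \<tau>: "\<And>j. norm (\<phi> j) \<le> \<tau> j" "\<And>j. norm (\<psi> j) \<le> \<tau> j" "(\<Sum>j<n. \<tau> j) \<le> M"
  shows "\<exists>\<mu>s.
    (\<forall>\<mu>\<in>set \<mu>s. \<mu> \<noteq> 0 \<longrightarrow> (\<exists>x. x \<noteq> 0 \<and>
       (\<Sum>i<n. (of_real (l i) * cinner x (v i)) *\<^sub>C v i) + (\<Sum>j<n. cinner x (\<phi> j) *\<^sub>C \<psi> j) = \<mu> *\<^sub>C x)) \<and>
    (\<forall>r t. 0 < r \<longrightarrow> 0 < t \<longrightarrow> t < 2 * pi \<longrightarrow>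
       cmod (\<Prod>\<mu>\<leftarrow>\<mu>s. 1 - \<mu> * of_real r * cis t) \<le> (\<Prod>i<n. cmod (1 - of_real (l i) * of_real r * cis t)) *
         (\<Prod>k<n. 1 + 2 * r * M / sin (t / 2) * \<tau> k))"
proof -
  define P where "P i j = cinner (\<psi> j) (v i)" for i j
  define Q where "Q k i = of_real (l i) * cinner (v i) (\<phi> k)" for k i
  define S where "S k j = cinner (\<psi> j) (\<phi> k)" for k j
  obtain \<mu>s where \<mu>s: "\<And>\<mu>. \<mu> \<in> set \<mu>s \<Longrightarrow> \<exists>a b. (\<exists>i<n. a i \<noteq> 0 \<or> b i \<noteq> 0) \<and>
       (\<forall>i<n. of_real (l i) * a i + (\<Sum>j<n. P i j * b j) = \<mu> * a i) \<and>
       (\<forall>k<n. (\<Sum>i<n. Q k i * a i) + (\<Sum>j<n. S k j * b j) = \<mu> * b k)"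
    "\<And>z. z \<noteq> 0 \<Longrightarrow> (\<And>i. i < n \<Longrightarrow> z * of_real (l i) \<noteq> 1) \<Longrightarrow>
       norm (\<Prod>\<mu>\<leftarrow>\<mu>s. 1 - z * \<mu>) \<le> (\<Prod>i<n. norm (1 - z * of_real (l i))) *
         (\<Prod>k<n. \<Sum>j<n. norm (of_bool (k = j) - z * S k j -
            (\<Sum>i<n. z^2 * Q k i * P i j / (1 - z * of_real (l i)))))"
    by (rule obtain_block_eigenvalues[of n "\<lambda>i. complex_of_real (l i)" P Q S]) blast
  show ?thesis
  proof (intro exI[of _ \<mu>s] conjI ballI allI impI)
    fix \<mu> assume "\<mu> \<in> set \<mu>s" and \<mu>0: "\<mu> \<noteq> 0"
    from \<mu>s(1)[OF this(1)] obtain a b where nz: "\<exists>i<n. a i \<noteq> 0 \<or> b i \<noteq> 0"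
      and ea: "\<And>i. i < n \<Longrightarrow> of_real (l i) * a i + (\<Sum>j<n. P i j * b j) = \<mu> * a i"
      and eb: "\<And>k. k < n \<Longrightarrow> (\<Sum>i<n. Q k i * a i) + (\<Sum>j<n. S k j * b j) = \<mu> * b k" by blast
    \<comment> \<open>The vector with coordinates (a, b). Its inner products with \<open>v i\<close>
      and \<open>\<phi> k\<close> reproduce mu a and mu b, so it is non-zero when mu is.\<close>
    define x where "x = (\<Sum>i<n. (of_real (l i) * a i) *\<^sub>C v i) + (\<Sum>j<n. b j *\<^sub>C \<psi> j)"
    have xv: "cinner x (v i) = \<mu> * a i" if "i < n" for i
    proof -
      have "cinner (\<Sum>i<n. (of_real (l i) * a i) *\<^sub>C v i) (v i) = of_real (l i) * a i"
        unfolding cinner_sum_semi_orthonormal[OF v finite_lessThan] using that l(2)[of i] by auto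
      moreover have "cinner (\<Sum>j<n. b j *\<^sub>C \<psi> j) (v i) = (\<Sum>j<n. P i j * b j)"
        unfolding cinner_sum_left by (simp add: cinner_scaleC_left P_def mult.commute)
      ultimately show ?thesis unfolding x_def cinner_add_left using ea[OF that] by simp
    qed
    have x\<phi>: "cinner x (\<phi> k) = \<mu> * b k" if "k < n" for k
    proof -
      have "cinner x (\<phi> k) = (\<Sum>i<n. Q k i * a i) + (\<Sum>j<n. S k j * b j)"
        unfolding x_def cinner_add_left cinner_sum_left
        by (simp add: cinner_scaleC_left Q_def S_def mult_ac)
      then show ?thesis using eb[OF that] by simp
    qed
    have "x \<noteq> 0"
    proof
      assume "x = 0"
      then have "a i = 0" "b i = 0" if "i < n" for i using xv[OF that] x\<phi>[OF that] \<mu>0 by auto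
      then show False using nz by blast
    qed
    moreover have "(\<Sum>i<n. (of_real (l i) * cinner x (v i)) *\<^sub>C v i) + (\<Sum>j<n. cinner x (\<phi> j) *\<^sub>C \<psi> j) = \<mu> *\<^sub>C x"
      unfolding x_def[THEN arg_cong, of "\<lambda>y. \<mu> *\<^sub>C y"] scaleC_add_right complex_vector.scale_sum_right
      by (intro arg_cong2[where f = "(+)"] sum.cong refl) (simp_all add: xv x\<phi> scaleC_scaleC mult_ac)
    ultimately show "\<exists>x. x \<noteq> 0 \<and>
       (\<Sum>i<n. (of_real (l i) * cinner x (v i)) *\<^sub>C v i) + (\<Sum>j<n. cinner x (\<phi> j) *\<^sub>C \<psi> j) = \<mu> *\<^sub>C x"
      by blast
  next
    fix r t :: real assume r: "0 < r" and t: "0 < t" "t < 2 * pi"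
    define z where "z = of_real r * cis t"
    define \<sigma> where "\<sigma> = sin (t / 2)"
    have \<sigma>: "0 < \<sigma>" "\<sigma> \<le> 1" unfolding \<sigma>_def using t by (auto intro!: sin_gt_zero)
    define X where "X k j = (\<Sum>i<n. z^2 * Q k i * P i j / (1 - z * of_real (l i)))" for k j
    have nz: "cmod z = r" using r by (simp add: z_def norm_mult)
    have \<sigma>l: "\<sigma> * (r * l i) \<le> cmod (1 - z * of_real (l i))" for i
    proof -
      have "\<bar>sin (t / 2)\<bar> * (r * l i) \<le> cmod (1 - of_real (r * l i) * cis t)"
        using r l(1)[of i] by (intro sin_half_mult_le) simp
      then show ?thesis using \<sigma>(1) by (simp add: \<sigma>_def z_def mult_ac)
    qed
    have zl: "z * of_real (l i) \<noteq> 1" for i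
    proof
      assume *: "z * of_real (l i) = 1"
      then have "\<sigma> * (r * l i) \<le> 0" using \<sigma>l[of i] by simp
      then have "l i \<le> 0" using \<sigma>(1) r by (simp add: mult_le_0_iff)
      then have "l i = 0" using l(1)[of i] by simp
      then show False using * by simp
    qed
    have \<tau>0: "0 \<le> \<tau> j" for j using \<tau>(1)[of j] by (meson norm_ge_zero order_trans)
    \<comment> \<open>Both summands are at most r / sigma * tau_k * tau_j. For X the factors r l_i /
      |1 - z l_i| are bounded by 1 / sigma, after which Cauchy-Schwarz and Bessel make the sum over
      i independent of n.\<close>
    have entry: "cmod (z * S k j + X k j) \<le> 2 * r / \<sigma> * \<tau> k * \<tau> j" for k j
    proof -
      have 1: "cmod (z * S k j) \<le> r / \<sigma> * (\<tau> k * \<tau> j)"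
      proof -
        have "cmod (S k j) \<le> \<tau> k * \<tau> j"
          unfolding S_def using norm_cinner_le[of "\<psi> j" "\<phi> k"] mult_mono[OF \<tau>(2)[of j] \<tau>(1)[of k] \<tau>0]
          by (simp add: mult.commute)
        then have "cmod (z * S k j) \<le> r * (\<tau> k * \<tau> j)" using r by (simp add: norm_mult nz mult_left_mono)
        also have "\<dots> \<le> r / \<sigma> * (\<tau> k * \<tau> j)"
          using r \<sigma> \<tau>0 by (intro mult_right_mono) (auto simp: le_divide_eq)
        finally show ?thesis .
      qed
      define p where "p i = cmod (cinner (\<phi> k) (v i))" for i
      define q where "q i = cmod (cinner (\<psi> j) (v i))" for i
      have "cmod (X k j) \<le> (\<Sum>i<n. r / \<sigma> * (p i * q i))"
      unfolding X_def
      proof (rule sum_norm_le)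
        fix i
        have c: "cmod (1 - z * of_real (l i)) > 0" using zl[of i] by simp
        have "cinner (v i) (\<phi> k) = cnj (cinner (\<phi> k) (v i))" by (rule cinner_commute)
        then have "cmod (cinner (v i) (\<phi> k)) = p i" by (simp add: p_def)
        then have "cmod (z^2 * Q k i * P i j / (1 - z * of_real (l i))) =
            (r * (p i * q i)) * ((r * l i) / cmod (1 - z * of_real (l i)))"
          using l(1)[of i] by (simp add: norm_mult norm_divide norm_power nz Q_def P_def q_def power2_eq_square)
        also have "\<dots> \<le> (r * (p i * q i)) * (1 / \<sigma>)"
        proof (rule mult_left_mono)
          show "(r * l i) / cmod (1 - z * of_real (l i)) \<le> 1 / \<sigma>"
            using \<sigma>l[of i] c \<sigma>(1) by (simp add: divide_le_eq le_divide_eq mult.commute)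
        qed (use r in \<open>simp add: p_def q_def\<close>)
        finally show "cmod (z^2 * Q k i * P i j / (1 - z * of_real (l i))) \<le> r / \<sigma> * (p i * q i)" by simp
      qed
      also have "\<dots> = r / \<sigma> * (\<Sum>i<n. p i * q i)" by (simp add: sum_distrib_left)
      also have "\<dots> \<le> r / \<sigma> * (\<tau> k * \<tau> j)"
      proof (rule mult_left_mono)
        have "(\<Sum>i<n. p i * q i)\<^sup>2 \<le> (\<Sum>i<n. (p i)\<^sup>2) * (\<Sum>i<n. (q i)\<^sup>2)"
          by (rule Cauchy_Schwarz_ineq_sum)
        also have "\<dots> \<le> (norm (\<phi> k))\<^sup>2 * (norm (\<psi> j))\<^sup>2"
          unfolding p_def q_def by (intro mult_mono bessel_inequality[OF v]) (auto intro: sum_nonneg)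
        also have "\<dots> \<le> (\<tau> k)\<^sup>2 * (\<tau> j)\<^sup>2"
          by (intro mult_mono power_mono \<tau>) auto
        finally have "(\<Sum>i<n. p i * q i)\<^sup>2 \<le> (\<tau> k * \<tau> j)\<^sup>2" by (simp add: power_mult_distrib)
        then show "(\<Sum>i<n. p i * q i) \<le> \<tau> k * \<tau> j"
          by (rule power2_le_imp_le) (simp add: \<tau>0)
      qed (use r \<sigma> in simp)
      finally have 2: "cmod (X k j) \<le> r / \<sigma> * (\<tau> k * \<tau> j)" .
      have "cmod (z * S k j + X k j) \<le>
          r / \<sigma> * (\<tau> k * \<tau> j) + r / \<sigma> * (\<tau> k * \<tau> j)"
        by (rule norm_triangle_le[OF add_mono[OF 1 2]])
      then show ?thesis by (simp add: mult_ac)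
    qed
    have row: "(\<Sum>j<n. norm (of_bool (k = j) - z * S k j - X k j)) \<le> 1 + 2 * r * M / \<sigma> * \<tau> k" if "k < n" for k
    proof -
      have "(\<Sum>j<n. norm (of_bool (k = j) - z * S k j - X k j)) \<le>
          (\<Sum>j<n. of_bool (k = j) + 2 * r / \<sigma> * \<tau> k * \<tau> j)"
      proof (rule sum_mono)
        fix j
        have "norm (of_bool (k = j) - (z * S k j + X k j)) \<le>
          norm (of_bool (k = j) :: complex) + cmod (z * S k j + X k j)"
          by (rule norm_triangle_ineq4)
        also have "\<dots> \<le> of_bool (k = j) + 2 * r / \<sigma> * \<tau> k * \<tau> j"
          by (intro add_mono entry) simp
        finally show "norm (of_bool (k = j) - z * S k j - X k j) \<le>
          of_bool (k = j) + 2 * r / \<sigma> * \<tau> k * \<tau> j"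
          by (simp only: diff_diff_eq)
      qed
      also have "\<dots> = 1 + 2 * r / \<sigma> * \<tau> k * (\<Sum>j<n. \<tau> j)"
        using that by (simp add: sum.distrib sum_distrib_left)
      also have "\<dots> \<le> 1 + 2 * r / \<sigma> * \<tau> k * M"
        using r \<sigma> \<tau>0 by (intro add_left_mono mult_left_mono \<tau>(3)) auto
      finally show ?thesis by (simp add: mult_ac)
    qed
    have "z \<noteq> 0" using nz r by auto
    from \<mu>s(2)[OF this zl, folded X_def] have "norm (\<Prod>\<mu>\<leftarrow>\<mu>s. 1 - z * \<mu>) \<le> (\<Prod>i<n. norm (1 - z * of_real (l i))) *
         (\<Prod>k<n. \<Sum>j<n. norm (of_bool (k = j) - z * S k j - X k j))" .
    also have "\<dots> \<le> (\<Prod>i<n. norm (1 - z * of_real (l i))) * (\<Prod>k<n. 1 + 2 * r * M / \<sigma> * \<tau> k)"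
      by (intro mult_left_mono prod_mono conjI row) (auto intro: sum_nonneg prod_nonneg)
    finally show "cmod (\<Prod>\<mu>\<leftarrow>\<mu>s. 1 - \<mu> * of_real r * cis t) \<le> (\<Prod>i<n. cmod (1 - of_real (l i) * of_real r * cis t)) *
         (\<Prod>k<n. 1 + 2 * r * M / sin (t / 2) * \<tau> k)"
      by (simp add: z_def \<sigma>_def mult_ac)
  qed
qed

section \<open>Letting the radius tend to infinity\<close>

lemma radial_kernel_inverse:
  assumes "x > 0"
  shows "radial_kernel s R (1 / x) = x powr s - x powr (- s) * R powr (- 2 * s)"
proof -
  have "(1 / x) powr e = x powr (- e)" for e
    using assms by (simp add: powr_divide powr_minus_divide)
  from this[of s] this[of "- s"] show ?thesis by (simp add: radial_kernel_def)
qed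

text \<open>With y = (R x)^s the expression is R^-s (y - 1/y - 2 ln y), which vanishes at y = 1 and
  has derivative R^-s (1 - 1/y)^2 in y. Thus the Jensen term never outweighs the mass, and terms may
  be dropped from the weighted sum.\<close>

lemma radial_kernel_ge_ln:
  assumes s: "0 < s" and x: "0 < x" and R: "0 < R" "1 < R * x"
  shows "0 \<le> radial_kernel s R (1 / x) - 2 * s * R powr (- s) * ln (R * x)"
proof -
  define y where "y = (R * x) powr s"
  have y1: "1 \<le> y" unfolding y_def using R s by (simp add: ge_one_powr_ge_zero)
  have "1 - 1 / 1 - 2 * ln 1 \<le> y - 1 / y - 2 * ln y"
  proof (rule DERIV_nonneg_imp_nondecreasing[OF y1, of "\<lambda>y. y - 1 / y - 2 * ln y"])
    fix z :: real assume z: "1 \<le> z" "z \<le> y"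
    have "((\<lambda>y. y - 1 / y - 2 * ln y) has_real_derivative (1 - 1 / z)\<^sup>2) (at z)"
      using z by (auto intro!: derivative_eq_intros simp: power2_eq_square field_simps)
    then show "\<exists>d. ((\<lambda>y. y - 1 / y - 2 * ln y) has_real_derivative d) (at z) \<and> 0 \<le> d" by (intro exI conjI) auto
  qed
  then have "0 \<le> R powr (- s) * (y - 1 / y - 2 * ln y)" by (intro mult_nonneg_nonneg) auto
  also have "\<dots> = R powr (- s) * y - R powr (- s) * (1 / y) - R powr (- s) * (2 * ln y)"
    by (simp add: right_diff_distrib)
  also have "R powr (- s) * y = x powr s"
    using x R by (simp add: y_def powr_mult powr_minus field_simps)
  also have "R powr (- s) * (1 / y) = x powr (- s) * R powr (- 2 * s)"
  proof -
    have "1 / y = R powr (- s) * x powr (- s)"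
      using x R by (simp add: y_def powr_mult powr_minus field_simps)
    moreover have "R powr (- 2 * s) = R powr (- s) * R powr (- s)" by (simp flip: powr_add)
    ultimately show ?thesis by (simp only: mult_ac)
  qed
  also have "ln y = s * ln (R * x)" unfolding y_def using R by (simp add: ln_powr)
  finally show ?thesis unfolding radial_kernel_inverse[OF x] by (simp add: mult_ac)
qed

lemma radial_kernel_ln_tendsto:
  assumes s: "0 < s" and x: "0 < x"
  shows "((\<lambda>R. radial_kernel s R (1 / x) - 2 * s * R powr (- s) * ln (R * x)) \<longlongrightarrow> x powr s) at_top"
  unfolding radial_kernel_inverse[OF x] using assms by real_asymp

text \<open>The \<open>m j\<close> are the eigenvalues of the \<open>n\<close>-th truncation of \<open>C + T\<close>, and \<open>\<tau>\<close> lists the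
  square roots of the s-numbers of \<open>T\<close>.\<close>

definition disc_bound :: "(nat \<Rightarrow> real) \<Rightarrow> (nat \<Rightarrow> real) \<Rightarrow> real \<Rightarrow> real \<Rightarrow> nat \<Rightarrow> bool" where
  "disc_bound l \<tau> M R n \<longleftrightarrow> (\<exists>(N :: nat) m. (\<forall>j<N. R * norm (m j :: complex) < 1) \<and>
      (\<forall>r t. 0 < r \<longrightarrow> r \<le> R \<longrightarrow> 0 < t \<longrightarrow> t < 2 * pi \<longrightarrow>
        (\<Prod>j<N. cmod (1 - m j * of_real r * cis t)) \<le> (\<Prod>i<n. cmod (1 - of_real (l i) * of_real r * cis t)) *
         (\<Prod>k<n. 1 + 2 * r * M / sin (t / 2) * \<tau> k)))"

text \<open>The bound \<open>K\<close> depends on s, d, M and the power sums of tau only. Hence R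
  can tend to infinity for a fixed number q of terms, and the resulting bound is uniform in
  q.\<close>

lemma power_sum_summable:
  fixes l \<tau> :: "nat \<Rightarrow> real"
  assumes s: "1 / 2 < s" "s < 1" and l: "\<And>i. 0 \<le> l i" and \<tau>: "\<And>i. 0 \<le> \<tau> i" and M: "0 \<le> M"
    and summ: "\<And>p. 0 < p \<Longrightarrow> p \<le> 1 \<Longrightarrow> summable (\<lambda>i. \<tau> i powr p)"
    and approx: "\<And>R. 1 \<le> R \<Longrightarrow> eventually (disc_bound l \<tau> M R) sequentially"
  shows "summable (\<lambda>i. l i powr s)"
proof -
  obtain d where d: "0 < - 1 / s\<^sup>2 + (\<Sum>k=1..<d. 2 * (1 - real k / real d) / ((real k)\<^sup>2 - s\<^sup>2))"
    using fejer_weight_pos[OF s] by blast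
  define w where "w k = 2 * (1 - real k / real d)" for k
  define f0 where "f0 = - 1 / s\<^sup>2 + (\<Sum>k=1..<d. w k / ((real k)\<^sup>2 - s\<^sup>2))"
  have f0: "f0 > 0" using d by (simp add: f0_def w_def)
  define Sp where "Sp p = (\<Sum>i. \<tau> i powr p)" for p
  \<comment> \<open>Comes from ln (1 + x) <= x^p / p with x = (2 r M / sin (t/2)) tau_k, summed over
    k; r^p is split off and the sine is replaced by its integrable majorant.\<close>
  define g where "g p t = (2 * M) powr p * Sp p / p * 4 powr p * (t powr (- p) + (2 * pi - t) powr (- p))" for p t
  define I where "I p = integral {0..2 * pi} (g p)" for p
  have Sp0: "0 \<le> Sp p" if "0 < p" "p \<le> 1" for p
    unfolding Sp_def by (rule suminf_nonneg[OF summ[OF that]]) simp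
  have g0: "0 \<le> g p t" if "0 < p" "p \<le> 1" for p t
    unfolding g_def using that Sp0[OF that] by (intro mult_nonneg_nonneg divide_nonneg_pos add_nonneg_nonneg) auto
  have gI: "(g p has_integral I p) {0..2 * pi}" if "0 < p" "p < 1" for p
    unfolding I_def
  proof (rule integrable_integral)
    show "g p integrable_on {0..2 * pi}"
      unfolding g_def[abs_def] by (intro integrable_on_mult_right integrable_powr_ends that)
  qed
  \<comment> \<open>Midpoints of (s, 1) and (0, s).\<close>
  define p1 where "p1 = (1 + s) / 2"
  define p2 where "p2 = s / 2"
  have p: "0 < p1" "p1 < 1" "s < p1" "0 < p2" "p2 < 1" "p2 < s"
    using s by (auto simp: p1_def p2_def field_simps)
  define K where "K = (1 + (\<Sum>k=1..<d. w k)) * I p1 / (2 * pi) / (p1 - s) + (1 + (\<Sum>k=1..<d. w k)) * I p2 / (2 * pi) / (s - p2)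
      + 2 * s * ((\<Sum>k=1..<d. w k / ((real k)\<^sup>2 - s\<^sup>2)) * (2 * I p2 / (2 * pi)))"
  define \<Psi> where "\<Psi> R i = (if R * l i \<le> 1 then 0 else radial_kernel s R (1 / l i) - 2 * s * R powr (- s) * ln (R * l i))" for R i
  have \<Psi>0: "0 \<le> \<Psi> R i" if "1 \<le> R" for R i
  proof (cases "R * l i \<le> 1")
    case False
    then have "l i \<noteq> 0" by auto
    then have "l i > 0" using l[of i] by simp
    then show ?thesis
      using radial_kernel_ge_ln[of s "l i" R] False that s by (simp add: \<Psi>_def)
  qed (simp add: \<Psi>_def)
  have main: "f0 * (\<Sum>i<q. \<Psi> R i) \<le> K" if R: "1 \<le> R" "\<And>i. R * l i \<noteq> 1" for R q
  proof -
    obtain n0 where n0: "\<forall>n\<ge>n0. disc_bound l \<tau> M R n"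
      using approx[OF R(1)] unfolding eventually_sequentially by (rule exE)
    \<comment> \<open>The admissible truncation depends on R. Since the summands are non-negative,
      the first q of them can be kept while n varies.\<close>
    define n where "n = max n0 q"
    have n: "n \<ge> n0" "n \<ge> q" by (simp_all add: n_def)
    have "disc_bound l \<tau> M R n" using n0 n(1) by simp
    then obtain N :: nat and m where m: "\<And>j. j < N \<Longrightarrow> R * norm (m j :: complex) < 1"
      and bd: "\<And>r t. 0 < r \<Longrightarrow> r \<le> R \<Longrightarrow> 0 < t \<Longrightarrow> t < 2 * pi \<Longrightarrow>
        (\<Prod>j<N. cmod (1 - m j * of_real r * cis t)) \<le> (\<Prod>i<n. cmod (1 - of_real (l i) * of_real r * cis t)) *
         (\<Prod>k<n. 1 + 2 * r * M / sin (t / 2) * \<tau> k)"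
      unfolding disc_bound_def by blast
    have lower: "- (r powr p * g p t) \<le> (\<Sum>i<n. ln (norm (1 - of_real (l i) * of_real r * cis t))) -
       (\<Sum>j<N. ln (norm (1 - m j * of_real r * cis t)))"
      if r: "0 < r" "r \<le> R" and t: "0 < t" "t < 2 * pi" and p: "0 < p" "p < 1" for r t p
    proof -
      define \<sigma> where "\<sigma> = sin (t / 2)"
      have \<sigma>: "0 < \<sigma>" unfolding \<sigma>_def using t by (auto intro!: sin_gt_zero)
      define y where "y = 2 * r * M / \<sigma>"
      have y: "0 \<le> y" using r \<sigma> M by (simp add: y_def)
      have mp: "0 < cmod (1 - m j * of_real r * cis t)" if "j < N" for j
      proof -
        have "cmod (m j * of_real r * cis t) = r * cmod (m j)" using r by (simp add: norm_mult)
        also have "\<dots> \<le> R * cmod (m j)" using r by (intro mult_right_mono) auto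
        also have "\<dots> < 1" by (rule m[OF that])
        finally have "m j * of_real r * cis t \<noteq> 1" by auto
        then show ?thesis by simp
      qed
      have 1: "0 < (\<Prod>j<N. cmod (1 - m j * of_real r * cis t))" by (rule prod_pos) (use mp in auto)
      have yp: "0 < 1 + y * \<tau> k" for k using y \<tau>[of k] by (intro add_pos_nonneg mult_nonneg_nonneg) auto
      then have f: "0 < (\<Prod>k<n. 1 + y * \<tau> k)" by (intro prod_pos) auto
      \<comment> \<open>A zero factor would force the positive product over the \<open>m j\<close>
        to be at most 0. So every logarithm below has a positive argument.\<close>
      have "(\<Prod>i<n. cmod (1 - of_real (l i) * of_real r * cis t)) \<noteq> 0"
      proof
        assume "(\<Prod>i<n. cmod (1 - of_real (l i) * of_real r * cis t)) = 0"
        with less_le_trans[OF 1 bd[OF r t]] show False by (simp only: mult_zero_left less_irrefl)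
      qed
      then have lp: "0 < cmod (1 - of_real (l i) * of_real r * cis t)" if "i < n" for i
        using prod_zero[of "{..<n}" "\<lambda>i. cmod (1 - of_real (l i) * of_real r * cis t)"] that
        by (metis finite_lessThan lessThan_iff norm_ge_zero order_le_less)
      have 2: "0 < (\<Prod>i<n. cmod (1 - of_real (l i) * of_real r * cis t))" by (rule prod_pos) (use lp in auto)
      have "ln (\<Prod>j<N. cmod (1 - m j * of_real r * cis t)) \<le>
          ln ((\<Prod>i<n. cmod (1 - of_real (l i) * of_real r * cis t)) * (\<Prod>k<n. 1 + y * \<tau> k))"
        using bd[OF r t] 1 2 f by (subst ln_le_cancel_iff) (auto simp: y_def \<sigma>_def)
      also have "\<dots> = ln (\<Prod>i<n. cmod (1 - of_real (l i) * of_real r * cis t)) + ln (\<Prod>k<n. 1 + y * \<tau> k)"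
        using 2 f by (intro ln_mult_pos) auto
      finally have lnle: "ln (\<Prod>j<N. cmod (1 - m j * of_real r * cis t)) \<le> \<dots>" .
      have A: "(\<Sum>j<N. ln (cmod (1 - m j * of_real r * cis t))) \<le>
          (\<Sum>i<n. ln (cmod (1 - of_real (l i) * of_real r * cis t))) + (\<Sum>k<n. ln (1 + y * \<tau> k))"
      proof -
        have "ln (\<Prod>j<N. cmod (1 - m j * of_real r * cis t)) = (\<Sum>j<N. ln (cmod (1 - m j * of_real r * cis t)))"
          by (rule ln_prod) (use mp in auto)
        moreover have "ln (\<Prod>i<n. cmod (1 - of_real (l i) * of_real r * cis t)) = (\<Sum>i<n. ln (cmod (1 - of_real (l i) * of_real r * cis t)))"
          by (rule ln_prod) (use lp in auto)
        moreover have "ln (\<Prod>k<n. 1 + y * \<tau> k) = (\<Sum>k<n. ln (1 + y * \<tau> k))"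
          by (rule ln_prod[OF finite_lessThan]) (metis yp less_irrefl)
        ultimately show ?thesis using lnle by (simp only:)
      qed
      have "(\<Sum>k<n. ln (1 + y * \<tau> k)) \<le> (\<Sum>k<n. y powr p / p * \<tau> k powr p)"
      proof (rule sum_mono)
        fix k
        have "ln (1 + y * \<tau> k) \<le> (y * \<tau> k) powr p / p"
          using y \<tau> p by (intro ln_one_plus_le_powr) auto
        also have "\<dots> = y powr p / p * \<tau> k powr p" using y \<tau> by (simp add: powr_mult)
        finally show "ln (1 + y * \<tau> k) \<le> y powr p / p * \<tau> k powr p" .
      qed
      also have "\<dots> = y powr p / p * (\<Sum>k<n. \<tau> k powr p)" by (simp add: sum_distrib_left)
      also have "\<dots> \<le> y powr p / p * Sp p"
        unfolding Sp_def using p by (intro mult_left_mono sum_le_suminf summ) auto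
      also have "y powr p = (2 * M) powr p * r powr p * \<sigma> powr (- p)"
        using r M \<sigma> by (simp add: y_def powr_divide powr_mult powr_minus_divide)
      also have "(2 * M) powr p * r powr p * \<sigma> powr (- p) / p * Sp p \<le>
          (2 * M) powr p * r powr p * (4 powr p * (t powr (- p) + (2 * pi - t) powr (- p))) / p * Sp p"
        unfolding \<sigma>_def using p t Sp0[of p]
        by (intro mult_right_mono divide_right_mono mult_left_mono sin_half_powr_le) auto
      also have "\<dots> = r powr p * g p t" by (simp add: g_def mult_ac)
      finally show ?thesis using A by linarith
    qed
    have "f0 * (\<Sum>i<n. \<Psi> R i) \<le> K"
      unfolding f0_def \<Psi>_def K_def
    proof (rule zeros_weighted_sum_le[where m = m and N = N])
      show "0 < s" "s < 1" using s by auto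
      show "s < p1" "p2 < s" by (rule p)+
      show "0 \<le> w k" if "k \<in> {1..<d}" for k using that by (simp add: w_def divide_le_eq)
      show "0 \<le> 1 + (\<Sum>k=1..<d. w k * cos (real k * t))" for t
        unfolding w_def by (rule fejer_kernel_nonneg)
      show "0 \<le> g p1 t" "0 \<le> g p2 t" for t using p by (auto intro: g0)
      show "(g p1 has_integral I p1) {0..2 * pi}" "(g p2 has_integral I p2) {0..2 * pi}" using p by (auto intro: gI)
    qed (use R l m lower p in auto)
    moreover have "(\<Sum>i<q. \<Psi> R i) \<le> (\<Sum>i<n. \<Psi> R i)"
      using n \<Psi>0[OF R(1)] by (intro sum_mono2) auto
    ultimately show ?thesis using f0 by (meson mult_left_mono less_imp_le order_trans)
  qed
  \<comment> \<open>Radii tending to infinity that avoid the countably many reciprocals 1 / l i, as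
    the boundary circle must not meet a singularity.\<close>
  have "\<exists>R. real k + 1 \<le> R \<and> (\<forall>i. R * l i \<noteq> 1)" for k
  proof -
    have "uncountable ({real k + 1..real k + 2} - range (\<lambda>i. 1 / l i))"
      by (intro uncountable_minus_countable countable_image) (auto simp: uncountable_closed_interval)
    then have "{real k + 1..real k + 2} - range (\<lambda>i. 1 / l i) \<noteq> {}" by (metis countable_empty)
    then obtain R where "R \<in> {real k + 1..real k + 2} - range (\<lambda>i. 1 / l i)" by blast
    then have R: "real k + 1 \<le> R" "R \<notin> range (\<lambda>i. 1 / l i)" by simp_all
    have "R * l i \<noteq> 1" for i
    proof
      assume *: "R * l i = 1"
      then have "l i \<noteq> 0" by auto
      with * have "R = 1 / l i" by (simp add: eq_divide_eq)
      then show False using R(2) by blast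
    qed
    then show ?thesis using R(1) by blast
  qed
  then obtain \<rho> where \<rho>: "\<And>k. real k + 1 \<le> \<rho> k" "\<And>k i. \<rho> k * l i \<noteq> 1" by metis
  have \<rho>lim: "filterlim \<rho> at_top sequentially"
  proof (rule filterlim_at_top_mono[OF filterlim_real_sequentially])
    have "real k \<le> \<rho> k" for k using \<rho>(1)[of k] by simp
    then show "eventually (\<lambda>k. real k \<le> \<rho> k) sequentially" by simp
  qed
  have \<Psi>lim: "(\<lambda>k. \<Psi> (\<rho> k) i) \<longlonglongrightarrow> l i powr s" for i
  proof (cases "l i = 0")
    case True
    then show ?thesis by (simp add: \<Psi>_def)
  next
    case False
    then have li: "l i > 0" using l[of i] by simp
    have "(\<lambda>k. radial_kernel s (\<rho> k) (1 / l i) - 2 * s * \<rho> k powr (- s) * ln (\<rho> k * l i)) \<longlonglongrightarrow> l i powr s"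
      using s li by (intro filterlim_compose[OF radial_kernel_ln_tendsto \<rho>lim]) auto
    moreover have "eventually (\<lambda>k. \<rho> k > 1 / l i) sequentially"
      using \<rho>lim by (simp add: filterlim_at_top_dense)
    then have "eventually (\<lambda>k. radial_kernel s (\<rho> k) (1 / l i) - 2 * s * \<rho> k powr (- s) * ln (\<rho> k * l i) = \<Psi> (\<rho> k) i) sequentially"
    proof eventually_elim
      case (elim k)
      then have "1 < \<rho> k * l i" using li by (simp add: divide_less_eq)
      then show ?case by (simp add: \<Psi>_def)
    qed
    ultimately show ?thesis by (rule Lim_transform_eventually)
  qed
  have bounded: "(\<Sum>i<q. l i powr s) \<le> K / f0" for q
  proof -
    have "(\<lambda>k. f0 * (\<Sum>i<q. \<Psi> (\<rho> k) i)) \<longlonglongrightarrow> f0 * (\<Sum>i<q. l i powr s)"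
      by (intro tendsto_mult tendsto_const tendsto_sum \<Psi>lim)
    moreover have "f0 * (\<Sum>i<q. \<Psi> (\<rho> k) i) \<le> K" for k
    proof (rule main)
      show "1 \<le> \<rho> k" using \<rho>(1)[of k] by simp
    qed (rule \<rho>(2))
    ultimately have "f0 * (\<Sum>i<q. l i powr s) \<le> K" by (intro LIMSEQ_le_const2) auto
    then show ?thesis using f0 by (simp add: le_divide_eq mult.commute)
  qed
  show ?thesis by (rule summableI_nonneg_bounded[OF _ bounded]) simp
qed

section \<open>Truncating C + T and the contradiction with the asymptotics of C\<close>

theorem theorem2p1:
  fixes A C T :: "'a :: complex_hilbert_space \<Rightarrow> 'a"
    and \<alpha> a :: real
  assumes A_eq: "A = (\<lambda>x. C x + T x)"
    and C_nonneg: "nonneg_operator C"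
    and C_compact: "compact_operator C"
    and C_lim_infinite: "filterlim (\<lambda>n. real n ^ 2 * s_number C n) at_top sequentially"
    and \<alpha>: "0 < \<alpha>" "\<alpha> < 2"
    and a: "0 < a"
    and C_lim: "(\<lambda>n. real n powr \<alpha> * s_number C n) \<longlonglongrightarrow> a"
    and T_schatten: "\<And>q :: real. 0 < q \<Longrightarrow> q \<le> 1 / \<alpha> \<Longrightarrow> T \<in> schatten_class q"
  shows "\<not> volterra_operator A"
proof
  assume volterra: "volterra_operator A"
  have half: "1 / 2 < 1 / \<alpha>" using \<alpha> by (simp add: field_simps)
  have T: "compact_operator T" using T_schatten[of "1 / \<alpha>"] \<alpha> by (simp add: schatten_class_def)
  obtain t e where e: "semi_orthonormal e" and t: "decseq t" "\<And>i. 0 \<le> t i" "t \<longlonglongrightarrow> 0"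
    and Te: "\<And>i. norm (T (e i)) = t i"
    and Trem: "\<And>n x. norm (T x - (\<Sum>i<n. cinner x (e i) *\<^sub>C T (e i))) \<le> t n * norm x"
    and sT: "\<And>n. s_number T (Suc n) = t n"
    using compact_operator_svd[OF T] by blast
  obtain l v where sp: "spectral_seq C l v" and sC: "\<And>n. s_number C (Suc n) = l n"
    using nonneg_compact_spectral_seq[OF C_nonneg C_compact] by blast
  note sp' = spectral_seqD[OF sp]
  \<comment> \<open>Each s-number of T is shared evenly between the two vectors of its rank-one
    term, so that both have norm at most tau.\<close>
  define \<tau> where "\<tau> i = sqrt (t i)" for i
  have \<tau>0: "0 \<le> \<tau> i" for i by (simp add: \<tau>_def t)
  have summ: "summable (\<lambda>i. \<tau> i powr p)" if "0 < p" "p \<le> 1" for p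
  proof -
    \<comment> \<open>p / 2 <= 1/2 < 1 / alpha: by alpha < 2 the exponent is in the range of the
      hypothesis on T.\<close>
    have "T \<in> schatten_class (p / 2)" using that half by (intro T_schatten) auto
    then have "summable (\<lambda>j. t j powr (p / 2))" by (simp add: schatten_class_def sT)
    moreover have "t j powr (p / 2) = \<tau> j powr p" for j
      using t(2)[of j] by (simp add: \<tau>_def powr_half_sqrt[symmetric] powr_powr)
    ultimately show ?thesis by simp
  qed
  define M where "M = (\<Sum>i. \<tau> i)"
  have "summable \<tau>" using summ[of 1] \<tau>0 by simp
  then have M: "0 \<le> M" "\<And>n. (\<Sum>j<n. \<tau> j) \<le> M"
    unfolding M_def using \<tau>0 by (auto intro: suminf_nonneg sum_le_suminf)
  define \<phi> where "\<phi> j = \<tau> j *\<^sub>R e j" for j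
  \<comment> \<open>Where tau j = 0 the quotient is 0 by convention, in agreement with T (e j) =
    0.\<close>
  define \<psi> where "\<psi> j = (1 / \<tau> j) *\<^sub>R T (e j)" for j
  have ne: "norm (e i) \<le> 1" for i
    using norm_semi_orthonormal[OF e, of i] by (cases "e i = 0") simp_all
  have n\<phi>: "norm (\<phi> j) \<le> \<tau> j" for j
    using mult_left_mono[OF ne[of j] \<tau>0[of j]] \<tau>0[of j] by (simp add: \<phi>_def)
  have n\<psi>: "norm (\<psi> j) \<le> \<tau> j" for j
    using t(2)[of j] by (simp add: \<psi>_def Te \<tau>_def real_div_sqrt)
  have \<phi>\<psi>: "cinner x (\<phi> j) *\<^sub>C \<psi> j = cinner x (e j) *\<^sub>C T (e j)" for x j
  proof (cases "\<tau> j = 0")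
    case True
    then have "t j = 0" using t(2)[of j] by (simp add: \<tau>_def)
    then have "T (e j) = 0" using Te[of j] by simp
    then show ?thesis by (simp add: \<psi>_def)
  next
    case False
    then show ?thesis
      by (simp add: \<phi>_def \<psi>_def scaleR_eq_scaleC scaleC_scaleC cinner_scaleC_right)
  qed
  define B where "B n x = (\<Sum>i<n. (of_real (l i) * cinner x (v i)) *\<^sub>C v i) + (\<Sum>j<n. cinner x (\<phi> j) *\<^sub>C \<psi> j)" for n x
  have BC: "B n (c *\<^sub>C x) = c *\<^sub>C B n x" for n c x
    by (simp add: B_def scaleC_add_right complex_vector.scale_sum_right cinner_scaleC_left scaleC_scaleC mult_ac)
  have close: "norm (A x - B n x) \<le> (l n + t n) * norm x" for n x
  proof -
    have "A x - B n x = (C x - (\<Sum>i<n. (of_real (l i) * cinner x (v i)) *\<^sub>C v i)) +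
        (T x - (\<Sum>i<n. cinner x (e i) *\<^sub>C T (e i)))"
      by (simp add: A_eq B_def \<phi>\<psi>)
    then have "norm (A x - B n x) \<le> l n * norm x + t n * norm x"
      using norm_triangle_mono[OF sp'(7)[of x n] Trem[of x n]] by simp
    then show ?thesis by (simp add: distrib_right)
  qed
  have lim: "(\<lambda>n. l n + t n) \<longlonglongrightarrow> 0" using tendsto_add[OF sp'(4) t(3)] by simp
  have approx: "eventually (disc_bound l \<tau> M R) sequentially" if R: "1 \<le> R" for R
  proof -
    have "0 < R" using R by simp
    have "eventually (\<lambda>n. \<forall>\<mu> x. x \<noteq> 0 \<longrightarrow> B n x = \<mu> *\<^sub>C x \<longrightarrow> R * cmod \<mu> < 1) sequentially"
      by (rule volterra_approx_eigenvalues[OF volterra BC close lim \<open>0 < R\<close>])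
    then show ?thesis
    proof eventually_elim
      case (elim n)
      have l0: "l i = 0" if "v i = 0" for i using that sp'(5) by simp
      have "\<exists>\<mu>s. (\<forall>\<mu>\<in>set \<mu>s. \<mu> \<noteq> 0 \<longrightarrow> (\<exists>x. x \<noteq> 0 \<and> B n x = \<mu> *\<^sub>C x)) \<and>
        (\<forall>r t. 0 < r \<longrightarrow> 0 < t \<longrightarrow> t < 2 * pi \<longrightarrow>
          cmod (\<Prod>\<mu>\<leftarrow>\<mu>s. 1 - \<mu> * of_real r * cis t) \<le> (\<Prod>i<n. cmod (1 - of_real (l i) * of_real r * cis t)) *
            (\<Prod>k<n. 1 + 2 * r * M / sin (t / 2) * \<tau> k))"
        unfolding B_def by (rule finite_rank_determinant_bound[OF sp'(1,3) l0 n\<phi> n\<psi> M(2)])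
      then obtain \<mu>s where \<mu>s: "(\<forall>\<mu>\<in>set \<mu>s. \<mu> \<noteq> 0 \<longrightarrow> (\<exists>x. x \<noteq> 0 \<and> B n x = \<mu> *\<^sub>C x)) \<and>
        (\<forall>r t. 0 < r \<longrightarrow> 0 < t \<longrightarrow> t < 2 * pi \<longrightarrow>
          cmod (\<Prod>\<mu>\<leftarrow>\<mu>s. 1 - \<mu> * of_real r * cis t) \<le> (\<Prod>i<n. cmod (1 - of_real (l i) * of_real r * cis t)) *
            (\<Prod>k<n. 1 + 2 * r * M / sin (t / 2) * \<tau> k))"
        by (rule exE)
      note ev = conjunct1[OF \<mu>s, THEN bspec, THEN mp] and bd = conjunct2[OF \<mu>s]
      \<comment> \<open>An eigenvector of the truncation is supplied only for non-zero mu; for mu =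
        0 the estimate is trivial.\<close>
      have small: "R * cmod \<mu> < 1" if mem: "\<mu> \<in> set \<mu>s" for \<mu>
      proof (cases "\<mu> = 0")
        case False
        then obtain x where "x \<noteq> 0" "B n x = \<mu> *\<^sub>C x" using ev[OF mem] by blast
        then show ?thesis using elim by blast
      qed simp
      have prod: "cmod (\<Prod>\<mu>\<leftarrow>xs. f \<mu>) = (\<Prod>j<length xs. cmod (f (xs ! j)))" for f xs
        by (induction xs) (simp_all add: prod.lessThan_Suc_shift norm_mult del: prod.lessThan_Suc)
      show ?case
        unfolding disc_bound_def
      proof (intro exI[of _ "length \<mu>s"] exI[of _ "\<lambda>j. \<mu>s ! j"] conjI allI impI)
        show "R * cmod (\<mu>s ! j) < 1" if "j < length \<mu>s" for j using that by (intro small nth_mem)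
      qed (use bd in \<open>simp add: prod\<close>)
    qed
  qed
  \<comment> \<open>The midpoint of 1/2 and the smaller of 1 and 1 / alpha; the interval is
    non-empty because alpha < 2.\<close>
  define s where "s = (1 / 2 + min 1 (1 / \<alpha>)) / 2"
  have s: "1 / 2 < s" "s < 1" "s < 1 / \<alpha>" using half by (auto simp: s_def min_def)
  have "summable (\<lambda>i. l i powr s)"
    by (rule power_sum_summable[OF s(1,2) sp'(3) \<tau>0 M(1) summ approx])
  \<comment> \<open>The limit of n^alpha s_n(C) makes l_n^s at least a multiple of (n + 1)^(- alpha
    s), hence of 1 / (n + 1) because s alpha <= 1.\<close>
  moreover have "eventually (\<lambda>n. norm ((a / 2) powr s * inverse (real (Suc n))) \<le> l n powr s) sequentially"
  proof -
    have "eventually (\<lambda>n. a / 2 < real n powr \<alpha> * s_number C n) sequentially"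
      using C_lim a by (intro order_tendstoD(1)[OF C_lim]) simp
    \<comment> \<open>Index shift: s-numbers are counted from 1, the sequence \<open>l\<close> from
      0.\<close>
    then have "eventually (\<lambda>n. a / 2 < real (Suc n) powr \<alpha> * s_number C (Suc n)) sequentially"
      by (simp only: eventually_sequentially_Suc[where P = "\<lambda>n. a / 2 < real n powr \<alpha> * s_number C n"])
    then show ?thesis
    proof eventually_elim
      case (elim n)
      have "(a / 2) powr s \<le> (real (Suc n) powr \<alpha> * l n) powr s"
        using elim a s by (intro powr_mono2) (auto simp: sC)
      also have "\<dots> = real (Suc n) powr (\<alpha> * s) * l n powr s"
        using sp'(3)[of n] by (simp add: powr_mult powr_powr)
      also have "\<dots> \<le> real (Suc n) powr 1 * l n powr s"
      proof (intro mult_right_mono powr_mono)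
        have "\<alpha> * s \<le> \<alpha> * (1 / \<alpha>)" using s \<alpha> by (intro mult_left_mono) auto
        then show "\<alpha> * s \<le> 1" using \<alpha> by simp
      qed auto
      finally have "(a / 2) powr s \<le> real (Suc n) * l n powr s" by simp
      then show ?case by (simp add: inverse_eq_divide divide_le_eq mult.commute)
    qed
  qed
  ultimately have "summable (\<lambda>n. (a / 2) powr s * inverse (real (Suc n)))"
    by (rule summable_comparison_test_ev[rotated])
  then have "summable (\<lambda>n. inverse (real (Suc n)))"
    using a by (subst (asm) summable_cmult_iff) auto
  then have "summable (\<lambda>n. inverse (real n))"
    by (subst (asm) summable_Suc_iff)
  then show False using not_summable_harmonic[where 'a = real] by blast
qed

end
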